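(* Let $k$ be a field and let $\mathcal{C}=(\mathcal{C},\mathbb{E},\mathfrak{s},\mathbb{E}^{-1})$ be a $k$-linear Krull--Schmidt extriangulated category with a negative first extension. Let $\Theta=(\Theta(1),\ldots,\Theta(t))$ be a mixed standardizable set in $\mathcal{C}$ such that $\mathrm{add}\,\Theta$ is $\mathbb{E}$-finite. If $\mathcal{F}(\Theta)$ admits a finite sequence of universal extensions by $\Theta$, then the following statements hold. (1) For each $i\in[1,t]$, there exists an $\mathfrak{s}$-conflation $K(i)\to P(i)\xrightarrow{\alpha_i}\Theta(i)\dashrightarrow$ such that $K(i)\in\mathcal{F}(\Theta(i)\oplus\cdots\oplus\Theta(t))$, $P(i)$ is an indecomposable projective object in $\mathcal{F}(\Theta)$ and $\alpha_i$ is right minimal. (2) Let $\mathbb{P}:=(P(1),\ldots,P(t))$. Then $(\Theta,\mathbb{P})$ is a mixed stratifying system in $\mathcal{C}$.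
   Context: All categories are skeletally small; subcategories are full and closed under isomorphisms. Extriangulated categories $(\mathcal{C},\mathbb{E},\mathfrak{s})$ are in the sense of Nakaoka--Palu: $\mathcal{C}$ is additive, $\mathbb{E}:\mathcal{C}^{op}\times\mathcal{C}\to\mathrm{Ab}$ is an additive bifunctor, and $\mathfrak{s}$ assigns to each $\delta\in\mathbb{E}(C,A)$ an equivalence class $[A\to B\to C]$ of complexes, subject to their axioms. If $\mathfrak{s}(\delta)=[A\xrightarrow{f}B\xrightarrow{g}C]$, then $A\xrightarrow{f}B\xrightarrow{g}C\overset{\delta}{\dashrightarrow}$ is an $\mathfrak{s}$-conflation. A negative first extension on $\mathcal{C}$ is an additive bifunctor $\mathbb{E}^{-1}:\mathcal{C}^{op}\times\mathcal{C}\to\mathrm{Ab}$ together with, for each $\delta\in\mathbb{E}(C,A)$, natural transformations $\mathbb{E}^{-1}(-,C)\to\mathcal{C}(-,A)$ and $\mathbb{E}^{-1}(A,-)\to\mathcal{C}(C,-)$ such that for every $\mathfrak{s}$-conflation $A\to B\to C\overset{\delta}{\dashrightarrow}$ and every $W$ the sequences $\mathbb{E}^{-1}(W,A)\to\mathbb{E}^{-1}(W,B)\to\mathbb{E}^{-1}(W,C)\to\mathcal{C}(W,A)\to\mathcal{C}(W,B)$ and $\mathbb{E}^{-1}(C,W)\to\mathbb{E}^{-1}(B,W)\to\mathbb{E}^{-1}(A,W)\to\mathcal{C}(C,W)\to\mathcal{C}(B,W)$ are exact. A subcategory $\mathcal{E}$ is $\mathbb{E}$-finite if $\mathbb{E}(M,N)$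 is finite dimensional over $k$ for all $M,N\in\mathcal{E}$. $\mathcal{X}*\mathcal{Y}$ is the subcategory of all $M$ with an $\mathfrak{s}$-conflation $X\to M\to Y\dashrightarrow$, $X\in\mathcal{X}$, $Y\in\mathcal{Y}$. A subcategory $\mathcal{E}$ is extension-closed if $\mathcal{E}*\mathcal{E}\subseteq\mathcal{E}$. $\mathcal{F}(M):=\bigcup_{l>0}\mathrm{add}\,M*\cdots*\mathrm{add}\,M$ ($l$ factors). An ordered set of objects is identified with the direct sum of its members. An object $P\in\mathcal{X}$ is projective in an extension-closed subcategory $\mathcal{X}$ if $\mathbb{E}(P,\mathcal{X})=0$. A brick is an object whose endomorphism ring is a division ring; a stone is an indecomposable object $M$ with $\mathbb{E}(M,M)=0$. $\Theta$ is a mixed standardizable set if: (MS1) each $\Theta(i)$ is a brick or a stone; (MS2) $\mathcal{C}(\Theta(i),\Theta(j))=0$ for $i>j$; (MS3) $\mathbb{E}(\Theta(i),\Theta(j))=0$ for $i>j$; (MS4) $\mathbb{E}^{-1}(\Theta,\Theta)=0$. Universal extensions: for an object $N$, let $D_N:=\mathrm{End}_{\mathcal{C}}(N)^{op}$ if $N$ is a brick and $D_N:=k$ otherwise; $\mathbb{E}(M,N)$ is a right $D_N$-module. If $d=\dim_{D_N}\mathbb{E}(M,N)<\infty$ and $d>0$, choose a $D_N$-basis $\delta_1,\dots,\delta_d$; the $D_N$-universal extension of $M$ by $N$ is the $\mathfrak{s}$-conflation $N^{\oplus d}\to E\to M\overset{\delta}{\dashrightarrow}$ with $\delta=(\delta_1,\dots,\delta_d)\in\mathbb{E}(M,N)^{d}\cong\mathbb{E}(M,N^{\oplus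 d})$; if $d=0$ it is $0\to M\xrightarrow{1}M\dashrightarrow$. Given $M,N$ with $\dim_{D_N}\mathbb{E}(M\oplus N,N)<\infty$, put $P_0:=M$ and iteratively let $N^{\oplus d_s}\to P_s\xrightarrow{a_s}P_{s-1}\dashrightarrow$ be the $D_N$-universal extension of $P_{s-1}$ by $N$ ($s\ge1$). For indecomposable $N$, an extension-closed subcategory $\mathcal{E}$ containing $N$ with $\dim_{D_N}\mathbb{E}(M,N)<\infty$ for all $M\in\mathcal{E}$ admits a finite sequence of universal extensions by $N$ if for each $M\in\mathcal{E}$ there is $s\ge1$ with $a_s$ an isomorphism. $\mathcal{E}$ admits a finite sequence of universal extensions by $\Theta$ (all $\Theta(i)$ indecomposable, contained in $\mathcal{E}$, with the corresponding finiteness) if it does so by every $\Theta(i)$. A mixed stratifying system $(\Theta,\mathbb{P})$ consists of an ordered set $\Theta$ of objects satisfying (MS1), (MS2), (MS4) and an ordered set $\mathbb{P}=(P(1),\dots,P(t))$ of indecomposable objects with $\mathfrak{s}$-conflations $K(i)\to P(i)\to\Theta(i)\dashrightarrow$, $K(i)\in\mathcal{F}(\Theta(i)\oplus\cdots\oplus\Theta(t))$, $\mathbb{E}(P(i),\mathcal{F}(\Theta))=0$, for each $i\in[1,t]$. *)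

theory Defs
  imports Complex_Main "HOL-Library.FuncSet"
begin

text \<open>
  Objects are the elements of a type \<open>'o\<close>.  All morphism spaces \<open>Hom A B\<close> are subspaces of one
  ambient vector space \<open>'m\<close> over the field \<open>'k\<close>, all extension spaces are subspaces of \<open>'e\<close>, and all
  negative extension groups are subgroups of \<open>'n\<close>.  They need not be disjoint.  This loses no generality
  for a small category: take the direct sum of all the spaces concerned as the ambient space, and
  extend composition and the two actions by zero.  Since an element of \<open>'m\<close> does not determine its
  source and target, these are passed explicitly where they matter.
\<close>

record ('o, 'm, 'k) linear_cat =
  Hom :: "'o \<Rightarrow> 'o \<Rightarrow> 'm set"
  Ident :: "'o \<Rightarrow> 'm"
  Comp :: "'m \<Rightarrow> 'm \<Rightarrow> 'm" (infixl "\<cdot>\<index>" 75)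
  hscale :: "'k \<Rightarrow> 'm \<Rightarrow> 'm"

text \<open>
  \<open>Ext C A\<close> is \<open>\<bbbE>(C,A)\<close>, contravariant in \<open>C\<close> and covariant in \<open>A\<close>; \<open>push a \<delta>\<close> is \<open>a\<^sub>*\<delta>\<close> and
  \<open>pull c \<delta>\<close> is \<open>c\<^sup>*\<delta>\<close>.  \<open>Realiz C A \<delta>\<close> is the class \<open>\<ss>(\<delta>)\<close>, a set of triples
  \<open>(B, x, y)\<close> standing for \<open>A \<rightarrow> B \<rightarrow> C\<close>.
\<close>

record ('o, 'm, 'k, 'e) extri_cat = "('o, 'm, 'k) linear_cat" +
  Ext :: "'o \<Rightarrow> 'o \<Rightarrow> 'e set"
  escale :: "'k \<Rightarrow> 'e \<Rightarrow> 'e"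
  push :: "'m \<Rightarrow> 'e \<Rightarrow> 'e"
  pull :: "'m \<Rightarrow> 'e \<Rightarrow> 'e"
  Realiz :: "'o \<Rightarrow> 'o \<Rightarrow> 'e \<Rightarrow> ('o \<times> 'm \<times> 'm) set"

text \<open>
  For \<open>\<delta> \<in> Ext C A\<close>, \<open>conn_cov C A \<delta> W\<close> is the map \<open>\<bbbE>\<^sup>-\<^sup>1(W,C) \<rightarrow> Hom W A\<close> and
  \<open>conn_contra C A \<delta> W\<close> is the map \<open>\<bbbE>\<^sup>-\<^sup>1(A,W) \<rightarrow> Hom C W\<close>.
\<close>

record ('o, 'm, 'k, 'e, 'n) neg_extri_cat = "('o, 'm, 'k, 'e) extri_cat" +
  NExt :: "'o \<Rightarrow> 'o \<Rightarrow> 'n set"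
  npush :: "'m \<Rightarrow> 'n \<Rightarrow> 'n"
  npull :: "'m \<Rightarrow> 'n \<Rightarrow> 'n"
  conn_cov :: "'o \<Rightarrow> 'o \<Rightarrow> 'e \<Rightarrow> 'o \<Rightarrow> 'n \<Rightarrow> 'm"
  conn_contra :: "'o \<Rightarrow> 'o \<Rightarrow> 'e \<Rightarrow> 'o \<Rightarrow> 'n \<Rightarrow> 'm"


section \<open>Krull--Schmidt linear categories\<close>

definition is_iso :: "('o, 'm, 'k, 'z) linear_cat_scheme \<Rightarrow> 'o \<Rightarrow> 'o \<Rightarrow> 'm \<Rightarrow> bool" where
  "is_iso \<C> A B f \<longleftrightarrow> f \<in> Hom \<C> A B \<and>
     (\<exists>g\<in>Hom \<C> B A. g \<cdot>\<^bsub>\<C>\<^esub> f = Ident \<C> A \<and> f \<cdot>\<^bsub>\<C>\<^esub> g = Ident \<C> B)"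

definition iso_closed :: "('o, 'm, 'k, 'z) linear_cat_scheme \<Rightarrow> 'o set \<Rightarrow> bool" where
  "iso_closed \<C> \<X> \<longleftrightarrow> (\<forall>A B f. A \<in> \<X> \<longrightarrow> is_iso \<C> A B f \<longrightarrow> B \<in> \<X>)"

definition zero_object :: "('o, 'm::ab_group_add, 'k, 'z) linear_cat_scheme \<Rightarrow> 'o \<Rightarrow> bool" where
  "zero_object \<C> Z \<longleftrightarrow> (\<forall>A. Hom \<C> A Z = {0} \<and> Hom \<C> Z A = {0})"

definition biproduct ::
  "('o, 'm::ab_group_add, 'k, 'z) linear_cat_scheme \<Rightarrow> 'o \<Rightarrow> 'o \<Rightarrow> 'o \<Rightarrow> 'm \<Rightarrow> 'm \<Rightarrow> 'm \<Rightarrow> 'm \<Rightarrow> bool" where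
  "biproduct \<C> A B S i j p q \<longleftrightarrow>
     i \<in> Hom \<C> A S \<and> j \<in> Hom \<C> B S \<and> p \<in> Hom \<C> S A \<and> q \<in> Hom \<C> S B \<and>
     p \<cdot>\<^bsub>\<C>\<^esub> i = Ident \<C> A \<and> q \<cdot>\<^bsub>\<C>\<^esub> j = Ident \<C> B \<and> p \<cdot>\<^bsub>\<C>\<^esub> j = 0 \<and> q \<cdot>\<^bsub>\<C>\<^esub> i = 0 \<and>
     i \<cdot>\<^bsub>\<C>\<^esub> p + j \<cdot>\<^bsub>\<C>\<^esub> q = Ident \<C> S"

definition direct_sum ::
  "('o, 'm::ab_group_add, 'k, 'z) linear_cat_scheme \<Rightarrow> nat set \<Rightarrow> (nat \<Rightarrow> 'o) \<Rightarrow> 'o \<Rightarrow>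
     (nat \<Rightarrow> 'm) \<Rightarrow> (nat \<Rightarrow> 'm) \<Rightarrow> bool" where
  "direct_sum \<C> I X S \<iota> \<pi> \<longleftrightarrow> finite I \<and>
     (\<forall>i\<in>I. \<iota> i \<in> Hom \<C> (X i) S \<and> \<pi> i \<in> Hom \<C> S (X i)) \<and>
     (\<forall>i\<in>I. \<forall>j\<in>I. \<pi> i \<cdot>\<^bsub>\<C>\<^esub> \<iota> j = (if i = j then Ident \<C> (X i) else 0)) \<and>
     (\<Sum>i\<in>I. \<iota> i \<cdot>\<^bsub>\<C>\<^esub> \<pi> i) = Ident \<C> S"

text \<open>A direct sum is only unique up to isomorphism; one is chosen.\<close>

definition dsum :: "('o, 'm::ab_group_add, 'k, 'z) linear_cat_scheme \<Rightarrow> nat set \<Rightarrow> (nat \<Rightarrow> 'o) \<Rightarrow> 'o" where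
  "dsum \<C> I X = (SOME S. \<exists>\<iota> \<pi>. direct_sum \<C> I X S \<iota> \<pi>)"

definition add_closure :: "('o, 'm::ab_group_add, 'k, 'z) linear_cat_scheme \<Rightarrow> 'o \<Rightarrow> 'o set" where
  "add_closure \<C> M =
     {X. \<exists>n S \<iota> \<pi> Y i j p q. direct_sum \<C> {..<n} (\<lambda>_. M) S \<iota> \<pi> \<and> biproduct \<C> X Y S i j p q}"

definition indecomposable :: "('o, 'm::ab_group_add, 'k, 'z) linear_cat_scheme \<Rightarrow> 'o \<Rightarrow> bool" where
  "indecomposable \<C> M \<longleftrightarrow> \<not> zero_object \<C> M \<and>
     (\<forall>X Y i j p q. biproduct \<C> X Y M i j p q \<longrightarrow> zero_object \<C> X \<or> zero_object \<C> Y)"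

definition local_endomorphism_ring ::
  "('o, 'm::ab_group_add, 'k, 'z) linear_cat_scheme \<Rightarrow> 'o \<Rightarrow> bool" where
  "local_endomorphism_ring \<C> M \<longleftrightarrow> Ident \<C> M \<noteq> 0 \<and>
     (\<forall>f\<in>Hom \<C> M M. \<forall>g\<in>Hom \<C> M M. is_iso \<C> M M (f + g) \<longrightarrow> is_iso \<C> M M f \<or> is_iso \<C> M M g)"

definition brick :: "('o, 'm::ab_group_add, 'k, 'z) linear_cat_scheme \<Rightarrow> 'o \<Rightarrow> bool" where
  "brick \<C> M \<longleftrightarrow> Ident \<C> M \<noteq> 0 \<and> (\<forall>f\<in>Hom \<C> M M. f \<noteq> 0 \<longrightarrow> is_iso \<C> M M f)"

definition right_minimal :: "('o, 'm, 'k, 'z) linear_cat_scheme \<Rightarrow> 'o \<Rightarrow> 'm \<Rightarrow> bool" where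
  "right_minimal \<C> A f \<longleftrightarrow> (\<forall>h\<in>Hom \<C> A A. f \<cdot>\<^bsub>\<C>\<^esub> h = f \<longrightarrow> is_iso \<C> A A h)"

locale linear_category =
  fixes \<C> :: "('o, 'm::ab_group_add, 'k::field, 'z) linear_cat_scheme" (structure)
  assumes hom_ambient: "vector_space (hscale \<C>)"
    and hom_subspace: "module.subspace (hscale \<C>) (Hom \<C> A B)"
    and id_hom: "Ident \<C> A \<in> Hom \<C> A A"
    and comp_hom: "g \<in> Hom \<C> B C \<Longrightarrow> f \<in> Hom \<C> A B \<Longrightarrow> g \<cdot> f \<in> Hom \<C> A C"
    and comp_assoc: "h \<in> Hom \<C> C D \<Longrightarrow> g \<in> Hom \<C> B C \<Longrightarrow> f \<in> Hom \<C> A B \<Longrightarrow> h \<cdot> g \<cdot> f = h \<cdot> (g \<cdot> f)"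
    and id_left: "f \<in> Hom \<C> A B \<Longrightarrow> Ident \<C> B \<cdot> f = f"
    and id_right: "f \<in> Hom \<C> A B \<Longrightarrow> f \<cdot> Ident \<C> A = f"
    and comp_add_left: "g \<in> Hom \<C> B C \<Longrightarrow> g' \<in> Hom \<C> B C \<Longrightarrow> f \<in> Hom \<C> A B \<Longrightarrow>
          (g + g') \<cdot> f = g \<cdot> f + g' \<cdot> f"
    and comp_add_right: "g \<in> Hom \<C> B C \<Longrightarrow> f \<in> Hom \<C> A B \<Longrightarrow> f' \<in> Hom \<C> A B \<Longrightarrow>
          g \<cdot> (f + f') = g \<cdot> f + g \<cdot> f'"
    and comp_scale_left: "g \<in> Hom \<C> B C \<Longrightarrow> f \<in> Hom \<C> A B \<Longrightarrow> hscale \<C> r g \<cdot> f = hscale \<C> r (g \<cdot> f)"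
    and comp_scale_right: "g \<in> Hom \<C> B C \<Longrightarrow> f \<in> Hom \<C> A B \<Longrightarrow> g \<cdot> hscale \<C> r f = hscale \<C> r (g \<cdot> f)"
    and zero_object_exists: "\<exists>Z. zero_object \<C> Z"
    and biproduct_exists: "\<exists>S i j p q. biproduct \<C> A B S i j p q"

locale krull_schmidt_category = linear_category +
  assumes krull_schmidt: "\<exists>n X \<iota> \<pi>. direct_sum \<C> {..<n} X A \<iota> \<pi> \<and> (\<forall>i<n. local_endomorphism_ring \<C> (X i))"


section \<open>Extriangulated categories (Nakaoka--Palu)\<close>

definition complexes ::
  "('o, 'm::ab_group_add, 'k, 'z) linear_cat_scheme \<Rightarrow> 'o \<Rightarrow> 'o \<Rightarrow> ('o \<times> 'm \<times> 'm) set" where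
  "complexes \<C> A C = {(B, x, y). x \<in> Hom \<C> A B \<and> y \<in> Hom \<C> B C \<and> y \<cdot>\<^bsub>\<C>\<^esub> x = 0}"

definition complex_equiv ::
  "('o, 'm::ab_group_add, 'k, 'z) linear_cat_scheme \<Rightarrow> 'o \<Rightarrow> 'o \<Rightarrow> (('o \<times> 'm \<times> 'm) \<times> ('o \<times> 'm \<times> 'm)) set" where
  "complex_equiv \<C> A C = {((B, x, y), (B', x', y')).
     (B, x, y) \<in> complexes \<C> A C \<and> (B', x', y') \<in> complexes \<C> A C \<and>
     (\<exists>b. is_iso \<C> B B' b \<and> b \<cdot>\<^bsub>\<C>\<^esub> x = x' \<and> y' \<cdot>\<^bsub>\<C>\<^esub> b = y)}"

definition conflation ::
  "('o, 'm, 'k, 'e, 'z) extri_cat_scheme \<Rightarrow> 'o \<Rightarrow> 'm \<Rightarrow> 'o \<Rightarrow> 'm \<Rightarrow> 'o \<Rightarrow> 'e \<Rightarrow> bool" where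
  "conflation \<C> A x B y C \<delta> \<longleftrightarrow> \<delta> \<in> Ext \<C> C A \<and> (B, x, y) \<in> Realiz \<C> C A \<delta>"

locale extriangulated_category = linear_category \<C>
  for \<C> :: "('o, 'm::ab_group_add, 'k::field, 'e::ab_group_add, 'z) extri_cat_scheme" (structure) +
  assumes ext_ambient: "vector_space (escale \<C>)"
    and ext_subspace: "module.subspace (escale \<C>) (Ext \<C> C A)"
    and push_ext: "a \<in> Hom \<C> A A' \<Longrightarrow> \<delta> \<in> Ext \<C> C A \<Longrightarrow> push \<C> a \<delta> \<in> Ext \<C> C A'"
    and pull_ext: "c \<in> Hom \<C> C' C \<Longrightarrow> \<delta> \<in> Ext \<C> C A \<Longrightarrow> pull \<C> c \<delta> \<in> Ext \<C> C' A"
    and push_id: "\<delta> \<in> Ext \<C> C A \<Longrightarrow> push \<C> (Ident \<C> A) \<delta> = \<delta>"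
    and pull_id: "\<delta> \<in> Ext \<C> C A \<Longrightarrow> pull \<C> (Ident \<C> C) \<delta> = \<delta>"
    and push_comp: "a' \<in> Hom \<C> A' A'' \<Longrightarrow> a \<in> Hom \<C> A A' \<Longrightarrow> \<delta> \<in> Ext \<C> C A \<Longrightarrow>
          push \<C> (a' \<cdot> a) \<delta> = push \<C> a' (push \<C> a \<delta>)"
    and pull_comp: "c \<in> Hom \<C> C' C \<Longrightarrow> c' \<in> Hom \<C> C'' C' \<Longrightarrow> \<delta> \<in> Ext \<C> C A \<Longrightarrow>
          pull \<C> (c \<cdot> c') \<delta> = pull \<C> c' (pull \<C> c \<delta>)"
    and push_pull: "a \<in> Hom \<C> A A' \<Longrightarrow> c \<in> Hom \<C> C' C \<Longrightarrow> \<delta> \<in> Ext \<C> C A \<Longrightarrow>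
          push \<C> a (pull \<C> c \<delta>) = pull \<C> c (push \<C> a \<delta>)"
    and push_add: "a \<in> Hom \<C> A A' \<Longrightarrow> \<delta> \<in> Ext \<C> C A \<Longrightarrow> \<delta>' \<in> Ext \<C> C A \<Longrightarrow>
          push \<C> a (\<delta> + \<delta>') = push \<C> a \<delta> + push \<C> a \<delta>'"
    and pull_add: "c \<in> Hom \<C> C' C \<Longrightarrow> \<delta> \<in> Ext \<C> C A \<Longrightarrow> \<delta>' \<in> Ext \<C> C A \<Longrightarrow>
          pull \<C> c (\<delta> + \<delta>') = pull \<C> c \<delta> + pull \<C> c \<delta>'"
    and push_add_hom: "a \<in> Hom \<C> A A' \<Longrightarrow> a' \<in> Hom \<C> A A' \<Longrightarrow> \<delta> \<in> Ext \<C> C A \<Longrightarrow>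
          push \<C> (a + a') \<delta> = push \<C> a \<delta> + push \<C> a' \<delta>"
    and pull_add_hom: "c \<in> Hom \<C> C' C \<Longrightarrow> c' \<in> Hom \<C> C' C \<Longrightarrow> \<delta> \<in> Ext \<C> C A \<Longrightarrow>
          pull \<C> (c + c') \<delta> = pull \<C> c \<delta> + pull \<C> c' \<delta>"
    and push_scale: "a \<in> Hom \<C> A A' \<Longrightarrow> \<delta> \<in> Ext \<C> C A \<Longrightarrow>
          push \<C> a (escale \<C> r \<delta>) = escale \<C> r (push \<C> a \<delta>)"
    and pull_scale: "c \<in> Hom \<C> C' C \<Longrightarrow> \<delta> \<in> Ext \<C> C A \<Longrightarrow>
          pull \<C> c (escale \<C> r \<delta>) = escale \<C> r (pull \<C> c \<delta>)"
    and push_scale_hom: "a \<in> Hom \<C> A A' \<Longrightarrow> \<delta> \<in> Ext \<C> C A \<Longrightarrow>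
          push \<C> (hscale \<C> r a) \<delta> = escale \<C> r (push \<C> a \<delta>)"
    and pull_scale_hom: "c \<in> Hom \<C> C' C \<Longrightarrow> \<delta> \<in> Ext \<C> C A \<Longrightarrow>
          pull \<C> (hscale \<C> r c) \<delta> = escale \<C> r (pull \<C> c \<delta>)"
    and real_class: "\<delta> \<in> Ext \<C> C A \<Longrightarrow> Realiz \<C> C A \<delta> \<in> complexes \<C> A C // complex_equiv \<C> A C"
    and real_morphism: "conflation \<C> A x B y C \<delta> \<Longrightarrow> conflation \<C> A' x' B' y' C' \<delta>' \<Longrightarrow>
          a \<in> Hom \<C> A A' \<Longrightarrow> c \<in> Hom \<C> C C' \<Longrightarrow> push \<C> a \<delta> = pull \<C> c \<delta>' \<Longrightarrow>
          \<exists>b\<in>Hom \<C> B B'. b \<cdot> x = x' \<cdot> a \<and> y' \<cdot> b = c \<cdot> y"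
    and real_split: "biproduct \<C> A C S i j p q \<Longrightarrow> (S, i, q) \<in> Realiz \<C> C A 0"
    and real_sum: "conflation \<C> A x B y C \<delta> \<Longrightarrow> conflation \<C> A' x' B' y' C' \<delta>' \<Longrightarrow>
          biproduct \<C> A A' SA iA jA pA qA \<Longrightarrow> biproduct \<C> B B' SB iB jB pB qB \<Longrightarrow>
          biproduct \<C> C C' SC iC jC pC qC \<Longrightarrow>
          conflation \<C> SA (iB \<cdot> x \<cdot> pA + jB \<cdot> x' \<cdot> qA) SB (iC \<cdot> y \<cdot> pB + jC \<cdot> y' \<cdot> qB) SC
            (push \<C> iA (pull \<C> pC \<delta>) + push \<C> jA (pull \<C> qC \<delta>'))"
    and ET3: "conflation \<C> A x B y C \<delta> \<Longrightarrow> conflation \<C> A' x' B' y' C' \<delta>' \<Longrightarrow>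
          a \<in> Hom \<C> A A' \<Longrightarrow> b \<in> Hom \<C> B B' \<Longrightarrow> b \<cdot> x = x' \<cdot> a \<Longrightarrow>
          \<exists>c\<in>Hom \<C> C C'. c \<cdot> y = y' \<cdot> b \<and> push \<C> a \<delta> = pull \<C> c \<delta>'"
    and ET3_op: "conflation \<C> A x B y C \<delta> \<Longrightarrow> conflation \<C> A' x' B' y' C' \<delta>' \<Longrightarrow>
          b \<in> Hom \<C> B B' \<Longrightarrow> c \<in> Hom \<C> C C' \<Longrightarrow> y' \<cdot> b = c \<cdot> y \<Longrightarrow>
          \<exists>a\<in>Hom \<C> A A'. b \<cdot> x = x' \<cdot> a \<and> push \<C> a \<delta> = pull \<C> c \<delta>'"
    and ET4: "conflation \<C> A f B f' D \<delta> \<Longrightarrow> conflation \<C> B g C g' F \<delta>' \<Longrightarrow>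
          \<exists>E h' d e \<delta>''. conflation \<C> A (g \<cdot> f) C h' E \<delta>'' \<and>
            conflation \<C> D d E e F (push \<C> f' \<delta>') \<and>
            h' \<cdot> g = d \<cdot> f' \<and> e \<cdot> h' = g' \<and>
            pull \<C> d \<delta>'' = \<delta> \<and> push \<C> f \<delta>'' = pull \<C> e \<delta>'"
    and ET4_op: "conflation \<C> D f' B f A \<delta> \<Longrightarrow> conflation \<C> F g' C g B \<delta>' \<Longrightarrow>
          \<exists>E h' d e \<delta>''. conflation \<C> E h' C (f \<cdot> g) A \<delta>'' \<and>
            conflation \<C> F e E d D (pull \<C> f' \<delta>') \<and>
            g \<cdot> h' = f' \<cdot> d \<and> h' \<cdot> e = g' \<and>
            push \<C> d \<delta>'' = \<delta> \<and> pull \<C> f \<delta>'' = push \<C> e \<delta>'"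


section \<open>Negative first extensions\<close>

definition exact_at :: "('a \<Rightarrow> 'b) \<Rightarrow> 'a set \<Rightarrow> ('b \<Rightarrow> 'c::zero) \<Rightarrow> 'b set \<Rightarrow> bool" where
  "exact_at u X v Y \<longleftrightarrow> u ` X = {y \<in> Y. v y = 0}"

locale negative_first_extension = extriangulated_category \<C>
  for \<C> :: "('o, 'm::ab_group_add, 'k::field, 'e::ab_group_add, 'n::ab_group_add, 'z) neg_extri_cat_scheme" (structure) +
  assumes next_zero: "0 \<in> NExt \<C> C A"
    and next_add: "\<eta> \<in> NExt \<C> C A \<Longrightarrow> \<eta>' \<in> NExt \<C> C A \<Longrightarrow> \<eta> + \<eta>' \<in> NExt \<C> C A"
    and next_uminus: "\<eta> \<in> NExt \<C> C A \<Longrightarrow> - \<eta> \<in> NExt \<C> C A"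
    and npush_next: "a \<in> Hom \<C> A A' \<Longrightarrow> \<eta> \<in> NExt \<C> C A \<Longrightarrow> npush \<C> a \<eta> \<in> NExt \<C> C A'"
    and npull_next: "c \<in> Hom \<C> C' C \<Longrightarrow> \<eta> \<in> NExt \<C> C A \<Longrightarrow> npull \<C> c \<eta> \<in> NExt \<C> C' A"
    and npush_id: "\<eta> \<in> NExt \<C> C A \<Longrightarrow> npush \<C> (Ident \<C> A) \<eta> = \<eta>"
    and npull_id: "\<eta> \<in> NExt \<C> C A \<Longrightarrow> npull \<C> (Ident \<C> C) \<eta> = \<eta>"
    and npush_comp: "a' \<in> Hom \<C> A' A'' \<Longrightarrow> a \<in> Hom \<C> A A' \<Longrightarrow> \<eta> \<in> NExt \<C> C A \<Longrightarrow>
          npush \<C> (a' \<cdot> a) \<eta> = npush \<C> a' (npush \<C> a \<eta>)"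
    and npull_comp: "c \<in> Hom \<C> C' C \<Longrightarrow> c' \<in> Hom \<C> C'' C' \<Longrightarrow> \<eta> \<in> NExt \<C> C A \<Longrightarrow>
          npull \<C> (c \<cdot> c') \<eta> = npull \<C> c' (npull \<C> c \<eta>)"
    and npush_npull: "a \<in> Hom \<C> A A' \<Longrightarrow> c \<in> Hom \<C> C' C \<Longrightarrow> \<eta> \<in> NExt \<C> C A \<Longrightarrow>
          npush \<C> a (npull \<C> c \<eta>) = npull \<C> c (npush \<C> a \<eta>)"
    and npush_add: "a \<in> Hom \<C> A A' \<Longrightarrow> \<eta> \<in> NExt \<C> C A \<Longrightarrow> \<eta>' \<in> NExt \<C> C A \<Longrightarrow>
          npush \<C> a (\<eta> + \<eta>') = npush \<C> a \<eta> + npush \<C> a \<eta>'"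
    and npull_add: "c \<in> Hom \<C> C' C \<Longrightarrow> \<eta> \<in> NExt \<C> C A \<Longrightarrow> \<eta>' \<in> NExt \<C> C A \<Longrightarrow>
          npull \<C> c (\<eta> + \<eta>') = npull \<C> c \<eta> + npull \<C> c \<eta>'"
    and npush_add_hom: "a \<in> Hom \<C> A A' \<Longrightarrow> a' \<in> Hom \<C> A A' \<Longrightarrow> \<eta> \<in> NExt \<C> C A \<Longrightarrow>
          npush \<C> (a + a') \<eta> = npush \<C> a \<eta> + npush \<C> a' \<eta>"
    and npull_add_hom: "c \<in> Hom \<C> C' C \<Longrightarrow> c' \<in> Hom \<C> C' C \<Longrightarrow> \<eta> \<in> NExt \<C> C A \<Longrightarrow>
          npull \<C> (c + c') \<eta> = npull \<C> c \<eta> + npull \<C> c' \<eta>"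
    and conn_cov_hom: "\<delta> \<in> Ext \<C> C A \<Longrightarrow> \<eta> \<in> NExt \<C> W C \<Longrightarrow> conn_cov \<C> C A \<delta> W \<eta> \<in> Hom \<C> W A"
    and conn_cov_add: "\<delta> \<in> Ext \<C> C A \<Longrightarrow> \<eta> \<in> NExt \<C> W C \<Longrightarrow> \<eta>' \<in> NExt \<C> W C \<Longrightarrow>
          conn_cov \<C> C A \<delta> W (\<eta> + \<eta>') = conn_cov \<C> C A \<delta> W \<eta> + conn_cov \<C> C A \<delta> W \<eta>'"
    and conn_cov_natural: "\<delta> \<in> Ext \<C> C A \<Longrightarrow> w \<in> Hom \<C> W' W \<Longrightarrow> \<eta> \<in> NExt \<C> W C \<Longrightarrow>
          conn_cov \<C> C A \<delta> W' (npull \<C> w \<eta>) = conn_cov \<C> C A \<delta> W \<eta> \<cdot> w"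
    and conn_contra_hom: "\<delta> \<in> Ext \<C> C A \<Longrightarrow> \<eta> \<in> NExt \<C> A W \<Longrightarrow> conn_contra \<C> C A \<delta> W \<eta> \<in> Hom \<C> C W"
    and conn_contra_add: "\<delta> \<in> Ext \<C> C A \<Longrightarrow> \<eta> \<in> NExt \<C> A W \<Longrightarrow> \<eta>' \<in> NExt \<C> A W \<Longrightarrow>
          conn_contra \<C> C A \<delta> W (\<eta> + \<eta>') = conn_contra \<C> C A \<delta> W \<eta> + conn_contra \<C> C A \<delta> W \<eta>'"
    and conn_contra_natural: "\<delta> \<in> Ext \<C> C A \<Longrightarrow> w \<in> Hom \<C> W W' \<Longrightarrow> \<eta> \<in> NExt \<C> A W \<Longrightarrow>
          conn_contra \<C> C A \<delta> W' (npush \<C> w \<eta>) = w \<cdot> conn_contra \<C> C A \<delta> W \<eta>"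
    and exact_cov: "conflation \<C> A x B y C \<delta> \<Longrightarrow>
          exact_at (npush \<C> x) (NExt \<C> W A) (npush \<C> y) (NExt \<C> W B) \<and>
          exact_at (npush \<C> y) (NExt \<C> W B) (conn_cov \<C> C A \<delta> W) (NExt \<C> W C) \<and>
          exact_at (conn_cov \<C> C A \<delta> W) (NExt \<C> W C) (\<lambda>h. x \<cdot> h) (Hom \<C> W A)"
    and exact_contra: "conflation \<C> A x B y C \<delta> \<Longrightarrow>
          exact_at (npull \<C> y) (NExt \<C> C W) (npull \<C> x) (NExt \<C> B W) \<and>
          exact_at (npull \<C> x) (NExt \<C> B W) (conn_contra \<C> C A \<delta> W) (NExt \<C> A W) \<and>
          exact_at (conn_contra \<C> C A \<delta> W) (NExt \<C> A W) (\<lambda>h. h \<cdot> y) (Hom \<C> C W)"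

locale krull_schmidt_negative_extriangulated_category =
  krull_schmidt_category \<C> + negative_first_extension \<C>
  for \<C> :: "('o, 'm::ab_group_add, 'k::field, 'e::ab_group_add, 'n::ab_group_add, 'z) neg_extri_cat_scheme" (structure)


section \<open>Filtrations and universal extensions\<close>

definition star :: "('o, 'm, 'k, 'e, 'z) extri_cat_scheme \<Rightarrow> 'o set \<Rightarrow> 'o set \<Rightarrow> 'o set" where
  "star \<C> \<X> \<Y> = {M. \<exists>X\<in>\<X>. \<exists>Y\<in>\<Y>. \<exists>f g \<delta>. conflation \<C> X f M g Y \<delta>}"

text \<open>\<open>star_power \<C> \<X> n\<close> has \<open>n + 1\<close> factors; the bracketing is immaterial, as \<open>star\<close> is associative by (ET4).\<close>

primrec star_power :: "('o, 'm, 'k, 'e, 'z) extri_cat_scheme \<Rightarrow> 'o set \<Rightarrow> nat \<Rightarrow> 'o set" where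
  "star_power \<C> \<X> 0 = \<X>"
| "star_power \<C> \<X> (Suc n) = star \<C> \<X> (star_power \<C> \<X> n)"

definition Filt :: "('o, 'm::ab_group_add, 'k, 'e, 'z) extri_cat_scheme \<Rightarrow> 'o \<Rightarrow> 'o set" where
  "Filt \<C> M = (\<Union>n. star_power \<C> (add_closure \<C> M) n)"

definition extension_closed :: "('o, 'm, 'k, 'e, 'z) extri_cat_scheme \<Rightarrow> 'o set \<Rightarrow> bool" where
  "extension_closed \<C> \<X> \<longleftrightarrow> iso_closed \<C> \<X> \<and> star \<C> \<X> \<X> \<subseteq> \<X>"

definition projective_in :: "('o, 'm, 'k, 'e::zero, 'z) extri_cat_scheme \<Rightarrow> 'o set \<Rightarrow> 'o \<Rightarrow> bool" where
  "projective_in \<C> \<X> P \<longleftrightarrow> P \<in> \<X> \<and> (\<forall>X\<in>\<X>. Ext \<C> P X = {0})"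

definition stone :: "('o, 'm::ab_group_add, 'k, 'e::zero, 'z) extri_cat_scheme \<Rightarrow> 'o \<Rightarrow> bool" where
  "stone \<C> M \<longleftrightarrow> indecomposable \<C> M \<and> Ext \<C> M M = {0}"

definition ext_finite :: "('o, 'm, 'k::field, 'e::ab_group_add, 'z) extri_cat_scheme \<Rightarrow> 'o set \<Rightarrow> bool" where
  "ext_finite \<C> \<X> \<longleftrightarrow> (\<forall>M\<in>\<X>. \<forall>N\<in>\<X>. \<exists>B. finite B \<and> module.span (escale \<C>) B = Ext \<C> M N)"

text \<open>
  \<open>D_basis \<C> M N d \<delta>\<close>: the family \<open>\<delta> 0, \<dots>, \<delta> (d - 1)\<close> is a basis of the right \<open>D\<^sub>N\<close>-module \<open>\<bbbE>(M,N)\<close>.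
  For a brick \<open>N\<close> the ring \<open>D\<^sub>N\<close> is the opposite of \<open>End(N)\<close>, which acts from the right by
  \<open>\<delta> f = f\<^sub>*\<delta>\<close>; otherwise \<open>D\<^sub>N\<close> is the ground field.
\<close>

definition D_basis ::
  "('o, 'm::ab_group_add, 'k::field, 'e::ab_group_add, 'z) extri_cat_scheme \<Rightarrow> 'o \<Rightarrow> 'o \<Rightarrow> nat \<Rightarrow> (nat \<Rightarrow> 'e) \<Rightarrow> bool" where
  "D_basis \<C> M N d \<delta> \<longleftrightarrow> (\<forall>i<d. \<delta> i \<in> Ext \<C> M N) \<and>
     (if brick \<C> N
      then \<forall>\<epsilon>\<in>Ext \<C> M N. \<exists>!f. f \<in> {..<d} \<rightarrow>\<^sub>E Hom \<C> N N \<and> \<epsilon> = (\<Sum>i<d. push \<C> (f i) (\<delta> i))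
      else \<forall>\<epsilon>\<in>Ext \<C> M N. \<exists>!r. r \<in> {..<d} \<rightarrow>\<^sub>E UNIV \<and> \<epsilon> = (\<Sum>i<d. escale \<C> (r i) (\<delta> i)))"

definition D_finite ::
  "('o, 'm::ab_group_add, 'k::field, 'e::ab_group_add, 'z) extri_cat_scheme \<Rightarrow> 'o \<Rightarrow> 'o \<Rightarrow> bool" where
  "D_finite \<C> M N \<longleftrightarrow> (\<exists>d \<delta>. D_basis \<C> M N d \<delta>)"

text \<open>
  \<open>universal_extension \<C> M N E a\<close>: the morphism \<open>a : E \<rightarrow> M\<close> is the deflation of a \<open>D\<^sub>N\<close>-universal extension
  of \<open>M\<close> by \<open>N\<close>.  The sum of the \<open>push \<C> (\<iota> i) (\<delta> i)\<close> is the element of \<open>\<bbbE>(M,N\<^sup>d)\<close> with components \<open>\<delta> i\<close>.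
\<close>

definition universal_extension ::
  "('o, 'm::ab_group_add, 'k::field, 'e::ab_group_add, 'z) extri_cat_scheme \<Rightarrow> 'o \<Rightarrow> 'o \<Rightarrow> 'o \<Rightarrow> 'm \<Rightarrow> bool" where
  "universal_extension \<C> M N E a \<longleftrightarrow> (\<exists>d \<delta>. D_basis \<C> M N d \<delta> \<and>
     (if d = 0 then E = M \<and> a = Ident \<C> M
      else \<exists>S \<iota> \<pi> f. direct_sum \<C> {..<d} (\<lambda>_. N) S \<iota> \<pi> \<and>
             conflation \<C> S f E a M (\<Sum>i<d. push \<C> (\<iota> i) (\<delta> i))))"

definition admits_universal_extensions_by ::
  "('o, 'm::ab_group_add, 'k::field, 'e::ab_group_add, 'z) extri_cat_scheme \<Rightarrow> 'o set \<Rightarrow> 'o \<Rightarrow> bool" where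
  "admits_universal_extensions_by \<C> \<E> N \<longleftrightarrow>
     indecomposable \<C> N \<and> extension_closed \<C> \<E> \<and> N \<in> \<E> \<and> (\<forall>M\<in>\<E>. D_finite \<C> M N) \<and>
     (\<forall>M\<in>\<E>. \<exists>P a. P 0 = M \<and>
        (\<forall>s\<ge>1::nat. universal_extension \<C> (P (s - 1)) N (P s) (a s)) \<and>
        (\<exists>s\<ge>1::nat. is_iso \<C> (P s) (P (s - 1)) (a s)))"


section \<open>Mixed standardizable sets and mixed stratifying systems\<close>

text \<open>An ordered set \<open>(\<Theta>(1), \<dots>, \<Theta>(t))\<close> is a function on \<open>nat\<close>, of which only the values on \<open>{1..t}\<close> matter.\<close>

definition MS1 :: "('o, 'm::ab_group_add, 'k, 'e::zero, 'z) extri_cat_scheme \<Rightarrow> nat \<Rightarrow> (nat \<Rightarrow> 'o) \<Rightarrow> bool" where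
  "MS1 \<C> t \<Theta> \<longleftrightarrow> (\<forall>i\<in>{1..t}. brick \<C> (\<Theta> i) \<or> stone \<C> (\<Theta> i))"

definition MS2 :: "('o, 'm::zero, 'k, 'z) linear_cat_scheme \<Rightarrow> nat \<Rightarrow> (nat \<Rightarrow> 'o) \<Rightarrow> bool" where
  "MS2 \<C> t \<Theta> \<longleftrightarrow> (\<forall>i\<in>{1..t}. \<forall>j\<in>{1..t}. i > j \<longrightarrow> Hom \<C> (\<Theta> i) (\<Theta> j) = {0})"

definition MS3 :: "('o, 'm, 'k, 'e::zero, 'z) extri_cat_scheme \<Rightarrow> nat \<Rightarrow> (nat \<Rightarrow> 'o) \<Rightarrow> bool" where
  "MS3 \<C> t \<Theta> \<longleftrightarrow> (\<forall>i\<in>{1..t}. \<forall>j\<in>{1..t}. i > j \<longrightarrow> Ext \<C> (\<Theta> i) (\<Theta> j) = {0})"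

definition MS4 ::
  "('o, 'm::ab_group_add, 'k, 'e, 'n::zero, 'z) neg_extri_cat_scheme \<Rightarrow> nat \<Rightarrow> (nat \<Rightarrow> 'o) \<Rightarrow> bool" where
  "MS4 \<C> t \<Theta> \<longleftrightarrow> NExt \<C> (dsum \<C> {1..t} \<Theta>) (dsum \<C> {1..t} \<Theta>) = {0}"

definition mixed_standardizable ::
  "('o, 'm::ab_group_add, 'k, 'e::zero, 'n::zero, 'z) neg_extri_cat_scheme \<Rightarrow> nat \<Rightarrow> (nat \<Rightarrow> 'o) \<Rightarrow> bool" where
  "mixed_standardizable \<C> t \<Theta> \<longleftrightarrow> MS1 \<C> t \<Theta> \<and> MS2 \<C> t \<Theta> \<and> MS3 \<C> t \<Theta> \<and> MS4 \<C> t \<Theta>"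

definition mixed_stratifying_system ::
  "('o, 'm::ab_group_add, 'k, 'e::zero, 'n::zero, 'z) neg_extri_cat_scheme \<Rightarrow> nat \<Rightarrow>
     (nat \<Rightarrow> 'o) \<Rightarrow> (nat \<Rightarrow> 'o) \<Rightarrow> bool" where
  "mixed_stratifying_system \<C> t \<Theta> P \<longleftrightarrow> MS1 \<C> t \<Theta> \<and> MS2 \<C> t \<Theta> \<and> MS4 \<C> t \<Theta> \<and>
     (\<forall>i\<in>{1..t}. indecomposable \<C> (P i) \<and>
        (\<exists>K f \<alpha> \<delta>. conflation \<C> K f (P i) \<alpha> (\<Theta> i) \<delta> \<and> K \<in> Filt \<C> (dsum \<C> {i..t} \<Theta>)) \<and>
        (\<forall>X\<in>Filt \<C> (dsum \<C> {1..t} \<Theta>). Ext \<C> (P i) X = {0}))"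

definition admits_universal_extensions ::
  "('o, 'm::ab_group_add, 'k::field, 'e::ab_group_add, 'z) extri_cat_scheme \<Rightarrow> 'o set \<Rightarrow> nat \<Rightarrow> (nat \<Rightarrow> 'o) \<Rightarrow> bool" where
  "admits_universal_extensions \<C> \<E> t \<Theta> \<longleftrightarrow> (\<forall>i\<in>{1..t}. admits_universal_extensions_by \<C> \<E> (\<Theta> i))"

end

theory Submission
  imports Defs
begin

text \<open>
  Starting from \<open>\<Theta>(i)\<close>, take iterated universal extensions by \<open>\<Theta>(i)\<close>, \<open>\<Theta>(i+1)\<close>, ..., \<open>\<Theta>(t)\<close>. The sequence for
  \<open>\<Theta>(j)\<close> stops at an object with no extensions by \<open>\<Theta>(j)\<close>, and by (MS3) the later steps create no new extensions by
  \<open>\<Theta>(l)\<close>, \<open>l \<le> j\<close>. The resulting \<open>P\<close> is projective in \<open>\<F>(\<Theta>)\<close>, its kernel \<open>K\<close> over \<open>\<Theta>(i)\<close> is filtered by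
  \<open>\<Theta>(i), \<dots>, \<Theta>(t)\<close>, and every map from \<open>P\<close> to \<open>\<Theta>(i)\<close> factors uniquely through \<open>\<alpha> : P \<rightarrow> \<Theta>(i)\<close>. As
  \<open>End(\<Theta>(i))\<close> is local, \<open>\<alpha>\<close> factors through an indecomposable summand \<open>P(i)\<close> of \<open>P\<close>, on which it is right minimal;
  the complement of \<open>P(i)\<close> is a summand of \<open>K\<close>.

  It remains to see that \<open>\<F>(\<Theta>(i), \<dots>, \<Theta>(t))\<close> is closed under direct summands. Each object \<open>M\<close> in it has a conflation
  \<open>U \<rightarrow> M \<rightarrow> V\<close> with \<open>V \<in> \<F>(\<Theta>(i))\<close> and \<open>U \<in> \<F>(\<Theta>(i+1), \<dots>, \<Theta>(t))\<close>, to which idempotents of \<open>M\<close> restrict uniquely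
  since \<open>Hom U V = 0 = \<bbbE>\<^sup>-\<^sup>1(U,V)\<close>. This leaves one object \<open>N\<close>. If \<open>N\<close> is a stone, then \<open>\<F>(N) = add N\<close>. If \<open>N\<close> is a
  brick, every nonzero map from \<open>N\<close> to an object of \<open>\<F>(N)\<close> is an inflation with a cone of smaller length, and
  induction on the length applies.
\<close>

section \<open>Additive categories\<close>

context linear_category
begin

lemma hom_zero [simp]: "0 \<in> Hom \<C> A B"
  using hom_subspace[of A B] hom_ambient module.subspace_0 vector_space_def module_iff_vector_space by metis

lemma hom_add: "f \<in> Hom \<C> A B \<Longrightarrow> g \<in> Hom \<C> A B \<Longrightarrow> f + g \<in> Hom \<C> A B"
  using hom_subspace[of A B] hom_ambient module.subspace_add module_iff_vector_space by metis

lemma hom_uminus: "f \<in> Hom \<C> A B \<Longrightarrow> - f \<in> Hom \<C> A B"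
  using hom_subspace[of A B] hom_ambient module.subspace_neg module_iff_vector_space by metis

lemma hom_diff: "f \<in> Hom \<C> A B \<Longrightarrow> g \<in> Hom \<C> A B \<Longrightarrow> f - g \<in> Hom \<C> A B"
  using hom_add[of f A B "- g"] hom_uminus by simp

lemma hom_sum: "(\<And>i. i \<in> I \<Longrightarrow> f i \<in> Hom \<C> A B) \<Longrightarrow> sum f I \<in> Hom \<C> A B"
  by (induction I rule: infinite_finite_induct) (auto intro: hom_add)

lemmas hom_intros = comp_hom hom_add hom_diff hom_uminus hom_zero id_hom

lemma comp_zero_left: "f \<in> Hom \<C> A B \<Longrightarrow> 0 \<cdot> f = 0"
  using comp_add_left[of 0 B B 0 f A] by simp

lemma comp_zero_right: "g \<in> Hom \<C> B C \<Longrightarrow> g \<cdot> 0 = 0"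
  using comp_add_right[of g B C 0 B 0] by simp

lemma comp_uminus_left: "g \<in> Hom \<C> B C \<Longrightarrow> f \<in> Hom \<C> A B \<Longrightarrow> (- g) \<cdot> f = - (g \<cdot> f)"
  using comp_add_left[of g B C "- g" f A] comp_zero_left[of f A B] hom_uminus[of g B C]
  by (simp add: eq_neg_iff_add_eq_0 add.commute)

lemma comp_uminus_right: "g \<in> Hom \<C> B C \<Longrightarrow> f \<in> Hom \<C> A B \<Longrightarrow> g \<cdot> (- f) = - (g \<cdot> f)"
  using comp_add_right[of g B C f A "- f"] comp_zero_right[of g B C] hom_uminus[of f A B]
  by (simp add: eq_neg_iff_add_eq_0 add.commute)

lemma comp_diff_left: "g \<in> Hom \<C> B C \<Longrightarrow> g' \<in> Hom \<C> B C \<Longrightarrow> f \<in> Hom \<C> A B \<Longrightarrow>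
    (g - g') \<cdot> f = g \<cdot> f - g' \<cdot> f"
  using comp_add_left[of g B C "- g'" f A] by (simp add: comp_uminus_left hom_uminus)

lemma comp_diff_right: "g \<in> Hom \<C> B C \<Longrightarrow> f \<in> Hom \<C> A B \<Longrightarrow> f' \<in> Hom \<C> A B \<Longrightarrow>
    g \<cdot> (f - f') = g \<cdot> f - g \<cdot> f'"
  using comp_add_right[of g B C f A "- f'"] by (simp add: comp_uminus_right hom_uminus)

lemma comp_sum_left: "(\<And>i. i \<in> I \<Longrightarrow> g i \<in> Hom \<C> B C) \<Longrightarrow> f \<in> Hom \<C> A B \<Longrightarrow>
    (\<Sum>i\<in>I. g i) \<cdot> f = (\<Sum>i\<in>I. g i \<cdot> f)"
proof (induction I rule: infinite_finite_induct)
  case (insert a I)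
  then show ?case using comp_add_left[of "g a" B C "sum g I" f A] hom_sum[of I g B C] by simp
qed (simp_all add: comp_zero_left)

lemma comp_sum_right: "g \<in> Hom \<C> B C \<Longrightarrow> (\<And>i. i \<in> I \<Longrightarrow> f i \<in> Hom \<C> A B) \<Longrightarrow>
    g \<cdot> (\<Sum>i\<in>I. f i) = (\<Sum>i\<in>I. g \<cdot> f i)"
proof (induction I rule: infinite_finite_induct)
  case (insert a I)
  then show ?case using comp_add_right[of g B C "f a" A "sum f I"] hom_sum[of I f A B] by simp
qed (simp_all add: comp_zero_right)

lemmas comp_simps = comp_assoc id_left id_right comp_add_left comp_add_right comp_zero_left
  comp_zero_right comp_diff_left comp_diff_right comp_uminus_left comp_uminus_right

section \<open>Isomorphisms and zero objects\<close>

lemma is_isoI: "f \<in> Hom \<C> A B \<Longrightarrow> g \<in> Hom \<C> B A \<Longrightarrow> g \<cdot> f = Ident \<C> A \<Longrightarrow> f \<cdot> g = Ident \<C> B \<Longrightarrow>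
    is_iso \<C> A B f"
  unfolding is_iso_def by blast

lemma is_isoE:
  assumes "is_iso \<C> A B f"
  obtains g where "f \<in> Hom \<C> A B" "g \<in> Hom \<C> B A" "g \<cdot> f = Ident \<C> A" "f \<cdot> g = Ident \<C> B" "is_iso \<C> B A g"
  using assms unfolding is_iso_def by blast

text \<open>Composites are normalized to right-nested form, where a known product
  \<open>h \<cdot> g\<close> is hidden by the bracketing; this rule and the two after it still apply
  it there.\<close>

lemma comp_reduce:
  assumes "h \<cdot> g = k" "h \<in> Hom \<C> C D" "g \<in> Hom \<C> B C" "f \<in> Hom \<C> A B"
  shows "h \<cdot> (g \<cdot> f) = k \<cdot> f"
  using assms by (simp add: comp_assoc[symmetric])

lemma comp_cancel:
  assumes "h \<cdot> g = Ident \<C> B" "h \<in> Hom \<C> C B" "g \<in> Hom \<C> B C" "f \<in> Hom \<C> A B"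
  shows "h \<cdot> (g \<cdot> f) = f"
  using assms by (simp add: comp_reduce[of h g "Ident \<C> B" C B B f A] id_left)

lemma comp_reduce_zero:
  assumes "h \<cdot> g = 0" "h \<in> Hom \<C> C D" "g \<in> Hom \<C> B C" "f \<in> Hom \<C> A B"
  shows "h \<cdot> (g \<cdot> f) = 0"
  using assms by (simp add: comp_reduce[of h g 0 C D B f A] comp_zero_left)

lemma is_iso_comp:
  assumes "is_iso \<C> B C g" "is_iso \<C> A B f" shows "is_iso \<C> A C (g \<cdot> f)"
proof -
  obtain f' where f: "f \<in> Hom \<C> A B" "f' \<in> Hom \<C> B A" "f' \<cdot> f = Ident \<C> A" "f \<cdot> f' = Ident \<C> B"
    using assms(2) by (rule is_isoE)
  obtain g' where g: "g \<in> Hom \<C> B C" "g' \<in> Hom \<C> C B" "g' \<cdot> g = Ident \<C> B" "g \<cdot> g' = Ident \<C> C"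
    using assms(1) by (rule is_isoE)
  have gf: "g \<cdot> f \<in> Hom \<C> A C" "f' \<cdot> g' \<in> Hom \<C> C A" using f g by (blast intro: comp_hom)+
  have "g' \<cdot> (g \<cdot> f) = f" "f \<cdot> (f' \<cdot> g') = g'" using f g by (blast intro: comp_cancel)+
  then show ?thesis using f g gf by (intro is_isoI[OF gf]) (simp_all add: comp_assoc)
qed

text \<open>Invertibility of \<open>g \<cdot> f\<close> gives a left inverse of \<open>f\<close>,
  that of \<open>f \<cdot> g\<close> a right inverse, and the two coincide.\<close>

lemma is_iso_two_sided:
  assumes fg: "f \<in> Hom \<C> A B" "g \<in> Hom \<C> B A" and "is_iso \<C> A A (g \<cdot> f)" "is_iso \<C> B B (f \<cdot> g)"
  shows "is_iso \<C> A B f"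
proof -
  obtain u where u: "u \<in> Hom \<C> A A" "u \<cdot> (g \<cdot> f) = Ident \<C> A" using assms(3) by (auto simp: is_iso_def)
  obtain v where v: "v \<in> Hom \<C> B B" "(f \<cdot> g) \<cdot> v = Ident \<C> B" using assms(4) by (auto simp: is_iso_def)
  have m: "u \<cdot> g \<in> Hom \<C> B A" "g \<cdot> v \<in> Hom \<C> B A" "g \<cdot> f \<in> Hom \<C> A A" "f \<cdot> g \<in> Hom \<C> B B"
    using u v fg by (blast intro: comp_hom)+
  have 1: "(u \<cdot> g) \<cdot> f = Ident \<C> A" using u fg by (simp add: comp_assoc)
  have 2: "f \<cdot> (g \<cdot> v) = Ident \<C> B" using v fg by (simp add: comp_assoc)
  have "u \<cdot> g = (u \<cdot> g) \<cdot> (f \<cdot> (g \<cdot> v))" using 2 m by (simp add: id_right)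
  also have "\<dots> = g \<cdot> v" using comp_cancel[OF 1 m(1) fg(1) m(2)] .
  finally show ?thesis using fg m 1 2 by (intro is_isoI[of f A B "u \<cdot> g"]) simp_all
qed

lemma is_iso_id: "is_iso \<C> A A (Ident \<C> A)"
  by (rule is_isoI[OF id_hom id_hom]) (simp_all add: id_left[OF id_hom])

text \<open>With \<open>f = 1 + n\<close> and \<open>n \<cdot> n = 0\<close>, the inverse is
  \<open>1 - n\<close>. The isomorphisms between middle terms of conflations below rest on
  this.\<close>

lemma is_iso_unipotent:
  assumes "f \<in> Hom \<C> A A" "(f - Ident \<C> A) \<cdot> (f - Ident \<C> A) = 0"
  shows "is_iso \<C> A A f"
proof -
  define n where "n = f - Ident \<C> A"
  have n: "n \<in> Hom \<C> A A" "n \<cdot> n = 0" "f = Ident \<C> A + n" "Ident \<C> A \<in> Hom \<C> A A"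
    using assms by (simp_all add: n_def hom_diff id_hom)
  have m: "Ident \<C> A - n \<in> Hom \<C> A A" "Ident \<C> A + n \<in> Hom \<C> A A" using n by (simp_all add: hom_diff hom_add)
  show ?thesis
    by (rule is_isoI[OF assms(1) m(1)]; use n m in \<open>simp add: comp_simps\<close>)
qed

lemma is_iso_zero_comp_right:
  assumes "is_iso \<C> A B f" "g \<in> Hom \<C> B C" "g \<cdot> f = 0" shows "g = 0"
proof -
  obtain h where h: "f \<in> Hom \<C> A B" "h \<in> Hom \<C> B A" "f \<cdot> h = Ident \<C> B" using assms(1) by (rule is_isoE)
  have "g = g \<cdot> f \<cdot> h" using h assms(2) by (simp add: comp_assoc id_right)
  then show ?thesis using assms(3) comp_zero_left[OF h(2)] by simp
qed

lemma zero_object_iff: "zero_object \<C> Z \<longleftrightarrow> Ident \<C> Z = 0"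
proof
  assume "Ident \<C> Z = 0"
  then have "x = 0" if "x \<in> Hom \<C> A Z" for x A using id_left[OF that] comp_zero_left[OF that] by simp
  moreover have "x = 0" if "x \<in> Hom \<C> Z A" for x A using id_right[OF that] comp_zero_right[OF that] \<open>Ident \<C> Z = 0\<close> by simp
  ultimately show "zero_object \<C> Z" by (auto simp: zero_object_def)
next
  assume "zero_object \<C> Z"
  then have "Hom \<C> Z Z = {0}" by (simp add: zero_object_def)
  then show "Ident \<C> Z = 0" using id_hom[of Z] by simp
qed

lemma zero_object_iso:
  assumes "is_iso \<C> A B f" "zero_object \<C> A" shows "zero_object \<C> B"
proof -
  obtain g where g: "f \<in> Hom \<C> A B" "g \<in> Hom \<C> B A" "f \<cdot> g = Ident \<C> B" using assms by (auto simp: is_iso_def)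
  have "f = 0" using g assms by (auto simp: zero_object_def)
  then show ?thesis using g comp_zero_left[of g] by (simp add: zero_object_iff)
qed

section \<open>Biproducts\<close>

lemma biproduct_swap: "biproduct \<C> A B S i j p q \<Longrightarrow> biproduct \<C> B A S j i q p"
  by (auto simp: biproduct_def add.commute)

lemma biproductD:
  assumes "biproduct \<C> A B S i j p q"
  shows "i \<in> Hom \<C> A S" "j \<in> Hom \<C> B S" "p \<in> Hom \<C> S A" "q \<in> Hom \<C> S B"
    "p \<cdot> i = Ident \<C> A" "q \<cdot> j = Ident \<C> B" "p \<cdot> j = 0" "q \<cdot> i = 0" "i \<cdot> p + j \<cdot> q = Ident \<C> S"
  using assms by (simp_all add: biproduct_def)

lemma biproductI:
  assumes "i \<in> Hom \<C> A S" "j \<in> Hom \<C> B S" "p \<in> Hom \<C> S A" "q \<in> Hom \<C> S B"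
    "p \<cdot> i = Ident \<C> A" "q \<cdot> j = Ident \<C> B" "p \<cdot> j = 0" "q \<cdot> i = 0" "i \<cdot> p + j \<cdot> q = Ident \<C> S"
  shows "biproduct \<C> A B S i j p q"
  using assms by (simp add: biproduct_def)

lemma biproduct_zero_left:
  assumes "zero_object \<C> Z" shows "biproduct \<C> Z A A 0 (Ident \<C> A) 0 (Ident \<C> A)"
  using assms by (intro biproductI) (simp_all add: zero_object_iff id_hom id_left[OF id_hom] comp_zero_left[OF id_hom] comp_zero_left[OF hom_zero] comp_zero_right[OF id_hom])

lemma biproduct_zero_right:
  assumes "zero_object \<C> Z" shows "biproduct \<C> A Z A (Ident \<C> A) 0 (Ident \<C> A) 0"
  using biproduct_swap[OF biproduct_zero_left[OF assms]] .

lemma biproduct_transport: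
  assumes "biproduct \<C> A B S i j p q"
    and g: "f \<in> Hom \<C> S T" "g \<in> Hom \<C> T S" "g \<cdot> f = Ident \<C> S" "f \<cdot> g = Ident \<C> T"
  shows "biproduct \<C> A B T (f \<cdot> i) (f \<cdot> j) (p \<cdot> g) (q \<cdot> g)"
proof -
  note b = biproductD[OF assms(1)]
  have m: "f \<cdot> i \<in> Hom \<C> A T" "f \<cdot> j \<in> Hom \<C> B T" "p \<cdot> g \<in> Hom \<C> T A" "q \<cdot> g \<in> Hom \<C> T B"
      "i \<cdot> p \<in> Hom \<C> S S" "j \<cdot> q \<in> Hom \<C> S S"
    using b g by (blast intro: comp_hom)+
  have gf: "g \<cdot> (f \<cdot> i) = i" "g \<cdot> (f \<cdot> j) = j" using b g by (blast intro: comp_cancel)+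
  have "f \<cdot> i \<cdot> (p \<cdot> g) + f \<cdot> j \<cdot> (q \<cdot> g) = f \<cdot> ((i \<cdot> p + j \<cdot> q) \<cdot> g)"
  proof -
    have "i \<cdot> (p \<cdot> g) \<in> Hom \<C> T S" "j \<cdot> (q \<cdot> g) \<in> Hom \<C> T S" using b m by (blast intro: comp_hom)+
    then show ?thesis using b(1-4) g(1,2) m by (simp add: comp_assoc comp_add_left comp_add_right)
  qed
  then have "f \<cdot> i \<cdot> (p \<cdot> g) + f \<cdot> j \<cdot> (q \<cdot> g) = Ident \<C> T" using b g by (simp add: id_left)
  then show ?thesis
    using b g m gf by (intro biproductI) (simp_all add: comp_assoc)
qed

lemma biproduct_iso:
  assumes "biproduct \<C> A B S i j p q" "is_iso \<C> S T f"
  shows "\<exists>i j p q. biproduct \<C> A B T i j p q"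
  using assms(2) by (rule is_isoE) (use biproduct_transport[OF assms(1)] in blast)

lemma biproduct_zero_iso:
  assumes b: "biproduct \<C> A B S i j p q" "zero_object \<C> B" shows "is_iso \<C> A S i" "is_iso \<C> S A p"
proof -
  note b = biproductD[OF b(1)]
  have "q = 0" using b assms(2) by (auto simp: zero_object_def)
  then have "i \<cdot> p = Ident \<C> S" using b comp_zero_right[OF b(2)] by simp
  then show "is_iso \<C> A S i" "is_iso \<C> S A p" using b by (auto simp: is_iso_def)
qed

end

text \<open>Direct sums are built one summand at a time, so that statements about them become
  inductions. Any biproduct object is accepted at each step, which makes the set closed under
  isomorphism.\<close>

inductive_set finite_sums :: "('o, 'm::ab_group_add, 'k, 'z) linear_cat_scheme \<Rightarrow> 'o set \<Rightarrow> 'o set"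
  for \<C> and \<X> where
  zero: "zero_object \<C> Z \<Longrightarrow> Z \<in> finite_sums \<C> \<X>"
| step: "X \<in> \<X> \<Longrightarrow> A \<in> finite_sums \<C> \<X> \<Longrightarrow> biproduct \<C> X A S i j p q \<Longrightarrow> S \<in> finite_sums \<C> \<X>"

section \<open>Exchange of summands and splitting of idempotents\<close>

context linear_category
begin

text \<open>The projection \<open>p\<close>, corrected by the inverse of \<open>p \<cdot> a\<close>,
  is a retraction of \<open>a\<close> that still kills \<open>j\<close>. So \<open>R\<close> stays a
  complement with the same inclusion, and only the projection onto it changes.\<close>

lemma biproduct_exchange_inclusion:
  assumes "biproduct \<C> X R A i j p q" and a: "a \<in> Hom \<C> X A" and "is_iso \<C> X X (p \<cdot> a)"
  shows "\<exists>c q'. biproduct \<C> X R A a j c q'"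
proof -
  note b = biproductD[OF assms(1)]
  obtain v where v: "v \<in> Hom \<C> X X" "v \<cdot> (p \<cdot> a) = Ident \<C> X" "(p \<cdot> a) \<cdot> v = Ident \<C> X"
    using assms(3) by (auto simp: is_iso_def)
  define c where "c = v \<cdot> p"
  define r where "r = q - (q \<cdot> a) \<cdot> c"
  have m: "c \<in> Hom \<C> A X" "q \<cdot> a \<in> Hom \<C> X R" "(q \<cdot> a) \<cdot> c \<in> Hom \<C> A R" "r \<in> Hom \<C> A R" "a \<cdot> c \<in> Hom \<C> A A"
      "i \<cdot> p \<in> Hom \<C> A A" "j \<cdot> q \<in> Hom \<C> A A" "p \<cdot> a \<in> Hom \<C> X X"
    unfolding c_def r_def using b a v by - (assumption | rule hom_intros)+
  have ca: "c \<cdot> a = Ident \<C> X" and cj: "c \<cdot> j = 0"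
    using b a v by (simp_all add: c_def comp_assoc comp_zero_right)
  have pac: "p \<cdot> (a \<cdot> c) = p"
    using comp_reduce[OF refl b(3) a m(1)] v b a m(8) by (simp add: c_def comp_cancel)
  have "(i \<cdot> p + j \<cdot> q) \<cdot> (a \<cdot> c) = a \<cdot> c" using b m by (simp add: id_left)
  then have "i \<cdot> p + j \<cdot> (q \<cdot> (a \<cdot> c)) = a \<cdot> c" using b(1-8) m a pac by (simp add: comp_add_left comp_assoc)
  then have jq: "j \<cdot> ((q \<cdot> a) \<cdot> c) = a \<cdot> c - i \<cdot> p" using b m a by (simp add: comp_assoc algebra_simps)
  have "biproduct \<C> X R A a j c r"
  proof (rule biproductI)
    show "r \<cdot> j = Ident \<C> R" using b m cj by (simp add: r_def comp_diff_left comp_assoc comp_zero_right)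
    show "r \<cdot> a = 0" using b m ca a by (simp add: r_def comp_diff_left comp_assoc id_right)
    show "a \<cdot> c + j \<cdot> r = Ident \<C> A"
      using b m jq by (simp add: r_def comp_diff_right add.commute)
  qed (use a b m ca cj in simp_all)
  then show ?thesis by blast
qed

text \<open>Dual exchange: \<open>q\<close> is kept, and \<open>j\<close> is corrected by
  \<open>a \<cdot> (b \<cdot> j)\<close> so that \<open>b\<close> kills it.\<close>

lemma biproduct_exchange_projection:
  assumes "biproduct \<C> X R A a j c q" and b: "b \<in> Hom \<C> A X" "b \<cdot> a = Ident \<C> X"
  shows "\<exists>j'. biproduct \<C> X R A a j' b q"
proof -
  note d = biproductD[OF assms(1)]
  define k where "k = j - a \<cdot> (b \<cdot> j)"
  have m: "b \<cdot> j \<in> Hom \<C> R X" "a \<cdot> (b \<cdot> j) \<in> Hom \<C> R A" "k \<in> Hom \<C> R A" "a \<cdot> c \<in> Hom \<C> A A" "j \<cdot> q \<in> Hom \<C> A A" "a \<cdot> b \<in> Hom \<C> A A" "b \<cdot> (j \<cdot> q) \<in> Hom \<C> A X"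
    unfolding k_def using b d by - (assumption | rule hom_intros)+
  have "b \<cdot> (a \<cdot> c + j \<cdot> q) = b" using d b by (simp add: id_right)
  then have "c + b \<cdot> (j \<cdot> q) = b" using d(1-8) b m by (simp add: comp_add_right comp_cancel)
  then have bjq: "b \<cdot> (j \<cdot> q) = b - c" by (simp add: algebra_simps)
  have "biproduct \<C> X R A a k b q"
  proof (rule biproductI)
    show "q \<cdot> k = Ident \<C> R" using b m d by (simp add: k_def comp_diff_right comp_reduce_zero)
    show "b \<cdot> k = 0" using b m d by (simp add: k_def comp_diff_right comp_cancel)
    show "a \<cdot> b + k \<cdot> q = Ident \<C> A"
      using d b m by (simp add: k_def comp_diff_left comp_assoc bjq comp_diff_right add.commute)
  qed (use b d m in simp_all)
  then show ?thesis by blast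
qed

text \<open>Associativity of biproducts, moving \<open>Y\<close> from the complement of
  \<open>X\<close> to its side. The idempotent of the new summand is recorded because the splitting
  of idempotents has to produce a prescribed one.\<close>

lemma biproduct_regroup:
  assumes "biproduct \<C> X R A a \<iota> b \<pi>" "biproduct \<C> Y Z R i j p q" "biproduct \<C> X Y T k l m n"
  shows "\<exists>I J P Q. biproduct \<C> T Z A I J P Q \<and> I \<cdot> P = a \<cdot> b + \<iota> \<cdot> ((i \<cdot> p) \<cdot> \<pi>)"
proof -
  note d = biproductD[OF assms(1)] biproductD[OF assms(2)] biproductD[OF assms(3)]
  define I where "I = a \<cdot> m + \<iota> \<cdot> (i \<cdot> n)"
  define P where "P = k \<cdot> b + l \<cdot> (p \<cdot> \<pi>)"
  have M1: "i \<cdot> n \<in> Hom \<C> T R" "a \<cdot> m \<in> Hom \<C> T A" "\<iota> \<cdot> (i \<cdot> n) \<in> Hom \<C> T A" "p \<cdot> \<pi> \<in> Hom \<C> A Y"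
    using d by - (assumption | rule hom_intros)+
  have M2: "k \<cdot> b \<in> Hom \<C> A T" "l \<cdot> (p \<cdot> \<pi>) \<in> Hom \<C> A T" "\<iota> \<cdot> j \<in> Hom \<C> Z A" "q \<cdot> \<pi> \<in> Hom \<C> A Z"
    using d by - (assumption | rule hom_intros)+
  have M3: "i \<cdot> (p \<cdot> \<pi>) \<in> Hom \<C> A R" "j \<cdot> (q \<cdot> \<pi>) \<in> Hom \<C> A R" "i \<cdot> p \<in> Hom \<C> R R" "j \<cdot> q \<in> Hom \<C> R R"
    "I \<in> Hom \<C> T A" "P \<in> Hom \<C> A T"
    unfolding I_def P_def using d by - (assumption | rule hom_intros)+
  note M = M1 M2 M3
  have bI: "b \<cdot> I = m" unfolding I_def using d M by (simp add: comp_add_right comp_cancel comp_reduce_zero)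
  have pI: "\<pi> \<cdot> I = i \<cdot> n" unfolding I_def using d M by (simp add: comp_add_right comp_cancel comp_reduce_zero)
  have mP: "m \<cdot> P = b" unfolding P_def using d M by (simp add: comp_add_right comp_cancel comp_reduce_zero)
  have nP: "n \<cdot> P = p \<cdot> \<pi>" unfolding P_def using d M by (simp add: comp_add_right comp_cancel comp_reduce_zero)
  have pj: "\<pi> \<cdot> (\<iota> \<cdot> j) = j" "b \<cdot> (\<iota> \<cdot> j) = 0" using d by (simp_all add: comp_cancel comp_reduce_zero)
  have pin: "p \<cdot> (i \<cdot> n) = n" "q \<cdot> (i \<cdot> n) = 0" using d by (simp_all add: comp_cancel comp_reduce_zero)
  have qpi: "i \<cdot> (p \<cdot> \<pi>) + j \<cdot> (q \<cdot> \<pi>) = \<pi>"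
  proof -
    have "(i \<cdot> p + j \<cdot> q) \<cdot> \<pi> = \<pi>" using d by (simp add: id_left)
    then show ?thesis using d(1-8,10-17,19-26) M by (simp add: comp_add_left comp_assoc)
  qed
  have IP: "I \<cdot> P = a \<cdot> b + \<iota> \<cdot> (i \<cdot> (p \<cdot> \<pi>))"
    using d M mP nP by (simp add: I_def comp_add_left comp_assoc)
  have "biproduct \<C> T Z A I (\<iota> \<cdot> j) P (q \<cdot> \<pi>)"
  proof (rule biproductI)
    show "P \<cdot> I = Ident \<C> T" using d M bI pI pin by (simp add: P_def comp_add_left comp_assoc)
    show "q \<cdot> \<pi> \<cdot> I = 0" using d M pI pin by (simp add: comp_assoc)
    show "P \<cdot> (\<iota> \<cdot> j) = 0" using d M pj by (simp add: P_def comp_add_left comp_assoc comp_zero_right)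
    show "q \<cdot> \<pi> \<cdot> (\<iota> \<cdot> j) = Ident \<C> Z" using d M pj by (simp add: comp_assoc)
    have "I \<cdot> P + \<iota> \<cdot> j \<cdot> (q \<cdot> \<pi>) = a \<cdot> b + \<iota> \<cdot> (i \<cdot> (p \<cdot> \<pi>) + j \<cdot> (q \<cdot> \<pi>))"
      using d(1-4,10-13) M by (simp add: IP comp_assoc comp_add_right add.assoc)
    then show "I \<cdot> P + \<iota> \<cdot> j \<cdot> (q \<cdot> \<pi>) = Ident \<C> A" using d qpi by simp
  qed (use M in simp_all)
  moreover have "I \<cdot> P = a \<cdot> b + \<iota> \<cdot> ((i \<cdot> p) \<cdot> \<pi>)" using IP d by (simp add: comp_assoc)
  ultimately show ?thesis by blast
qed

lemma finite_sums_iso: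
  assumes "A \<in> finite_sums \<C> \<X>" "is_iso \<C> A B f" shows "B \<in> finite_sums \<C> \<X>"
  using assms(1)
proof cases
  case zero
  then show ?thesis using zero_object_iso[OF assms(2)] finite_sums.zero by metis
next
  case (step X A' i j p q)
  then obtain i' j' p' q' where "biproduct \<C> X A' B i' j' p' q'"
    using biproduct_iso[OF step(3) assms(2)] by blast
  then show ?thesis using finite_sums.step[OF step(1,2)] by blast
qed

lemma finite_sums_mono: "A \<in> finite_sums \<C> \<X> \<Longrightarrow> \<X> \<subseteq> \<Y> \<Longrightarrow> A \<in> finite_sums \<C> \<Y>"
proof (induction rule: finite_sums.induct)
  case (step X A S i j p q)
  then show ?case using finite_sums.step[of X \<Y> A] by blast
qed (rule finite_sums.zero)

text \<open>
  One of \<open>e\<close> and \<open>1 - e\<close> is invertible on a given local summand \<open>X\<close> of \<open>A\<close>, and then \<open>X\<close> can be split off from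
  the image of \<open>e\<close> or of \<open>1 - e\<close>.
\<close>

lemma split_idempotent:
  assumes "A \<in> finite_sums \<C> \<X>" and loc: "\<And>X. X \<in> \<X> \<Longrightarrow> local_endomorphism_ring \<C> X"
    and "e \<in> Hom \<C> A A" "e \<cdot> e = e"
  shows "\<exists>Y Z i j p q. biproduct \<C> Y Z A i j p q \<and> i \<cdot> p = e \<and> Y \<in> finite_sums \<C> \<X> \<and> Z \<in> finite_sums \<C> \<X>"
  using assms(1,3,4)
proof (induction arbitrary: e rule: finite_sums.induct)
  case (zero Z)
  then have "e = 0" by (auto simp: zero_object_def)
  then show ?case using biproduct_zero_left[OF zero(1), of Z] zero(1) comp_zero_left[OF hom_zero]
    by (blast intro: finite_sums.zero)
next
  case (step X A S i j p q)
  note b = biproductD[OF step.hyps(3)]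
  have main: "\<exists>Y Z i j p q. biproduct \<C> Y Z S i j p q \<and> i \<cdot> p = e \<and> Y \<in> finite_sums \<C> \<X> \<and> Z \<in> finite_sums \<C> \<X>"
    if e: "e \<in> Hom \<C> S S" "e \<cdot> e = e" and iso: "is_iso \<C> X X (p \<cdot> (e \<cdot> i))" for e
  proof -
    obtain v where v: "v \<in> Hom \<C> X X" "v \<cdot> (p \<cdot> (e \<cdot> i)) = Ident \<C> X"
      using iso by (auto simp: is_iso_def)
    \<comment> \<open>\<open>X\<close> is moved into the image of \<open>e\<close>: \<open>a\<close>
      is fixed by \<open>e\<close>, and its retraction \<open>c\<close> satisfies
      \<open>c \<cdot> e = c\<close>.\<close>
    define a where "a = e \<cdot> i"
    define c where "c = v \<cdot> (p \<cdot> e)"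
    have m: "a \<in> Hom \<C> X S" "c \<in> Hom \<C> S X" "p \<cdot> e \<in> Hom \<C> S X" "e \<cdot> i \<in> Hom \<C> X S"
      unfolding a_def c_def using b e v by - (assumption | rule hom_intros)+
    have ea: "e \<cdot> a = a" using comp_reduce[OF e(2) e(1) e(1) b(1)] by (simp add: a_def)
    have ce: "c \<cdot> e = c" using b e v m by (simp add: c_def comp_assoc)
    have ca: "c \<cdot> a = Ident \<C> X" using b e v m ea by (simp add: c_def comp_assoc a_def)
    obtain c' q' where "biproduct \<C> X A S a j c' q'"
      using biproduct_exchange_inclusion[OF step.hyps(3) m(1)] iso by (auto simp: a_def)
    then obtain j' where bp: "biproduct \<C> X A S a j' c q'"
      using biproduct_exchange_projection m(2) ca by blast
    note d = biproductD[OF bp]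
    \<comment> \<open>Since \<open>c \<cdot> e = c\<close> and \<open>c\<close> kills
      \<open>j'\<close>, the idempotent \<open>e\<close> maps the complement \<open>A\<close> into
      itself. Its restriction \<open>f\<close> is idempotent, and the induction hypothesis splits
      it.\<close>
    define f where "f = q' \<cdot> (e \<cdot> j')"
    have m2: "e \<cdot> j' \<in> Hom \<C> A S" "f \<in> Hom \<C> A A" "a \<cdot> c \<in> Hom \<C> S S" "j' \<cdot> q' \<in> Hom \<C> S S"
      unfolding f_def using d e by - (assumption | rule hom_intros)+
    have "c \<cdot> (e \<cdot> j') = 0" using comp_reduce[OF ce] d e by simp
    moreover have "(a \<cdot> c + j' \<cdot> q') \<cdot> (e \<cdot> j') = e \<cdot> j'" using d m2 by (simp add: id_left)
    ultimately have ej: "e \<cdot> j' = j' \<cdot> f"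
      using d(1-8) m2 e by (simp add: comp_add_left comp_assoc comp_zero_right f_def)
    have "e \<cdot> (e \<cdot> j') = e \<cdot> j'" using comp_reduce[OF e(2) e(1) e(1)] d by simp
    then have "e \<cdot> (j' \<cdot> f) = e \<cdot> j'" by (simp only: ej)
    then have eef: "q' \<cdot> (e \<cdot> (j' \<cdot> f)) = f" by (simp only: f_def[symmetric])
    have "f \<cdot> f = (q' \<cdot> (e \<cdot> j')) \<cdot> f" by (subst (1) f_def) (rule refl)
    then have ff: "f \<cdot> f = f" using d(1-4) e m2 eef by (simp add: comp_assoc)
    obtain Y Z k l m n where s: "biproduct \<C> Y Z A k l m n" "k \<cdot> m = f" "Y \<in> finite_sums \<C> \<X>" "Z \<in> finite_sums \<C> \<X>"
      using step.IH[OF m2(2) ff] by blast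
    obtain T k' l' m' n' where t: "biproduct \<C> X Y T k' l' m' n'" using biproduct_exists by blast
    obtain I J P Q where r: "biproduct \<C> T Z S I J P Q" "I \<cdot> P = a \<cdot> c + j' \<cdot> (f \<cdot> q')"
      using biproduct_regroup[OF bp s(1) t] s(2) by auto
    have "e \<cdot> (a \<cdot> c + j' \<cdot> q') = e" using d e by (simp add: id_right)
    then have "a \<cdot> c + (e \<cdot> j') \<cdot> q' = e" using d(1-8) e m2 comp_reduce[OF ea e(1) d(1) d(3)]
      by (simp add: comp_add_right comp_assoc)
    then have "I \<cdot> P = e" using r ej d m2 by (simp add: comp_assoc)
    moreover have "T \<in> finite_sums \<C> \<X>" using t step.hyps(1) s(3) by (blast intro: finite_sums.step)
    ultimately show ?thesis using r s by blast
  qed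
  let ?e = "Ident \<C> S - e"
  have m: "?e \<in> Hom \<C> S S" "Ident \<C> S \<in> Hom \<C> S S" "e \<cdot> i \<in> Hom \<C> X S" "?e \<cdot> i \<in> Hom \<C> X S"
    using step.prems b by - (assumption | rule hom_intros)+
  have ee: "?e \<cdot> ?e = ?e" using m step.prems by (simp add: comp_diff_left comp_diff_right id_left id_right)
  note e' = m ee
  have "p \<cdot> (e \<cdot> i) + p \<cdot> (?e \<cdot> i) = Ident \<C> X"
    using b e' step.prems by (simp add: comp_diff_left comp_diff_right id_left)
  then have "is_iso \<C> X X (p \<cdot> (e \<cdot> i)) \<or> is_iso \<C> X X (p \<cdot> (?e \<cdot> i))"
    using loc[OF step.hyps(1)] comp_hom[OF b(3) e'(3)] comp_hom[OF b(3) e'(4)] is_iso_id[of X]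
    unfolding local_endomorphism_ring_def by metis
  then show ?case
  proof
    assume "is_iso \<C> X X (p \<cdot> (e \<cdot> i))"
    then show ?thesis using main step.prems by blast
  next
    assume "is_iso \<C> X X (p \<cdot> (?e \<cdot> i))"
    then obtain Y Z i' j' p' q' where r: "biproduct \<C> Y Z S i' j' p' q'" "i' \<cdot> p' = ?e" "Y \<in> finite_sums \<C> \<X>" "Z \<in> finite_sums \<C> \<X>"
      using main e' by blast
    \<comment> \<open>A splitting of \<open>1 - e\<close> becomes one of \<open>e\<close> when its
      two summands are interchanged.\<close>
    have "j' \<cdot> q' = Ident \<C> S - i' \<cdot> p'" using biproductD(9)[OF r(1)] by (metis add_diff_cancel_left')
    then have "j' \<cdot> q' = e" using r(2) by simp
    then show ?thesis using r biproduct_swap by blast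
  qed
qed

end

section \<open>Finite direct sums and local endomorphism rings\<close>

context linear_category
begin

lemma direct_sumD:
  assumes "direct_sum \<C> I X S \<iota> \<pi>"
  shows "finite I" "\<And>i. i \<in> I \<Longrightarrow> \<iota> i \<in> Hom \<C> (X i) S" "\<And>i. i \<in> I \<Longrightarrow> \<pi> i \<in> Hom \<C> S (X i)"
    "\<And>i j. i \<in> I \<Longrightarrow> j \<in> I \<Longrightarrow> \<pi> i \<cdot> \<iota> j = (if i = j then Ident \<C> (X i) else 0)"
    "(\<Sum>i\<in>I. \<iota> i \<cdot> \<pi> i) = Ident \<C> S"
  using assms by (simp_all add: direct_sum_def)

lemma direct_sum_component:
  assumes "direct_sum \<C> I X S \<iota> \<pi>" "k \<in> I" and h: "\<And>l. l \<in> I \<Longrightarrow> h l \<in> Hom \<C> W (X l)"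
  shows "\<pi> k \<cdot> (\<Sum>l\<in>I. \<iota> l \<cdot> h l) = h k"
proof -
  note d = direct_sumD[OF assms(1)]
  have "\<pi> k \<cdot> (\<Sum>l\<in>I. \<iota> l \<cdot> h l) = (\<Sum>l\<in>I. \<pi> k \<cdot> (\<iota> l \<cdot> h l))"
    by (rule comp_sum_right[OF d(3)[OF assms(2)] comp_hom[OF d(2) h]])
  also have "\<dots> = (\<Sum>l\<in>I. if l = k then h k else 0)"
  proof (rule sum.cong[OF refl])
    fix l assume l: "l \<in> I"
    have "\<pi> k \<cdot> (\<iota> l \<cdot> h l) = (if k = l then Ident \<C> (X k) else 0) \<cdot> h l"
      using comp_reduce[OF d(4)[OF assms(2) l] d(3)[OF assms(2)] d(2)[OF l] h[OF l]] .
    then show "\<pi> k \<cdot> (\<iota> l \<cdot> h l) = (if l = k then h k else 0)"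
      using id_left[OF h[OF l]] comp_zero_left[OF h[OF l]] by auto
  qed
  finally show ?thesis using d(1) assms(2) by simp
qed

lemma direct_sum_exists:
  assumes "finite I"
  shows "\<exists>S\<in>finite_sums \<C> (X ` I). \<exists>\<iota> \<pi>. direct_sum \<C> I X S \<iota> \<pi>"
  using assms
proof (induction I rule: finite_induct)
  case empty
  obtain Z where "zero_object \<C> Z" using zero_object_exists by blast
  then have "direct_sum \<C> {} X Z (\<lambda>_. 0) (\<lambda>_. 0)" "Z \<in> finite_sums \<C> (X ` {})"
    by (simp_all add: direct_sum_def zero_object_iff finite_sums.zero)
  then show ?case by blast
next
  case (insert a I)
  then obtain S \<iota> \<pi> where S: "S \<in> finite_sums \<C> (X ` I)" "direct_sum \<C> I X S \<iota> \<pi>" by blast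
  obtain T i j p q where T: "biproduct \<C> (X a) S T i j p q" using biproduct_exists by blast
  note b = biproductD[OF T] and d = direct_sumD[OF S(2)]
  let ?\<iota> = "\<lambda>k. if k = a then i else j \<cdot> \<iota> k" and ?\<pi> = "\<lambda>k. if k = a then p else \<pi> k \<cdot> q"
  have "(\<Sum>k\<in>I. ?\<iota> k \<cdot> ?\<pi> k) = (\<Sum>k\<in>I. (j \<cdot> (\<iota> k \<cdot> \<pi> k)) \<cdot> q)"
  proof (rule sum.cong[OF refl])
    fix k assume k: "k \<in> I"
    have "\<iota> k \<cdot> \<pi> k \<in> Hom \<C> S S" "\<pi> k \<cdot> q \<in> Hom \<C> T (X k)" using d(2,3)[OF k] b(4) by (blast intro: comp_hom)+
    then show "?\<iota> k \<cdot> ?\<pi> k = (j \<cdot> (\<iota> k \<cdot> \<pi> k)) \<cdot> q"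
      using k insert.hyps(2) d(2,3)[OF k] b(2,4) by (auto simp: comp_assoc)
  qed
  also have "\<dots> = (j \<cdot> (\<Sum>k\<in>I. \<iota> k \<cdot> \<pi> k)) \<cdot> q"
  proof -
    have m1: "\<iota> k \<cdot> \<pi> k \<in> Hom \<C> S S" if "k \<in> I" for k using comp_hom[OF d(2)[OF that] d(3)[OF that]] .
    have m2: "j \<cdot> (\<iota> k \<cdot> \<pi> k) \<in> Hom \<C> S T" if "k \<in> I" for k using comp_hom[OF b(2) m1[OF that]] .
    show ?thesis by (simp only: comp_sum_right[OF b(2) m1] comp_sum_left[OF m2 b(4)])
  qed
  also have "\<dots> = j \<cdot> q" using d(5) id_right[OF b(2)] by simp
  finally have sum: "(\<Sum>k\<in>insert a I. ?\<iota> k \<cdot> ?\<pi> k) = Ident \<C> T" using insert.hyps b(9) by simp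
  have "?\<pi> k \<cdot> ?\<iota> l = (if k = l then Ident \<C> (X k) else 0)" if "k \<in> insert a I" "l \<in> insert a I" for k l
  proof -
    have jl: "j \<cdot> \<iota> l \<in> Hom \<C> (X l) T" if "l \<in> I" using comp_hom[OF b(2) d(2)[OF that]] .
    have 1: "p \<cdot> (j \<cdot> \<iota> l) = 0" if "l \<in> I" using comp_reduce_zero[OF b(7) b(3) b(2) d(2)[OF that]] .
    have 2: "(\<pi> k \<cdot> q) \<cdot> i = 0" if "k \<in> I" using comp_assoc[OF d(3)[OF that] b(4) b(1)] b(8) comp_zero_right[OF d(3)[OF that]] by simp
    have 3: "(\<pi> k \<cdot> q) \<cdot> (j \<cdot> \<iota> l) = \<pi> k \<cdot> \<iota> l" if "k \<in> I" "l \<in> I"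
      using comp_assoc[OF d(3)[OF that(1)] b(4) jl[OF that(2)]] comp_cancel[OF b(6) b(4) b(2) d(2)[OF that(2)]] by simp
    show ?thesis using that 1 2 3 d(4) b(5) by auto
  qed
  moreover have "?\<iota> k \<in> Hom \<C> (X k) T" "?\<pi> k \<in> Hom \<C> T (X k)" if "k \<in> insert a I" for k
    using that b(1,3) comp_hom[OF b(2) d(2)] comp_hom[OF d(3) b(4)] by auto
  ultimately have "direct_sum \<C> (insert a I) X T ?\<iota> ?\<pi>"
    unfolding direct_sum_def using sum insert.hyps(1) by blast
  moreover have "T \<in> finite_sums \<C> (X ` insert a I)"
    by (rule finite_sums.step[OF _ finite_sums_mono[OF S(1)] T]) auto
  ultimately show ?case by blast
qed

lemma direct_sum_unique:
  assumes "direct_sum \<C> I X S \<iota> \<pi>" "direct_sum \<C> I X T \<iota>' \<pi>'"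
  shows "\<exists>f. is_iso \<C> S T f"
proof -
  have main: "(\<Sum>k\<in>I. \<iota> k \<cdot> \<pi>' k) \<in> Hom \<C> T S \<and> (\<Sum>k\<in>I. \<iota> k \<cdot> \<pi>' k) \<cdot> (\<Sum>k\<in>I. \<iota>' k \<cdot> \<pi> k) = Ident \<C> S"
    if S: "direct_sum \<C> I X S \<iota> \<pi>" and T: "direct_sum \<C> I X T \<iota>' \<pi>'" for S T \<iota> \<pi> \<iota>' \<pi>'
  proof -
    note d = direct_sumD[OF S] and d' = direct_sumD[OF T]
    have f: "(\<Sum>k\<in>I. \<iota>' k \<cdot> \<pi> k) \<in> Hom \<C> S T" using comp_hom[OF d'(2) d(3)] by (rule hom_sum)
    have "(\<Sum>k\<in>I. \<iota> k \<cdot> \<pi>' k) \<cdot> (\<Sum>k\<in>I. \<iota>' k \<cdot> \<pi> k) = (\<Sum>k\<in>I. (\<iota> k \<cdot> \<pi>' k) \<cdot> (\<Sum>k\<in>I. \<iota>' k \<cdot> \<pi> k))"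
      by (rule comp_sum_left[OF comp_hom[OF d(2) d'(3)] f])
    also have "\<dots> = (\<Sum>k\<in>I. \<iota> k \<cdot> \<pi> k)"
    proof (rule sum.cong[OF refl])
      fix k assume k: "k \<in> I"
      show "(\<iota> k \<cdot> \<pi>' k) \<cdot> (\<Sum>k\<in>I. \<iota>' k \<cdot> \<pi> k) = \<iota> k \<cdot> \<pi> k"
        using comp_assoc[OF d(2)[OF k] d'(3)[OF k] f] direct_sum_component[OF T k d(3)] by simp
    qed
    finally show ?thesis using d(5) hom_sum[OF comp_hom[OF d(2) d'(3)]] by simp
  qed
  have "is_iso \<C> S T (\<Sum>k\<in>I. \<iota>' k \<cdot> \<pi> k)"
    by (rule is_isoI[OF conjunct1[OF main[OF assms(2,1)]] conjunct1[OF main[OF assms]] conjunct2[OF main[OF assms]] conjunct2[OF main[OF assms(2,1)]]])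
  then show ?thesis by blast
qed

text \<open>The direct sum constructed summand by summand has this property, and every other one is
  isomorphic to it.\<close>

lemma direct_sum_in_finite_sums:
  assumes "direct_sum \<C> I X S \<iota> \<pi>"
  shows "S \<in> finite_sums \<C> (X ` I)"
proof -
  obtain T \<iota>' \<pi>' where T: "T \<in> finite_sums \<C> (X ` I)" "direct_sum \<C> I X T \<iota>' \<pi>'"
    using direct_sum_exists[OF direct_sumD(1)[OF assms], of X] by blast
  obtain f where "is_iso \<C> T S f" using direct_sum_unique[OF T(2) assms] by blast
  then show ?thesis by (rule finite_sums_iso[OF T(1)])
qed

lemma dsum_direct_sum:
  assumes "finite I" shows "\<exists>\<iota> \<pi>. direct_sum \<C> I X (dsum \<C> I X) \<iota> \<pi>"
  unfolding dsum_def by (rule someI_ex) (use direct_sum_exists[OF assms] in blast)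

lemma local_not_zero: "local_endomorphism_ring \<C> M \<Longrightarrow> \<not> zero_object \<C> M"
  by (simp add: local_endomorphism_ring_def zero_object_iff)

text \<open>One of the complementary idempotents \<open>i \<cdot> p\<close> and
  \<open>j \<cdot> q\<close> is invertible. The projection onto the other summand annihilates it,
  hence is zero.\<close>

lemma local_indecomposable:
  assumes "local_endomorphism_ring \<C> M" shows "indecomposable \<C> M"
  unfolding indecomposable_def
proof (intro conjI allI impI)
  show "\<not> zero_object \<C> M" using assms by (rule local_not_zero)
  fix X Y i j p q assume bp: "biproduct \<C> X Y M i j p q"
  note b = biproductD[OF bp]
  have m: "i \<cdot> p \<in> Hom \<C> M M" "j \<cdot> q \<in> Hom \<C> M M" using b by (blast intro: comp_hom)+
  have "is_iso \<C> M M (i \<cdot> p) \<or> is_iso \<C> M M (j \<cdot> q)"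
    using assms m is_iso_id[of M] b(9) unfolding local_endomorphism_ring_def by metis
  then show "zero_object \<C> X \<or> zero_object \<C> Y"
  proof
    assume "is_iso \<C> M M (i \<cdot> p)"
    moreover have "q \<cdot> (i \<cdot> p) = 0" using comp_reduce_zero[OF b(8) b(4) b(1) b(3)] .
    ultimately have "q = 0" by (rule is_iso_zero_comp_right[OF _ b(4)])
    then show ?thesis using b(6) comp_zero_left[OF b(2)] by (simp add: zero_object_iff)
  next
    assume "is_iso \<C> M M (j \<cdot> q)"
    moreover have "p \<cdot> (j \<cdot> q) = 0" using comp_reduce_zero[OF b(7) b(3) b(2) b(4)] .
    ultimately have "p = 0" by (rule is_iso_zero_comp_right[OF _ b(3)])
    then show ?thesis using b(5) comp_zero_left[OF b(1)] by (simp add: zero_object_iff)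
  qed
qed

lemma local_iso:
  assumes "is_iso \<C> A B f" "local_endomorphism_ring \<C> A" shows "local_endomorphism_ring \<C> B"
proof -
  obtain g where g: "f \<in> Hom \<C> A B" "g \<in> Hom \<C> B A" "g \<cdot> f = Ident \<C> A" "f \<cdot> g = Ident \<C> B" "is_iso \<C> B A g"
    using assms(1) by (rule is_isoE)
  have "is_iso \<C> B B u \<or> is_iso \<C> B B v" if uv: "u \<in> Hom \<C> B B" "v \<in> Hom \<C> B B" "is_iso \<C> B B (u + v)" for u v
  proof -
    have m: "g \<cdot> (u \<cdot> f) \<in> Hom \<C> A A" "g \<cdot> (v \<cdot> f) \<in> Hom \<C> A A" "u \<cdot> f \<in> Hom \<C> A B" "v \<cdot> f \<in> Hom \<C> A B"
      using g uv by (blast intro: comp_hom)+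
    have "g \<cdot> ((u + v) \<cdot> f) = g \<cdot> (u \<cdot> f) + g \<cdot> (v \<cdot> f)" using g uv m by (simp add: comp_add_left comp_add_right)
    moreover have "is_iso \<C> A A (g \<cdot> ((u + v) \<cdot> f))" by (rule is_iso_comp[OF g(5) is_iso_comp[OF uv(3) assms(1)]])
    ultimately have "is_iso \<C> A A (g \<cdot> (u \<cdot> f)) \<or> is_iso \<C> A A (g \<cdot> (v \<cdot> f))"
      using assms(2) m unfolding local_endomorphism_ring_def by metis
    moreover have transfer: "is_iso \<C> B B w" if w: "w \<in> Hom \<C> B B" "is_iso \<C> A A (g \<cdot> (w \<cdot> f))" for w
    proof -
      have mw: "w \<cdot> f \<in> Hom \<C> A B" "g \<cdot> (w \<cdot> f) \<in> Hom \<C> A A" using g w by (blast intro: comp_hom)+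
      have "f \<cdot> ((g \<cdot> (w \<cdot> f)) \<cdot> g) = w"
        using g w mw comp_cancel[OF g(4) g(1,2)] by (simp add: comp_assoc id_right)
      then show ?thesis using is_iso_comp[OF assms(1) is_iso_comp[OF w(2) g(5)]] by simp
    qed
    ultimately show ?thesis using uv by blast
  qed
  moreover have "Ident \<C> B \<noteq> 0" using zero_object_iso[OF g(5)] local_not_zero[OF assms(2)] zero_object_iff by blast
  ultimately show ?thesis unfolding local_endomorphism_ring_def by blast
qed

lemma local_sum_iso:
  assumes "local_endomorphism_ring \<C> M" "finite I" "\<And>k. k \<in> I \<Longrightarrow> g k \<in> Hom \<C> M M" "is_iso \<C> M M (\<Sum>k\<in>I. g k)"
  shows "\<exists>k\<in>I. is_iso \<C> M M (g k)"
  using assms(2,3,4)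
proof (induction I rule: finite_induct)
  case empty
  then have "Ident \<C> M = 0" using comp_zero_right by (auto simp: is_iso_def)
  then show ?case using assms(1) by (simp add: local_endomorphism_ring_def)
next
  case (insert a I)
  then have "is_iso \<C> M M (g a) \<or> is_iso \<C> M M (\<Sum>k\<in>I. g k)"
    using assms(1) hom_sum[of I g M M] unfolding local_endomorphism_ring_def by simp
  then show ?case using insert by blast
qed

lemma brick_local: "brick \<C> M \<Longrightarrow> local_endomorphism_ring \<C> M"
  unfolding brick_def local_endomorphism_ring_def by (metis add_0)

end

section \<open>Consequences of the Krull--Schmidt property\<close>

context krull_schmidt_category
begin

lemma in_finite_sums_local: "A \<in> finite_sums \<C> {X. local_endomorphism_ring \<C> X}"
proof -
  obtain n :: nat and X \<iota> \<pi> where "direct_sum \<C> {..<n} X A \<iota> \<pi>" "\<forall>i<n. local_endomorphism_ring \<C> (X i)"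
    using krull_schmidt[of A] by blast
  then show ?thesis by (intro finite_sums_mono[OF direct_sum_in_finite_sums]) auto
qed

text \<open>A local summand splits off from \<open>M\<close>; as it is nonzero, its complement must
  vanish.\<close>

lemma indecomposable_local:
  assumes "indecomposable \<C> M" shows "local_endomorphism_ring \<C> M"
  using in_finite_sums_local[of M]
proof cases
  case zero
  then show ?thesis using assms by (simp add: indecomposable_def)
next
  case (step X A i j p q)
  then have "zero_object \<C> A" using assms local_not_zero[of X] unfolding indecomposable_def by blast
  then show ?thesis using local_iso[OF biproduct_zero_iso(1)[OF step(3)]] step(1) by simp
qed

text \<open>The idempotent \<open>s \<cdot> r\<close> splits, and the complement of its image is
  also a complement of \<open>X\<close>: from \<open>i \<cdot> p = s \<cdot> r\<close> it follows
  that \<open>r\<close> kills \<open>j\<close> and \<open>q\<close> kills \<open>s\<close>.\<close>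

lemma retract_complement:
  assumes s: "s \<in> Hom \<C> X A" and r: "r \<in> Hom \<C> A X" and rs: "r \<cdot> s = Ident \<C> X"
  shows "\<exists>R j q. biproduct \<C> X R A s j r q"
proof -
  have e: "s \<cdot> r \<in> Hom \<C> A A" "(s \<cdot> r) \<cdot> (s \<cdot> r) = s \<cdot> r"
    using s r comp_cancel[OF rs r s r] comp_assoc[OF s r comp_hom[OF s r]] by (simp_all add: comp_hom)
  obtain Y Z i j p q where Y: "biproduct \<C> Y Z A i j p q" "i \<cdot> p = s \<cdot> r"
    using split_idempotent[OF in_finite_sums_local[of A] _ e] by auto
  note b = biproductD[OF Y(1)]
  have m: "r \<cdot> j \<in> Hom \<C> Z X" "q \<cdot> s \<in> Hom \<C> X Z" "p \<cdot> j \<in> Hom \<C> Z Y" "q \<cdot> i \<in> Hom \<C> Y Z" using b s r by (blast intro: comp_hom)+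
  have "r \<cdot> j = r \<cdot> ((s \<cdot> r) \<cdot> j)" using comp_cancel[OF rs r s m(1)] s r b by (simp add: comp_assoc)
  also have "\<dots> = r \<cdot> (i \<cdot> (p \<cdot> j))" using Y(2)[symmetric] b by (simp only: comp_assoc)
  also have "\<dots> = 0" using b r by (simp add: comp_zero_right)
  finally have rj: "r \<cdot> j = 0" .
  have "q \<cdot> s = (q \<cdot> (s \<cdot> r)) \<cdot> s" using rs s r b comp_assoc[OF b(4) e(1) s] by (simp add: comp_assoc id_right)
  also have "\<dots> = 0" using Y(2) comp_reduce_zero[OF b(8,4,1,3)] s by (simp add: comp_zero_left)
  finally have "q \<cdot> s = 0" .
  then have "biproduct \<C> X Z A s j r q" using b s r rs rj Y(2) by (intro biproductI) simp_all
  then show ?thesis by blast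
qed

end

section \<open>Exact sequences in extriangulated categories\<close>

context extriangulated_category
begin

lemma ext_zero [simp]: "0 \<in> Ext \<C> C A"
  using ext_subspace[of C A] ext_ambient module.subspace_0 module_iff_vector_space by metis

lemma ext_add: "\<delta> \<in> Ext \<C> C A \<Longrightarrow> \<epsilon> \<in> Ext \<C> C A \<Longrightarrow> \<delta> + \<epsilon> \<in> Ext \<C> C A"
  using ext_subspace[of C A] ext_ambient module.subspace_add module_iff_vector_space by metis

lemma ext_sum: "(\<And>i. i \<in> I \<Longrightarrow> \<delta> i \<in> Ext \<C> C A) \<Longrightarrow> sum \<delta> I \<in> Ext \<C> C A"
  by (induction I rule: infinite_finite_induct) (auto intro: ext_add)

lemma push_zero: "a \<in> Hom \<C> A A' \<Longrightarrow> push \<C> a 0 = 0"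
  using push_add[of a A A' 0 A 0] by simp

lemma pull_zero: "c \<in> Hom \<C> C' C \<Longrightarrow> pull \<C> c 0 = 0"
  using pull_add[of c C' C 0 C 0] by simp

lemma push_zero_hom: "\<delta> \<in> Ext \<C> C A \<Longrightarrow> push \<C> 0 \<delta> = 0"
  using push_add_hom[of 0 A A 0 \<delta> C] by simp

lemma pull_zero_hom: "\<delta> \<in> Ext \<C> C A \<Longrightarrow> pull \<C> 0 \<delta> = 0"
  using pull_add_hom[of 0 C C 0 \<delta> A] by simp

lemma push_sum: "a \<in> Hom \<C> A A' \<Longrightarrow> (\<And>i. i \<in> I \<Longrightarrow> \<delta> i \<in> Ext \<C> C A) \<Longrightarrow>
    push \<C> a (sum \<delta> I) = (\<Sum>i\<in>I. push \<C> a (\<delta> i))"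
proof (induction I rule: infinite_finite_induct)
  case (insert k I)
  then show ?case using push_add[of a A A' "\<delta> k" C "sum \<delta> I"] ext_sum[of I \<delta> C A] by simp
qed (simp_all add: push_zero)

lemma ext_vanishI: "(\<And>\<epsilon>. \<epsilon> \<in> Ext \<C> C A \<Longrightarrow> \<epsilon> = 0) \<Longrightarrow> Ext \<C> C A = {0}"
  using ext_zero by blast

lemma conflationD:
  assumes "conflation \<C> A x B y C \<delta>"
  shows "\<delta> \<in> Ext \<C> C A" "x \<in> Hom \<C> A B" "y \<in> Hom \<C> B C" "y \<cdot> x = 0"
proof -
  show d: "\<delta> \<in> Ext \<C> C A" using assms by (simp add: conflation_def)
  have "(B, x, y) \<in> Realiz \<C> C A \<delta>" using assms by (simp add: conflation_def)
  then have "(B, x, y) \<in> complexes \<C> A C"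
    using real_class[OF d] by (auto simp: quotient_def complex_equiv_def)
  then show "x \<in> Hom \<C> A B" "y \<in> Hom \<C> B C" "y \<cdot> x = 0" by (simp_all add: complexes_def)
qed

lemma conflation_exists:
  assumes "\<delta> \<in> Ext \<C> C A" shows "\<exists>B x y. conflation \<C> A x B y C \<delta>"
proof -
  obtain B x y where t: "(B, x, y) \<in> complexes \<C> A C" "Realiz \<C> C A \<delta> = complex_equiv \<C> A C `` {(B, x, y)}"
    using real_class[OF assms] by (auto simp: quotient_def)
  have "Ident \<C> B \<cdot> x = x" "y \<cdot> Ident \<C> B = y" using t(1) by (auto simp: complexes_def id_left id_right)
  then have "((B, x, y), (B, x, y)) \<in> complex_equiv \<C> A C" using t(1) is_iso_id[of B] by (auto simp: complex_equiv_def)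
  then have "conflation \<C> A x B y C \<delta>" using assms t(2) by (simp add: conflation_def)
  then show ?thesis by blast
qed

text \<open>A realization is a whole equivalence class of complexes, so the middle term may be
  replaced along an isomorphism compatible with both ends.\<close>

lemma conflation_iso:
  assumes c: "conflation \<C> A x B y C \<delta>" and b: "is_iso \<C> B B' b" and y': "y' \<in> Hom \<C> B' C" "y' \<cdot> b = y"
  shows "conflation \<C> A (b \<cdot> x) B' y' C \<delta>"
proof -
  note d = conflationD[OF c]
  have bm: "b \<in> Hom \<C> B B'" using b by (simp add: is_iso_def)
  obtain B0 x0 y0 where R: "Realiz \<C> C A \<delta> = complex_equiv \<C> A C `` {(B0, x0, y0)}"
    using real_class[OF d(1)] by (auto simp: quotient_def)
  have "((B0, x0, y0), (B, x, y)) \<in> complex_equiv \<C> A C" using c R by (simp add: conflation_def)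
  then obtain f where f: "is_iso \<C> B0 B f" "f \<cdot> x0 = x" "y \<cdot> f = y0" "(B0, x0, y0) \<in> complexes \<C> A C"
    by (auto simp: complex_equiv_def)
  have m: "f \<in> Hom \<C> B0 B" "x0 \<in> Hom \<C> A B0" using f by (auto simp: is_iso_def complexes_def)
  have "(b \<cdot> f) \<cdot> x0 = b \<cdot> x" "y' \<cdot> (b \<cdot> f) = y0"
    using comp_assoc[OF bm m] comp_reduce[OF y'(2) y'(1) bm m(1)] f by simp_all
  moreover have "(B', b \<cdot> x, y') \<in> complexes \<C> A C"
    using comp_reduce[OF y'(2) y'(1) bm d(2)] y' d(4) comp_hom[OF bm d(2)] by (simp add: complexes_def)
  ultimately have "((B0, x0, y0), (B', b \<cdot> x, y')) \<in> complex_equiv \<C> A C"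
    using f is_iso_comp[OF b f(1)] by (auto simp: complex_equiv_def)
  then show ?thesis using d(1) R by (simp add: conflation_def)
qed

lemma conflation_unique:
  assumes "conflation \<C> A x B y C \<delta>" "conflation \<C> A x' B' y' C \<delta>"
  shows "\<exists>b. is_iso \<C> B B' b \<and> b \<cdot> x = x' \<and> y' \<cdot> b = y"
proof -
  note d = conflationD[OF assms(1)] and d' = conflationD[OF assms(2)]
  obtain B0 x0 y0 where R: "Realiz \<C> C A \<delta> = complex_equiv \<C> A C `` {(B0, x0, y0)}"
    using real_class[OF d(1)] by (auto simp: quotient_def)
  have "((B0, x0, y0), (B, x, y)) \<in> complex_equiv \<C> A C" "((B0, x0, y0), (B', x', y')) \<in> complex_equiv \<C> A C"
    using assms R by (simp_all add: conflation_def)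
  then obtain f f' where f: "is_iso \<C> B0 B f" "f \<cdot> x0 = x" "y \<cdot> f = y0" "x0 \<in> Hom \<C> A B0"
    and f': "is_iso \<C> B0 B' f'" "f' \<cdot> x0 = x'" "y' \<cdot> f' = y0"
    by (auto simp: complex_equiv_def complexes_def)
  obtain g where g: "f \<in> Hom \<C> B0 B" "g \<in> Hom \<C> B B0" "g \<cdot> f = Ident \<C> B0" "f \<cdot> g = Ident \<C> B" "is_iso \<C> B B0 g"
    using f(1) by (rule is_isoE)
  have m: "f' \<in> Hom \<C> B0 B'" using f'(1) by (simp add: is_iso_def)
  have "g \<cdot> x = x0" using comp_cancel[OF g(3,2,1) f(4)] f(2) by simp
  then have "(f' \<cdot> g) \<cdot> x = x'" using comp_assoc[OF m g(2) d(2)] f'(2) by simp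
  moreover have "y' \<cdot> (f' \<cdot> g) = y"
    using comp_reduce[OF f'(3) d'(3) m g(2)] comp_assoc[OF d(3) g(1,2)] f(3) g(4) id_right[OF d(3)] by simp
  ultimately show ?thesis using is_iso_comp[OF f'(1) g(5)] by blast
qed

lemma conflation_biproduct: "biproduct \<C> A C S i j p q \<Longrightarrow> conflation \<C> A i S q C 0"
  using real_split by (simp add: conflation_def)

text \<open>The class 0 is also realized by a biproduct, and two realizations of one class differ by
  an isomorphism of middle terms, which carries the biproduct structure over.\<close>

lemma conflation_zero_biproduct:
  assumes "conflation \<C> A x B y C 0" shows "\<exists>s r. biproduct \<C> A C B x s r y"
proof -
  obtain S i j p q where S: "biproduct \<C> A C S i j p q" using biproduct_exists by blast
  obtain b where b: "is_iso \<C> S B b" "b \<cdot> i = x" "y \<cdot> b = q"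
    using conflation_unique[OF conflation_biproduct[OF S] assms] by blast
  obtain g where g: "b \<in> Hom \<C> S B" "g \<in> Hom \<C> B S" "g \<cdot> b = Ident \<C> S" "b \<cdot> g = Ident \<C> B"
    using b(1) by (rule is_isoE)
  have "q \<cdot> g = y" using comp_assoc[OF conflationD(3)[OF assms] g(1,2)] b(3) g(4) id_right[OF conflationD(3)[OF assms]] by simp
  then show ?thesis using biproduct_transport[OF S g] b(2) by auto
qed

lemma conflation_id_left: "\<exists>Z. zero_object \<C> Z \<and> conflation \<C> Z 0 A (Ident \<C> A) A 0"
  using zero_object_exists conflation_biproduct[OF biproduct_zero_left] by blast

lemma conflation_id_right: "\<exists>Z. zero_object \<C> Z \<and> conflation \<C> A (Ident \<C> A) A 0 Z 0"
  using zero_object_exists conflation_biproduct[OF biproduct_zero_right] by blast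

text \<open>Compare with the trivial conflation \<open>W \<rightarrow> W \<rightarrow> 0\<close>: as
  \<open>y \<cdot> f = 0\<close>, the right-hand square commutes, and the dual of (ET3) supplies the
  map on the left ends.\<close>

lemma hom_factor_inflation:
  assumes c: "conflation \<C> A x B y C \<delta>" and f: "f \<in> Hom \<C> W B" "y \<cdot> f = 0"
  shows "\<exists>g\<in>Hom \<C> W A. f = x \<cdot> g"
proof -
  obtain Z where Z: "conflation \<C> W (Ident \<C> W) W 0 Z 0" using conflation_id_right[of W] by blast
  have "y \<cdot> f = 0 \<cdot> 0" using f comp_zero_right[OF hom_zero] by simp
  then obtain a where "a \<in> Hom \<C> W A" "f \<cdot> Ident \<C> W = x \<cdot> a" using ET3_op[OF Z c f(1) hom_zero] by blast
  then show ?thesis using id_right[OF f(1)] by auto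
qed

lemma hom_factor_deflation:
  assumes c: "conflation \<C> A x B y C \<delta>" and f: "f \<in> Hom \<C> B W" "f \<cdot> x = 0"
  shows "\<exists>g\<in>Hom \<C> C W. f = g \<cdot> y"
proof -
  obtain Z where Z: "conflation \<C> Z 0 W (Ident \<C> W) W 0" using conflation_id_left[of W] by blast
  have "f \<cdot> x = 0 \<cdot> 0" using f comp_zero_right[OF hom_zero] by simp
  then obtain g where "g \<in> Hom \<C> C W" "g \<cdot> y = Ident \<C> W \<cdot> f" using ET3[OF c Z hom_zero f(1)] by blast
  then show ?thesis using id_left[OF f(1)] by auto
qed

text \<open>When \<open>pull \<C> f \<delta>\<close> vanishes, the identity of \<open>A\<close> and
  \<open>f\<close> form a morphism from the split extension of \<open>W\<close> by \<open>A\<close>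
  to \<open>\<delta>\<close>. A realization of it, restricted to the summand \<open>W\<close>, is
  the lift.\<close>

lemma lift_deflation:
  assumes c: "conflation \<C> A x B y C \<delta>" and f: "f \<in> Hom \<C> W C" "pull \<C> f \<delta> = 0"
  shows "\<exists>g\<in>Hom \<C> W B. y \<cdot> g = f"
proof -
  obtain S i j p q where S: "biproduct \<C> A W S i j p q" using biproduct_exists by blast
  note s = biproductD[OF S] and d = conflationD[OF c]
  have "push \<C> (Ident \<C> A) 0 = pull \<C> f \<delta>" using f push_id[OF ext_zero] by simp
  then obtain b where b: "b \<in> Hom \<C> S B" "y \<cdot> b = f \<cdot> q"
    using real_morphism[OF conflation_biproduct[OF S] c id_hom f(1)] by blast
  have "y \<cdot> (b \<cdot> j) = f" using comp_reduce[OF b(2) d(3) b(1) s(2)] comp_assoc[OF f(1) s(4,2)] s(6) id_right[OF f(1)] by simp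
  then show ?thesis using comp_hom[OF b(1) s(2)] by blast
qed

lemma extend_inflation:
  assumes c: "conflation \<C> A x B y C \<delta>" and f: "f \<in> Hom \<C> A W" "push \<C> f \<delta> = 0"
  shows "\<exists>g\<in>Hom \<C> B W. g \<cdot> x = f"
proof -
  obtain S i j p q where S: "biproduct \<C> W C S i j p q" using biproduct_exists by blast
  note s = biproductD[OF S] and d = conflationD[OF c]
  have "push \<C> f \<delta> = pull \<C> (Ident \<C> C) 0" using f pull_id[OF ext_zero] by simp
  then obtain b where b: "b \<in> Hom \<C> B S" "b \<cdot> x = i \<cdot> f"
    using real_morphism[OF c conflation_biproduct[OF S] f(1) id_hom] by blast
  have "(p \<cdot> b) \<cdot> x = f" using comp_assoc[OF s(3) b(1) d(2)] b(2) comp_cancel[OF s(5,3,1) f(1)] by simp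
  then show ?thesis using comp_hom[OF s(3) b(1)] by blast
qed

text \<open>(ET3), applied to the map from the biproduct of \<open>A\<close> and \<open>B\<close> to
  \<open>B\<close> given by \<open>x\<close> and 1, yields \<open>g\<close> with
  \<open>pull \<C> g \<delta> = 0\<close>; restriction to the summand \<open>B\<close> identifies
  \<open>g\<close> with \<open>y\<close>.\<close>

lemma pull_deflation:
  assumes c: "conflation \<C> A x B y C \<delta>" shows "pull \<C> y \<delta> = 0"
proof -
  obtain S i j p q where S: "biproduct \<C> A B S i j p q" using biproduct_exists by blast
  note s = biproductD[OF S] and d = conflationD[OF c]
  have m: "x \<cdot> p \<in> Hom \<C> S B" "x \<cdot> p + q \<in> Hom \<C> S B" using s d by - (assumption | rule hom_intros)+
  have "(x \<cdot> p + q) \<cdot> i = x \<cdot> Ident \<C> A" using s d m by (simp add: comp_add_left comp_assoc)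
  then obtain g where g: "g \<in> Hom \<C> B C" "g \<cdot> q = y \<cdot> (x \<cdot> p + q)" "push \<C> (Ident \<C> A) 0 = pull \<C> g \<delta>"
    using ET3[OF conflation_biproduct[OF S] c id_hom m(2)] by blast
  have "g \<cdot> q = y \<cdot> q" using g(2) s d m by (simp add: comp_add_right comp_reduce_zero)
  then have "(g \<cdot> q) \<cdot> j = (y \<cdot> q) \<cdot> j" by simp
  then have "g = y" using s d g(1) by (simp add: comp_assoc id_right)
  then show ?thesis using g(3) push_id[OF ext_zero] by simp
qed

lemma push_inflation:
  assumes c: "conflation \<C> A x B y C \<delta>" shows "push \<C> x \<delta> = 0"
proof -
  obtain S i j p q where S: "biproduct \<C> B C S i j p q" using biproduct_exists by blast
  note s = biproductD[OF S] and d = conflationD[OF c]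
  have m: "j \<cdot> y \<in> Hom \<C> B S" "i + j \<cdot> y \<in> Hom \<C> B S" using s d by - (assumption | rule hom_intros)+
  have "q \<cdot> (i + j \<cdot> y) = Ident \<C> C \<cdot> y" using s d m by (simp add: comp_add_right comp_cancel id_left)
  then obtain g where g: "g \<in> Hom \<C> A B" "(i + j \<cdot> y) \<cdot> x = i \<cdot> g" "push \<C> g \<delta> = pull \<C> (Ident \<C> C) 0"
    using ET3_op[OF c conflation_biproduct[OF S] m(2) id_hom] by blast
  have "i \<cdot> x = i \<cdot> g" using g(2) s d m by (simp add: comp_add_left comp_assoc comp_zero_right)
  then have "p \<cdot> (i \<cdot> x) = p \<cdot> (i \<cdot> g)" by simp
  then have "g = x" using s d g by (simp add: comp_cancel)
  then show ?thesis using g(3) pull_id[OF ext_zero] by simp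
qed

text \<open>Realize \<open>\<epsilon>\<close> by \<open>B \<rightarrow> E \<rightarrow> W\<close>.
  By (ET4), \<open>push \<C> y \<epsilon>\<close> is realized by an extension of \<open>W\<close> by
  the cone of \<open>x\<close>, which splits. The class \<open>\<delta>''\<close> of the composite
  inflation \<open>A \<rightarrow> E\<close>, pulled back along the splitting, is the
  preimage.\<close>

lemma ext_exact_covariant:
  assumes c: "conflation \<C> A x B y C \<delta>" and e: "\<epsilon> \<in> Ext \<C> W B" "push \<C> y \<epsilon> = 0"
  shows "\<exists>\<epsilon>'\<in>Ext \<C> W A. \<epsilon> = push \<C> x \<epsilon>'"
proof -
  note d = conflationD[OF c]
  obtain E g g' where E: "conflation \<C> B g E g' W \<epsilon>" using conflation_exists[OF e(1)] by blast
  obtain E' h' d' e' \<delta>'' where E': "conflation \<C> A (g \<cdot> x) E h' E' \<delta>''" "conflation \<C> C d' E' e' W (push \<C> y \<epsilon>)"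
    "push \<C> x \<delta>'' = pull \<C> e' \<epsilon>" using ET4[OF c E] by blast
  have "pull \<C> (Ident \<C> W) (push \<C> y \<epsilon>) = 0" using e(2) pull_zero[OF id_hom] by simp
  then obtain s where s: "s \<in> Hom \<C> W E'" "e' \<cdot> s = Ident \<C> W" using lift_deflation[OF E'(2) id_hom] by blast
  have m: "e' \<in> Hom \<C> E' W" "\<delta>'' \<in> Ext \<C> E' A" using conflationD[OF E'(2)] conflationD[OF E'(1)] by simp_all
  have "\<epsilon> = pull \<C> s (pull \<C> e' \<epsilon>)" using pull_comp[OF m(1) s(1) e(1)] s(2) pull_id[OF e(1)] by simp
  also have "\<dots> = push \<C> x (pull \<C> s \<delta>'')" using E'(3) push_pull[OF d(2) s(1) m(2)] by simp
  finally show ?thesis using pull_ext[OF s(1) m(2)] by blast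
qed

lemma ext_exact_contravariant:
  assumes c: "conflation \<C> A x B y C \<delta>" and e: "\<epsilon> \<in> Ext \<C> B W" "pull \<C> x \<epsilon> = 0"
  shows "\<exists>\<epsilon>'\<in>Ext \<C> C W. \<epsilon> = pull \<C> y \<epsilon>'"
proof -
  note d = conflationD[OF c]
  obtain E g' g where E: "conflation \<C> W g' E g B \<epsilon>" using conflation_exists[OF e(1)] by blast
  obtain E' h' d' e' \<delta>'' where E': "conflation \<C> E' h' E (y \<cdot> g) C \<delta>''" "conflation \<C> W e' E' d' A (pull \<C> x \<epsilon>)"
    "pull \<C> y \<delta>'' = push \<C> e' \<epsilon>" using ET4_op[OF c E] by blast
  have "push \<C> (Ident \<C> W) (pull \<C> x \<epsilon>) = 0" using e(2) push_zero[OF id_hom] by simp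
  then obtain r where r: "r \<in> Hom \<C> E' W" "r \<cdot> e' = Ident \<C> W" using extend_inflation[OF E'(2) id_hom] by blast
  have m: "e' \<in> Hom \<C> W E'" "\<delta>'' \<in> Ext \<C> C E'" using conflationD[OF E'(2)] conflationD[OF E'(1)] by simp_all
  have "\<epsilon> = push \<C> r (push \<C> e' \<epsilon>)" using push_comp[OF r(1) m(1) e(1)] r(2) push_id[OF e(1)] by simp
  also have "\<dots> = pull \<C> y (push \<C> r \<delta>'')" using E'(3) push_pull[OF r(1) d(3) m(2)] by simp
  finally show ?thesis using push_ext[OF r(1) m(2)] by blast
qed

lemma ext_vanish_covariant:
  assumes c: "conflation \<C> A x B y C \<delta>" and "Ext \<C> W A = {0}" "Ext \<C> W C = {0}" shows "Ext \<C> W B = {0}"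
proof (rule ext_vanishI)
  fix \<epsilon> assume e: "\<epsilon> \<in> Ext \<C> W B"
  note d = conflationD[OF c]
  have "push \<C> y \<epsilon> = 0" using push_ext[OF d(3) e] assms(3) by simp
  then obtain \<epsilon>' where "\<epsilon>' \<in> Ext \<C> W A" "\<epsilon> = push \<C> x \<epsilon>'" using ext_exact_covariant[OF c e] by blast
  then show "\<epsilon> = 0" using assms(2) push_zero[OF d(2)] by simp
qed

lemma ext_vanish_contravariant:
  assumes c: "conflation \<C> A x B y C \<delta>" and "Ext \<C> A W = {0}" "Ext \<C> C W = {0}" shows "Ext \<C> B W = {0}"
proof (rule ext_vanishI)
  fix \<epsilon> assume e: "\<epsilon> \<in> Ext \<C> B W"
  note d = conflationD[OF c]
  have "pull \<C> x \<epsilon> = 0" using pull_ext[OF d(2) e] assms(2) by simp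
  then obtain \<epsilon>' where "\<epsilon>' \<in> Ext \<C> C W" "\<epsilon> = pull \<C> y \<epsilon>'" using ext_exact_contravariant[OF c e] by blast
  then show "\<epsilon> = 0" using assms(3) pull_zero[OF d(3)] by simp
qed

lemma hom_vanish_covariant:
  assumes c: "conflation \<C> A x B y C \<delta>" and "Hom \<C> W A = {0}" "Hom \<C> W C = {0}" shows "Hom \<C> W B = {0}"
proof -
  note d = conflationD[OF c]
  have "f = 0" if f: "f \<in> Hom \<C> W B" for f
  proof -
    have "y \<cdot> f = 0" using comp_hom[OF d(3) f] assms(3) by simp
    then obtain g where "g \<in> Hom \<C> W A" "f = x \<cdot> g" using hom_factor_inflation[OF c f] by blast
    then show ?thesis using assms(2) comp_zero_right[OF d(2)] by simp
  qed
  then show ?thesis using hom_zero[of W B] by auto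
qed

lemma hom_vanish_contravariant:
  assumes c: "conflation \<C> A x B y C \<delta>" and "Hom \<C> A W = {0}" "Hom \<C> C W = {0}" shows "Hom \<C> B W = {0}"
proof -
  note d = conflationD[OF c]
  have "f = 0" if f: "f \<in> Hom \<C> B W" for f
  proof -
    have "f \<cdot> x = 0" using comp_hom[OF f d(2)] assms(2) by simp
    then obtain g where "g \<in> Hom \<C> C W" "f = g \<cdot> y" using hom_factor_deflation[OF c f] by blast
    then show ?thesis using assms(3) comp_zero_left[OF d(3)] by simp
  qed
  then show ?thesis using hom_zero[of B W] by auto
qed

lemma ext_zero_object:
  assumes "zero_object \<C> Z" shows "Ext \<C> Z A = {0}" "Ext \<C> A Z = {0}"
proof -
  have Z: "Ident \<C> Z = 0" using assms by (simp add: zero_object_iff)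
  show "Ext \<C> Z A = {0}" by (rule ext_vanishI) (use Z pull_id pull_zero_hom in metis)
  show "Ext \<C> A Z = {0}" by (rule ext_vanishI) (use Z push_id push_zero_hom in metis)
qed

lemma ext_vanish_retract:
  assumes "s \<in> Hom \<C> X A" "r \<in> Hom \<C> A X" "r \<cdot> s = Ident \<C> X" "Ext \<C> A W = {0}"
  shows "Ext \<C> X W = {0}"
proof (rule ext_vanishI)
  fix \<epsilon> assume e: "\<epsilon> \<in> Ext \<C> X W"
  have "\<epsilon> = pull \<C> s (pull \<C> r \<epsilon>)" using pull_comp[OF assms(2,1) e] assms(3) pull_id[OF e] by simp
  then show "\<epsilon> = 0" using pull_ext[OF assms(2) e] assms(4) pull_zero[OF assms(1)] by simp
qed

lemma conflation_from_zero_iso: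
  assumes c: "conflation \<C> Z x B y C \<delta>" and Z: "zero_object \<C> Z" shows "is_iso \<C> B C y"
proof -
  note d = conflationD[OF c]
  have "\<delta> = 0" using d(1) ext_zero_object(2)[OF Z] by blast
  then obtain s r where "biproduct \<C> Z C B x s r y" using conflation_zero_biproduct c by blast
  then show ?thesis using biproduct_zero_iso(2)[OF biproduct_swap Z] by simp
qed

text \<open>\<open>b - 1\<close> kills \<open>x\<close>, hence factors through \<open>y\<close>;
  since also \<open>y \<cdot> (b - 1) = 0\<close>, its square is zero.\<close>

lemma conflation_endo_iso:
  assumes c: "conflation \<C> A x B y C \<delta>" and b: "b \<in> Hom \<C> B B" "b \<cdot> x = x" "y \<cdot> b = y"
  shows "is_iso \<C> B B b"
proof (rule is_iso_unipotent[OF b(1)])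
  note d = conflationD[OF c]
  have m: "b - Ident \<C> B \<in> Hom \<C> B B" using b id_hom by (simp add: hom_diff)
  have "(b - Ident \<C> B) \<cdot> x = 0" using b d id_hom[of B] by (simp add: comp_diff_left id_left)
  then obtain g where g: "g \<in> Hom \<C> C B" "b - Ident \<C> B = g \<cdot> y" using hom_factor_deflation[OF c m] by blast
  have "y \<cdot> (b - Ident \<C> B) = 0" using b d id_hom[of B] by (simp add: comp_diff_right id_right)
  then have "(g \<cdot> y) \<cdot> (b - Ident \<C> B) = 0" using comp_assoc[OF g(1) d(3) m] comp_zero_right[OF g(1)] by simp
  then show "(b - Ident \<C> B) \<cdot> (b - Ident \<C> B) = 0" using g(2) by simp
qed

end

section \<open>Vanishing of negative extensions, monic inflations and epic deflations\<close>

context negative_first_extension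
begin

lemma npush_zero: "a \<in> Hom \<C> A A' \<Longrightarrow> npush \<C> a 0 = 0"
  using npush_add[of a A A' 0 A 0] next_zero[of A A] by simp

lemma npull_zero: "c \<in> Hom \<C> C' C \<Longrightarrow> npull \<C> c 0 = 0"
  using npull_add[of c C' C 0 C 0] next_zero[of C C] by simp

lemma next_vanish_covariant:
  assumes c: "conflation \<C> A x B y C \<delta>" and "NExt \<C> W A = {0}" "NExt \<C> W C = {0}" shows "NExt \<C> W B = {0}"
proof -
  note d = conflationD[OF c]
  have "\<eta> = 0" if h: "\<eta> \<in> NExt \<C> W B" for \<eta>
  proof -
    have "npush \<C> y \<eta> = 0" using npush_next[OF d(3) h] assms(3) by simp
    then have "\<eta> \<in> npush \<C> x ` NExt \<C> W A" using exact_cov[OF c, of W] h by (simp add: exact_at_def)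
    then show ?thesis using assms(2) npush_zero[OF d(2)] by simp
  qed
  then show ?thesis using next_zero[of W B] by auto
qed

lemma next_vanish_contravariant:
  assumes c: "conflation \<C> A x B y C \<delta>" and "NExt \<C> A W = {0}" "NExt \<C> C W = {0}" shows "NExt \<C> B W = {0}"
proof -
  note d = conflationD[OF c]
  have "\<eta> = 0" if h: "\<eta> \<in> NExt \<C> B W" for \<eta>
  proof -
    have "npull \<C> x \<eta> = 0" using npull_next[OF d(2) h] assms(2) by simp
    then have "\<eta> \<in> npull \<C> y ` NExt \<C> C W" using exact_contra[OF c, of W] h by (simp add: exact_at_def)
    then show ?thesis using assms(3) npull_zero[OF d(3)] by simp
  qed
  then show ?thesis using next_zero[of B W] by auto
qed

lemma next_zero_object:
  assumes "zero_object \<C> Z" shows "NExt \<C> Z A = {0}" "NExt \<C> A Z = {0}"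
proof -
  have Z: "Ident \<C> Z = 0" using assms by (simp add: zero_object_iff)
  have "\<eta> = 0" if h: "\<eta> \<in> NExt \<C> Z A" for \<eta>
    using npull_add_hom[OF id_hom id_hom h] npull_id[OF h] Z by simp
  moreover have "\<eta> = 0" if h: "\<eta> \<in> NExt \<C> A Z" for \<eta>
    using npush_add_hom[OF id_hom id_hom h] npush_id[OF h] Z by simp
  ultimately show "NExt \<C> Z A = {0}" "NExt \<C> A Z = {0}" using next_zero by auto
qed

text \<open>The maps from \<open>W\<close> killed by \<open>x\<close> are the image of the
  connecting map from \<open>NExt \<C> W C\<close>. Inflations need not be monic in general; this
  vanishing makes \<open>x\<close> monic against \<open>W\<close>.\<close>

lemma inflation_mono:
  assumes c: "conflation \<C> A x B y C \<delta>" and N: "NExt \<C> W C = {0}" and g: "g \<in> Hom \<C> W A" "x \<cdot> g = 0"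
  shows "g = 0"
proof -
  note d = conflationD[OF c]
  have "g \<in> conn_cov \<C> C A \<delta> W ` NExt \<C> W C" using exact_cov[OF c, of W] g by (simp add: exact_at_def)
  moreover have "conn_cov \<C> C A \<delta> W 0 = 0" using conn_cov_add[OF d(1) next_zero next_zero, of W] by simp
  ultimately show ?thesis using N by simp
qed

lemma deflation_epi:
  assumes c: "conflation \<C> A x B y C \<delta>" and N: "NExt \<C> A W = {0}" and g: "g \<in> Hom \<C> C W" "g \<cdot> y = 0"
  shows "g = 0"
proof -
  note d = conflationD[OF c]
  have "g \<in> conn_contra \<C> C A \<delta> W ` NExt \<C> A W" using exact_contra[OF c, of W] g by (simp add: exact_at_def)
  moreover have "conn_contra \<C> C A \<delta> W 0 = 0" using conn_contra_add[OF d(1) next_zero next_zero, of W] by simp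
  ultimately show ?thesis using N by simp
qed

end

section \<open>Filtrations\<close>

text \<open>Factors come from \<open>\<X>\<close> itself rather than from an additive closure, and
  length 0 means a zero object. The length thereby becomes a measure for induction; for the
  standardizable set the resulting class is later identified with \<open>Filt\<close>.\<close>

primrec filtered_length :: "('o, 'm::ab_group_add, 'k, 'e, 'z) extri_cat_scheme \<Rightarrow> 'o set \<Rightarrow> nat \<Rightarrow> 'o set" where
  "filtered_length \<C> \<X> 0 = {Z. zero_object \<C> Z}"
| "filtered_length \<C> \<X> (Suc n) = star \<C> \<X> (filtered_length \<C> \<X> n)"

definition filtered :: "('o, 'm::ab_group_add, 'k, 'e, 'z) extri_cat_scheme \<Rightarrow> 'o set \<Rightarrow> 'o set" where
  "filtered \<C> \<X> = (\<Union>n. filtered_length \<C> \<X> n)"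

lemma filtered_iff: "X \<in> filtered \<C> \<X> \<longleftrightarrow> (\<exists>n. X \<in> filtered_length \<C> \<X> n)"
  by (simp add: filtered_def)

lemma filtered_zero: "zero_object \<C> Z \<Longrightarrow> Z \<in> filtered \<C> \<X>"
  by (auto simp: filtered_iff intro!: exI[of _ 0])

lemma starI: "X \<in> \<X> \<Longrightarrow> Y \<in> \<Y> \<Longrightarrow> conflation \<C> X f M g Y \<delta> \<Longrightarrow> M \<in> star \<C> \<X> \<Y>"
  unfolding star_def by blast

lemma filtered_step:
  assumes "conflation \<C> T x X y Y \<delta>" "T \<in> \<X>" "Y \<in> filtered \<C> \<X>" shows "X \<in> filtered \<C> \<X>"
proof -
  obtain n where "Y \<in> filtered_length \<C> \<X> n" using assms(3) by (auto simp: filtered_iff)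
  then have "X \<in> filtered_length \<C> \<X> (Suc n)" using starI[OF assms(2) _ assms(1)] by simp
  then show ?thesis unfolding filtered_iff by (rule exI)
qed

lemma filtered_induct [consumes 1, case_names zero step]:
  assumes "X \<in> filtered \<C> \<X>" and zero: "\<And>Z. zero_object \<C> Z \<Longrightarrow> P Z"
    and step: "\<And>T x X y Y \<delta>. conflation \<C> T x X y Y \<delta> \<Longrightarrow> T \<in> \<X> \<Longrightarrow> Y \<in> filtered \<C> \<X> \<Longrightarrow> P Y \<Longrightarrow> P X"
  shows "P X"
proof -
  obtain n where "X \<in> filtered_length \<C> \<X> n" using assms(1) by (auto simp: filtered_iff)
  then show ?thesis
  proof (induction n arbitrary: X)
    case (Suc n)
    then obtain T Y x y \<delta> where Y: "T \<in> \<X>" "Y \<in> filtered_length \<C> \<X> n" "conflation \<C> T x X y Y \<delta>"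
      by (auto simp: star_def)
    moreover have "Y \<in> filtered \<C> \<X>" using Y(2) by (auto simp: filtered_iff)
    ultimately show ?case using step[OF Y(3,1)] Suc.IH[OF Y(2)] by simp
  qed (simp add: zero)
qed

lemma filtered_mono:
  assumes "\<X> \<subseteq> \<Y>" "X \<in> filtered \<C> \<X>" shows "X \<in> filtered \<C> \<Y>"
  using assms(2)
proof (induction rule: filtered_induct)
  case (step T x X y Y \<delta>)
  then show ?case using filtered_step[OF step(1)] assms(1) by auto
qed (rule filtered_zero)

context extriangulated_category
begin

lemma conflation_iso_exists:
  assumes c: "conflation \<C> A x B y C \<delta>" and "is_iso \<C> B B' b"
  shows "\<exists>x' y'. conflation \<C> A x' B' y' C \<delta>"
proof -
  obtain g where g: "b \<in> Hom \<C> B B'" "g \<in> Hom \<C> B' B" "g \<cdot> b = Ident \<C> B" using assms(2) by (rule is_isoE)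
  note d = conflationD[OF c]
  have "y \<cdot> g \<in> Hom \<C> B' C" "(y \<cdot> g) \<cdot> b = y" using g d by (simp_all add: comp_hom comp_assoc id_right)
  then show ?thesis using conflation_iso[OF c assms(2)] by blast
qed

lemma is_iso_sym: "is_iso \<C> A B f \<Longrightarrow> \<exists>g. is_iso \<C> B A g"
  by (auto simp: is_iso_def)

lemma filtered_length_iso:
  assumes "X \<in> filtered_length \<C> \<X> n" "is_iso \<C> X Y f" shows "Y \<in> filtered_length \<C> \<X> n"
proof (cases n)
  case 0
  then show ?thesis using assms zero_object_iso[OF assms(2)] by simp
next
  case (Suc m)
  then obtain T Z x y \<delta> where *: "T \<in> \<X>" "Z \<in> filtered_length \<C> \<X> m" "conflation \<C> T x X y Z \<delta>"
    using assms(1) by (auto simp: star_def)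
  obtain x' y' where "conflation \<C> T x' Y y' Z \<delta>" using conflation_iso_exists[OF *(3) assms(2)] by blast
  then show ?thesis using starI[OF *(1,2)] Suc by simp
qed

lemma filtered_iso:
  assumes "X \<in> filtered \<C> \<X>" "is_iso \<C> X Y f" shows "Y \<in> filtered \<C> \<X>"
  using assms(1) filtered_length_iso[OF _ assms(2)] by (auto simp: filtered_iff)

text \<open>(ET4) detaches the first factor \<open>T\<close> of \<open>X\<close> from
  \<open>M\<close> and leaves an extension of \<open>Y\<close> by the rest of \<open>X\<close>, to
  which induction applies.\<close>

lemma filtered_extension:
  assumes "X \<in> filtered \<C> \<X>" "Y \<in> filtered \<C> \<X>" "conflation \<C> X f M g Y \<delta>"
  shows "M \<in> filtered \<C> \<X>"
  using assms(1,3)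
proof (induction arbitrary: M f g \<delta> rule: filtered_induct)
  case (zero Z)
  obtain h where "is_iso \<C> Y M h" using is_iso_sym[OF conflation_from_zero_iso[OF zero(2,1)]] by blast
  then show ?case by (rule filtered_iso[OF assms(2)])
next
  case (step T x X y X')
  obtain E h' d e \<delta>'' where E: "conflation \<C> T (f \<cdot> x) M h' E \<delta>''" "conflation \<C> X' d E e Y (push \<C> y \<delta>)"
    using ET4[OF step.hyps(1) step.prems] by blast
  show ?case by (rule filtered_step[OF E(1) step.hyps(2) step.IH[OF E(2)]])
qed

lemma filtered_single:
  assumes "T \<in> \<X>" shows "T \<in> filtered \<C> \<X>"
proof -
  obtain Z where "zero_object \<C> Z" "conflation \<C> T (Ident \<C> T) T 0 Z 0" using conflation_id_right[of T] by blast
  then show ?thesis by (intro filtered_step[OF _ assms filtered_zero])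
qed

lemma finite_sums_filtered:
  assumes "S \<in> finite_sums \<C> \<Y>" "\<Y> \<subseteq> filtered \<C> \<X>" shows "S \<in> filtered \<C> \<X>"
  using assms(1)
proof (induction rule: finite_sums.induct)
  case (step X A S i j p q)
  then show ?case using filtered_extension[OF _ step.IH conflation_biproduct[OF step.hyps(3)]] assms(2) by blast
qed (rule filtered_zero)

lemma filtered_ext_vanish_left:
  assumes "X \<in> filtered \<C> \<X>" "\<And>T. T \<in> \<X> \<Longrightarrow> Ext \<C> T W = {0}" shows "Ext \<C> X W = {0}"
  using assms(1)
proof (induction rule: filtered_induct)
  case (step T x X y Y \<delta>)
  then show ?case using ext_vanish_contravariant[OF step(1)] assms(2) by simp
qed (rule ext_zero_object)

lemma filtered_ext_vanish_right:
  assumes "X \<in> filtered \<C> \<X>" "\<And>T. T \<in> \<X> \<Longrightarrow> Ext \<C> W T = {0}" shows "Ext \<C> W X = {0}"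
  using assms(1)
proof (induction rule: filtered_induct)
  case (step T x X y Y \<delta>)
  then show ?case using ext_vanish_covariant[OF step(1)] assms(2) by simp
qed (rule ext_zero_object)

lemma filtered_hom_vanish_left:
  assumes "X \<in> filtered \<C> \<X>" "\<And>T. T \<in> \<X> \<Longrightarrow> Hom \<C> T W = {0}" shows "Hom \<C> X W = {0}"
  using assms(1)
proof (induction rule: filtered_induct)
  case (step T x X y Y \<delta>)
  then show ?case using hom_vanish_contravariant[OF step(1)] assms(2) by simp
qed (simp add: zero_object_def)

lemma filtered_hom_vanish_right:
  assumes "X \<in> filtered \<C> \<X>" "\<And>T. T \<in> \<X> \<Longrightarrow> Hom \<C> W T = {0}" shows "Hom \<C> W X = {0}"
  using assms(1)
proof (induction rule: filtered_induct)
  case (step T x X y Y \<delta>)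
  then show ?case using hom_vanish_covariant[OF step(1)] assms(2) by simp
qed (simp add: zero_object_def)

text \<open>Copies of \<open>B\<close> can be moved past the factors in \<open>\<Y>\<close> to the
  quotient end, because extensions of the latter by \<open>B\<close> split.\<close>

lemma filtered_reorder:
  assumes "M \<in> filtered \<C> (insert B \<Y>)" and ext: "\<And>T. T \<in> \<Y> \<Longrightarrow> Ext \<C> T B = {0}"
  shows "\<exists>U\<in>filtered \<C> \<Y>. \<exists>V\<in>filtered \<C> {B}. \<exists>x y \<delta>. conflation \<C> U x M y V \<delta>"
  using assms(1)
proof (induction rule: filtered_induct)
  case (zero Z)
  then have "conflation \<C> Z (Ident \<C> Z) Z 0 Z 0" using conflation_biproduct[OF biproduct_zero_right] by blast
  then show ?case using filtered_zero[OF zero] by blast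
next
  case (step T x M y M' \<delta>)
  then obtain U V x' y' \<delta>' where U: "U \<in> filtered \<C> \<Y>" "V \<in> filtered \<C> {B}" "conflation \<C> U x' M' y' V \<delta>'" by blast
  obtain E h' d e \<delta>'' where E: "conflation \<C> E h' M (y' \<cdot> y) V \<delta>''" "conflation \<C> T e E d U (pull \<C> x' \<delta>)"
    using ET4_op[OF U(3) step(1)] by blast
  show ?case
  proof (cases "T \<in> \<Y>")
    case True
    then have "E \<in> filtered \<C> \<Y>" using filtered_step[OF E(2)] U(1) by blast
    then show ?thesis using E(1) U(2) by blast
  next
    case False
    then have T: "T = B" using step(2) by simp
    \<comment> \<open>\<open>E\<close> is an extension of \<open>U\<close> by \<open>B\<close>, so
      it splits and \<open>U\<close> can be taken as the subobject instead. (ET4) then leaves as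
      quotient an extension of \<open>V\<close> by \<open>B\<close>.\<close>
    have "pull \<C> x' \<delta> = 0" using filtered_ext_vanish_left[OF U(1) ext] conflationD(1)[OF E(2)] T by blast
    then obtain s r where "biproduct \<C> T U E e s r d" using conflation_zero_biproduct[of T e E d U] E(2) by auto
    then have "conflation \<C> U s E r T 0" by (rule conflation_biproduct[OF biproduct_swap])
    then obtain F h'' d' e' \<delta>3 where F: "conflation \<C> U (h' \<cdot> s) M h'' F \<delta>3" "conflation \<C> T d' F e' V (push \<C> r \<delta>'')"
      using ET4[OF _ E(1)] by blast
    have "F \<in> filtered \<C> {B}" using filtered_step[OF F(2) _ U(2)] T by simp
    then show ?thesis using F(1) U(1) by blast
  qed
qed

end

context linear_category
begin

text \<open>Images of one idempotent are isomorphic: \<open>p \<cdot> i'\<close> is the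
  inverse.\<close>

lemma same_idempotent_iso:
  assumes a: "i \<in> Hom \<C> X M" "p \<in> Hom \<C> M X" "p \<cdot> i = Ident \<C> X"
    and b: "i' \<in> Hom \<C> X' M" "p' \<in> Hom \<C> M X'" "p' \<cdot> i' = Ident \<C> X'" and e: "i \<cdot> p = i' \<cdot> p'"
  shows "is_iso \<C> X X' (p' \<cdot> i)"
proof (rule is_isoI)
  have m: "p' \<cdot> i \<in> Hom \<C> X X'" "p \<cdot> i' \<in> Hom \<C> X' X" using a b by (blast intro: comp_hom)+
  then show "p' \<cdot> i \<in> Hom \<C> X X'" "p \<cdot> i' \<in> Hom \<C> X' X" by auto
  have "(p \<cdot> i') \<cdot> (p' \<cdot> i) = p \<cdot> ((i' \<cdot> p') \<cdot> i)" using a b m by (simp add: comp_assoc)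
  also have "\<dots> = p \<cdot> ((i \<cdot> p) \<cdot> i)" using e by simp
  also have "\<dots> = Ident \<C> X" using a by (simp add: comp_assoc id_right)
  finally show "(p \<cdot> i') \<cdot> (p' \<cdot> i) = Ident \<C> X" .
  have "(p' \<cdot> i) \<cdot> (p \<cdot> i') = p' \<cdot> ((i \<cdot> p) \<cdot> i')" using a b m by (simp add: comp_assoc)
  also have "\<dots> = p' \<cdot> ((i' \<cdot> p') \<cdot> i')" using e by simp
  also have "\<dots> = Ident \<C> X'" using b by (simp add: comp_assoc id_right)
  finally show "(p' \<cdot> i) \<cdot> (p \<cdot> i') = Ident \<C> X'" .
qed

lemma biproduct_zero_summand:
  assumes "biproduct \<C> X Y M i j p q" "zero_object \<C> M" shows "zero_object \<C> X"
proof -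
  note b = biproductD[OF assms(1)]
  have "i = 0" using b(1) assms(2) by (auto simp: zero_object_def)
  then show ?thesis using b(5) comp_zero_right[OF b(3)] by (simp add: zero_object_iff)
qed

end

section \<open>Direct summands of filtered objects\<close>

context krull_schmidt_negative_extriangulated_category
begin

lemma filtered_next_vanish_left:
  assumes "X \<in> filtered \<C> \<X>" "\<And>T. T \<in> \<X> \<Longrightarrow> NExt \<C> T W = {0}" shows "NExt \<C> X W = {0}"
  using assms(1)
proof (induction rule: filtered_induct)
  case (step T x X y Y \<delta>)
  then show ?case using next_vanish_contravariant[OF step(1)] assms(2) by simp
qed (rule next_zero_object)

lemma filtered_next_vanish_right:
  assumes "X \<in> filtered \<C> \<X>" "\<And>T. T \<in> \<X> \<Longrightarrow> NExt \<C> W T = {0}" shows "NExt \<C> W X = {0}"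
  using assms(1)
proof (induction rule: filtered_induct)
  case (step T x X y Y \<delta>)
  then show ?case using next_vanish_covariant[OF step(1)] assms(2) by simp
qed (rule next_zero_object)

text \<open>A form of Schur's lemma, by induction on the length. Either \<open>f\<close> factors
  through the first factor \<open>N\<close> by an invertible map, or its composite to the quotient
  \<open>Z\<close> is nonzero and is an inflation by induction. The cone in the conclusion is
  shorter by one, which drives the next induction.\<close>

lemma brick_inflation:
  assumes N: "brick \<C> N" "NExt \<C> N N = {0}"
    and "X \<in> filtered_length \<C> {N} n" "f \<in> Hom \<C> N X" "f \<noteq> 0"
  shows "\<exists>m g Y \<delta>. n = Suc m \<and> Y \<in> filtered_length \<C> {N} m \<and> conflation \<C> N f X g Y \<delta>"
  using assms(3-5)
proof (induction n arbitrary: X f)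
  case 0
  then show ?case by (simp add: zero_object_def)
next
  case (Suc m)
  then obtain x y Z \<delta> where Z: "conflation \<C> N x X y Z \<delta>" "Z \<in> filtered_length \<C> {N} m" by (auto simp: star_def)
  note f = Suc.prems(2) and z = conflationD[OF Z(1)]
  show ?case
  proof (cases "y \<cdot> f = 0")
    case True
    then obtain u where u: "u \<in> Hom \<C> N N" "f = x \<cdot> u" using hom_factor_inflation[OF Z(1) f] by blast
    then have "u \<noteq> 0" using Suc.prems(3) comp_zero_right[OF z(2)] by auto
    then have "is_iso \<C> N N u" using N(1) u(1) by (simp add: brick_def)
    then obtain v where v: "v \<in> Hom \<C> N N" "v \<cdot> u = Ident \<C> N" "u \<cdot> v = Ident \<C> N" by (rule is_isoE)
    obtain O' where O: "zero_object \<C> O'" using zero_object_exists by blast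
    \<comment> \<open>The isomorphism \<open>u\<close> is an inflation with zero cone, so (ET4)
      gives \<open>x \<cdot> u\<close> a cone isomorphic to that of \<open>x\<close>.\<close>
    have "biproduct \<C> N O' N u 0 v 0"
      using u v O comp_zero_left[OF u(1)] comp_zero_right[OF v(1)] comp_zero_left[OF hom_zero]
      by (intro biproductI) (simp_all add: zero_object_iff)
    then have "conflation \<C> N u N 0 O' 0" by (rule conflation_biproduct)
    then obtain E h d e \<delta>' where E: "conflation \<C> N (x \<cdot> u) X h E \<delta>'" "conflation \<C> O' d E e Z (push \<C> 0 \<delta>)"
      using ET4[OF _ Z(1)] by blast
    obtain g where "is_iso \<C> Z E g" using is_iso_sym[OF conflation_from_zero_iso[OF E(2) O]] by blast
    then have "E \<in> filtered_length \<C> {N} m" by (rule filtered_length_iso[OF Z(2)])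
    then show ?thesis using E(1) u(2) by blast
  next
    case False
    then obtain m' h W \<delta>' where W: "m = Suc m'" "W \<in> filtered_length \<C> {N} m'" "conflation \<C> N (y \<cdot> f) Z h W \<delta>'"
      using Suc.IH[OF Z(2) comp_hom[OF z(3) f]] by blast
    note w = conflationD[OF W(3)]
    \<comment> \<open>\<open>E\<close> is the part of \<open>X\<close> lying over the copy of
      \<open>N\<close> in \<open>Z\<close>: an extension of \<open>N\<close> by \<open>N\<close>,
      through which \<open>f\<close> factors.\<close>
    obtain E h' d e \<delta>'' where E: "conflation \<C> E h' X (h \<cdot> y) W \<delta>''" "conflation \<C> N e E d N (pull \<C> (y \<cdot> f) \<delta>)"
      "y \<cdot> h' = (y \<cdot> f) \<cdot> d" using ET4_op[OF W(3) Z(1)] by blast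
    note c = conflationD[OF E(1)] and c' = conflationD[OF E(2)]
    have "(h \<cdot> y) \<cdot> f = 0" using comp_assoc[OF w(3) z(3) f] w(4) by simp
    then obtain g where g: "g \<in> Hom \<C> N E" "f = h' \<cdot> g" using hom_factor_inflation[OF E(1) f] by blast
    have "y \<cdot> f = y \<cdot> (h' \<cdot> g)" using g(2) by simp
    also have "\<dots> = (y \<cdot> f) \<cdot> (d \<cdot> g)"
      using comp_reduce[OF E(3) z(3) c(2) g(1)] comp_assoc[OF w(2) c'(3) g(1)] by simp
    finally have "d \<cdot> g \<noteq> 0" using False comp_zero_right[OF w(2)] by auto
    then have "is_iso \<C> N N (d \<cdot> g)" using N(1) comp_hom[OF c'(3) g(1)] by (simp add: brick_def)
    then obtain v where v: "v \<in> Hom \<C> N N" "v \<cdot> (d \<cdot> g) = Ident \<C> N" "(d \<cdot> g) \<cdot> v = Ident \<C> N" by (rule is_isoE)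
    \<comment> \<open>\<open>k\<close> is a retraction of \<open>g\<close> that kills
      \<open>e\<close>. The goal is a biproduct of two copies of \<open>N\<close> with inclusions
      \<open>g\<close> and \<open>e\<close>; the other projection \<open>r\<close> comes from
      \<open>1 - g \<cdot> k\<close>. The identities for \<open>r\<close> are tested after composing
      with \<open>e\<close>, which is monic against \<open>N\<close>.\<close>
    define k where "k = v \<cdot> d"
    have m: "k \<in> Hom \<C> E N" "g \<cdot> k \<in> Hom \<C> E E" "Ident \<C> E - g \<cdot> k \<in> Hom \<C> E E" "Ident \<C> E \<in> Hom \<C> E E" "d \<cdot> g \<in> Hom \<C> N N"
      unfolding k_def using g v c' by - (assumption | rule hom_intros)+
    have kg: "k \<cdot> g = Ident \<C> N" and ke: "k \<cdot> e = 0"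
      using v g c' by (simp_all add: k_def comp_assoc comp_zero_right)
    have "d \<cdot> (g \<cdot> k) = d"
      using comp_assoc[OF c'(3) g(1) m(1)] comp_cancel[OF v(3) m(5) v(1) c'(3)] by (simp add: k_def)
    then have "d \<cdot> (Ident \<C> E - g \<cdot> k) = 0" using m c' by (simp add: comp_diff_right id_right)
    then obtain r where r: "r \<in> Hom \<C> E N" "Ident \<C> E - g \<cdot> k = e \<cdot> r" using hom_factor_inflation[OF E(2) m(3)] by blast
    have er: "e \<cdot> r = Ident \<C> E - g \<cdot> k" using r(2) by simp
    have re: "r \<cdot> e = Ident \<C> N"
    proof -
      have "e \<cdot> (r \<cdot> e) = e"
        using comp_reduce[OF er c'(2) r(1) c'(2)] m c' g ke by (simp add: comp_diff_left comp_assoc id_left comp_zero_right)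
      then have "e \<cdot> (r \<cdot> e - Ident \<C> N) = 0"
        using c'(2) comp_hom[OF r(1) c'(2)] id_hom[of N] by (simp add: comp_diff_right id_right)
      then have "r \<cdot> e - Ident \<C> N = 0"
        by (rule inflation_mono[OF E(2) N(2) hom_diff[OF comp_hom[OF r(1) c'(2)] id_hom]])
      then show ?thesis by simp
    qed
    have rg: "r \<cdot> g = 0"
    proof -
      have "e \<cdot> (r \<cdot> g) = 0"
        using comp_reduce[OF er c'(2) r(1) g(1)] m g kg by (simp add: comp_diff_left comp_assoc id_left id_right)
      then show ?thesis by (rule inflation_mono[OF E(2) N(2) comp_hom[OF r(1) g(1)]])
    qed
    have "biproduct \<C> N N E g e k r"
      using g(1) c'(2) m(1) r(1) kg re ke rg er by (intro biproductI) simp_all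
    then have "conflation \<C> N g E r N 0" by (rule conflation_biproduct)
    then obtain F h'' d' e' \<delta>3 where F: "conflation \<C> N (h' \<cdot> g) X h'' F \<delta>3" "conflation \<C> N d' F e' W (push \<C> r \<delta>'')"
      using ET4[OF _ E(1)] by blast
    have "F \<in> filtered_length \<C> {N} m" using starI[OF _ W(2) F(2)] W(1) by simp
    then show ?thesis using F(1) g(2) by blast
  qed
qed

text \<open>If \<open>X\<close> is nonzero, it receives a nonzero map from \<open>N\<close>, and its
  composite into \<open>M\<close> is an inflation with a shorter cone. The projection to
  \<open>Y\<close> kills this copy of \<open>N\<close>, so \<open>Y\<close> is a retract of the cone
  and induction applies. The roles of \<open>X\<close> and \<open>Y\<close> are symmetric.\<close>

lemma brick_filtered_summand_length:
  assumes N: "brick \<C> N" "NExt \<C> N N = {0}"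
    and "M \<in> filtered_length \<C> {N} n" "biproduct \<C> X Y M i j p q"
  shows "X \<in> filtered \<C> {N} \<and> Y \<in> filtered \<C> {N}"
  using assms(3,4)
proof (induction n arbitrary: M X Y i j p q)
  case 0
  then have "zero_object \<C> X" "zero_object \<C> Y"
    using biproduct_zero_summand[OF 0(2)] biproduct_zero_summand[OF biproduct_swap[OF 0(2)]] by simp_all
  then show ?case by (simp add: filtered_zero)
next
  case (Suc n)
  have fM: "M \<in> filtered \<C> {N}" unfolding filtered_iff using Suc.prems(1) by (rule exI)
  have main: "Y \<in> filtered \<C> {N}" if bp: "biproduct \<C> X Y M i j p q" for X Y i j p q
  proof (cases "zero_object \<C> X")
    case True
    show ?thesis by (rule filtered_iso[OF fM biproduct_zero_iso(2)[OF biproduct_swap[OF bp] True]])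
  next
    case False
    note b = biproductD[OF bp]
    have "p \<noteq> 0" using False b(5) comp_zero_left[OF b(1)] by (auto simp: zero_object_iff)
    then have "Hom \<C> M X \<noteq> {0}" using b(3) by auto
    \<comment> \<open>All factors of \<open>M\<close> are copies of \<open>N\<close>; if
      \<open>N\<close> had only zero maps to \<open>X\<close>, so would \<open>M\<close>.\<close>
    then have "Hom \<C> N X \<noteq> {0}" using filtered_hom_vanish_left[OF fM, of X] by auto
    then obtain f where f: "f \<in> Hom \<C> N X" "f \<noteq> 0" using hom_zero by blast
    have "p \<cdot> (i \<cdot> f) = f" using comp_cancel[OF b(5,3,1) f(1)] .
    then have "i \<cdot> f \<noteq> 0" using f(2) comp_zero_right[OF b(3)] by auto
    then obtain g C \<delta> where C: "C \<in> filtered_length \<C> {N} n" "conflation \<C> N (i \<cdot> f) M g C \<delta>"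
      using brick_inflation[OF N Suc.prems(1) comp_hom[OF b(1) f(1)]] by blast
    have g: "g \<in> Hom \<C> M C" using conflationD[OF C(2)] by simp
    have "q \<cdot> (i \<cdot> f) = 0" using comp_reduce_zero[OF b(8,4,1) f(1)] .
    then obtain r where r: "r \<in> Hom \<C> C Y" "q = r \<cdot> g" using hom_factor_deflation[OF C(2) b(4)] by blast
    have "r \<cdot> (g \<cdot> j) = Ident \<C> Y" using b(6) r comp_assoc[OF r(1) g b(2)] by simp
    then obtain R j' q' where "biproduct \<C> Y R C (g \<cdot> j) j' r q'"
      using retract_complement[OF comp_hom[OF g b(2)] r(1)] by blast
    then show ?thesis using Suc.IH[OF C(1)] by simp
  qed
  show ?case using main[OF Suc.prems(2)] main[OF biproduct_swap[OF Suc.prems(2)]] by simp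
qed

lemma brick_filtered_summand:
  assumes "brick \<C> N" "NExt \<C> N N = {0}" "M \<in> filtered \<C> {N}" "biproduct \<C> X Y M i j p q"
  shows "X \<in> filtered \<C> {N}"
proof -
  obtain n where "M \<in> filtered_length \<C> {N} n" using assms(3) by (auto simp: filtered_iff)
  then show ?thesis using brick_filtered_summand_length[OF assms(1,2) _ assms(4)] by simp
qed

text \<open>Without self-extensions of \<open>N\<close> every filtration splits, so \<open>M\<close>
  is a finite direct sum of copies of \<open>N\<close>. As \<open>N\<close> has a local endomorphism
  ring, images of idempotents are such sums again.\<close>

lemma stone_filtered_summand:
  assumes N: "stone \<C> N" and "M \<in> filtered \<C> {N}" and bp: "biproduct \<C> X Y M i j p q"
  shows "X \<in> filtered \<C> {N}"
proof -
  have loc: "local_endomorphism_ring \<C> N" using N indecomposable_local by (simp add: stone_def)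
  note b = biproductD[OF bp]
  have "M \<in> finite_sums \<C> {N}"
    using assms(2)
  proof (induction rule: filtered_induct)
    case (step T x M y Y \<delta>)
    have "Ext \<C> Y N = {0}" using filtered_ext_vanish_left[OF step(3)] N by (simp add: stone_def)
    then have "\<delta> = 0" using conflationD(1)[OF step(1)] step(2) by auto
    then obtain s r where "biproduct \<C> T Y M x s r y" using conflation_zero_biproduct[of T x M y Y] step(1) by blast
    then show ?case by (rule finite_sums.step[OF step(2) step(4)])
  qed (rule finite_sums.zero)
  moreover have "(i \<cdot> p) \<cdot> (i \<cdot> p) = i \<cdot> p"
    using comp_assoc[OF b(1,3) comp_hom[OF b(1,3)]] comp_cancel[OF b(5,3,1,3)] by simp
  ultimately obtain X' Y' i' j' p' q' where X': "biproduct \<C> X' Y' M i' j' p' q'" "i' \<cdot> p' = i \<cdot> p" "X' \<in> finite_sums \<C> {N}"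
    using split_idempotent[of M "{N}" "i \<cdot> p"] loc comp_hom[OF b(1,3)] by auto
  note b' = biproductD[OF X'(1)]
  have "is_iso \<C> X' X (p \<cdot> i')" by (rule same_idempotent_iso[OF b'(1,3,5) b(1,3,5) X'(2)])
  then have "X \<in> finite_sums \<C> {N}" by (rule finite_sums_iso[OF X'(3)])
  then show ?thesis using finite_sums_filtered filtered_single by blast
qed

text \<open>
  Because of \<open>Hom U V = 0\<close> and \<open>\<bbbE>\<^sup>-\<^sup>1(U,V) = 0\<close>, the idempotent of \<open>M\<close> belonging to the summand \<open>X\<close> induces
  idempotents on \<open>U\<close> and \<open>V\<close>; their images are the ends of the conflation found for \<open>X\<close>.
\<close>

lemma conflation_summand:
  assumes c: "conflation \<C> U x M y V \<delta>" and hom: "Hom \<C> U V = {0}" and neg: "NExt \<C> U V = {0}"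
    and bp: "biproduct \<C> X Y M i j p q"
  shows "\<exists>U' U2 iU jU pU qU V' V2 iV jV pV qV x' y' \<delta>'. biproduct \<C> U' U2 U iU jU pU qU \<and>
    biproduct \<C> V' V2 V iV jV pV qV \<and> conflation \<C> U' x' X y' V' \<delta>'"
proof -
  note b = biproductD[OF bp] and d = conflationD[OF c]
  define e where "e = i \<cdot> p"
  have e: "e \<in> Hom \<C> M M" "e \<cdot> e = e"
    using comp_assoc[OF b(1,3) comp_hom[OF b(1,3)]] comp_cancel[OF b(5,3,1,3)] comp_hom[OF b(1,3)] by (simp_all add: e_def)
  have m: "e \<cdot> x \<in> Hom \<C> U M" "y \<cdot> e \<in> Hom \<C> M V" using e d by (simp_all add: comp_hom)
  \<comment> \<open>\<open>Hom U V = 0\<close> lets \<open>e\<close> restrict to \<open>a\<close> on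
    \<open>U\<close>, and (ET3) yields \<open>h\<close> on \<open>V\<close>. Idempotency of
    \<open>a\<close> and \<open>h\<close> is checked after composing with \<open>x\<close> and
    \<open>y\<close>, which may be cancelled because \<open>NExt \<C> U V\<close> vanishes.\<close>
  have "y \<cdot> (e \<cdot> x) = 0" using hom comp_hom[OF d(3) m(1)] by simp
  then obtain a where a: "a \<in> Hom \<C> U U" "e \<cdot> x = x \<cdot> a" using hom_factor_inflation[OF c m(1)] by blast
  obtain h where h: "h \<in> Hom \<C> V V" "h \<cdot> y = y \<cdot> e" "push \<C> a \<delta> = pull \<C> h \<delta>" using ET3[OF c c a(1) e(1) a(2)] by blast
  have m2: "a \<cdot> a \<in> Hom \<C> U U" "h \<cdot> h \<in> Hom \<C> V V" using a h by (simp_all add: comp_hom)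
  have aa: "a \<cdot> a = a"
  proof -
    have "x \<cdot> (a \<cdot> a) = e \<cdot> (e \<cdot> x)" using comp_reduce[OF a(2)[symmetric] d(2) a(1) a(1)] comp_assoc[OF e(1) d(2) a(1)] a(2) by simp
    also have "\<dots> = x \<cdot> a" using comp_reduce[OF e(2,1,1) d(2)] a(2) by simp
    finally have "x \<cdot> (a \<cdot> a - a) = 0" using comp_diff_right[OF d(2) m2(1) a(1)] by simp
    then have "a \<cdot> a - a = 0" by (rule inflation_mono[OF c neg hom_diff[OF m2(1) a(1)]])
    then show ?thesis by simp
  qed
  have hh: "h \<cdot> h = h"
  proof -
    have "(h \<cdot> h) \<cdot> y = (y \<cdot> e) \<cdot> e" using comp_assoc[OF h(1,1) d(3)] comp_assoc[OF h(1) d(3) e(1)] h(2) by simp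
    also have "\<dots> = h \<cdot> y" using comp_assoc[OF d(3) e(1,1)] e(2) h(2) by simp
    finally have "(h \<cdot> h - h) \<cdot> y = 0" using comp_diff_left[OF m2(2) h(1) d(3)] by simp
    then have "h \<cdot> h - h = 0" by (rule deflation_epi[OF c neg hom_diff[OF m2(2) h(1)]])
    then show ?thesis by simp
  qed
  obtain U' U2 iU jU pU qU where U: "biproduct \<C> U' U2 U iU jU pU qU" "iU \<cdot> pU = a"
    using split_idempotent[OF in_finite_sums_local[of U] _ a(1) aa] by auto
  obtain V' V2 iV jV pV qV where V: "biproduct \<C> V' V2 V iV jV pV qV" "iV \<cdot> pV = h"
    using split_idempotent[OF in_finite_sums_local[of V] _ h(1) hh] by auto
  note bU = biproductD[OF U(1)] and bV = biproductD[OF V(1)]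
  have pUa: "pU \<cdot> a = pU" and aiU: "a \<cdot> iU = iU" and pVh: "pV \<cdot> h = pV" and hiV: "h \<cdot> iV = iV"
    using U(2) V(2) comp_cancel[OF bU(5,3,1,3)] comp_cancel[OF bV(5,3,1,3)] comp_assoc[OF bU(1,3,1)] comp_assoc[OF bV(1,3,1)]
      bU(5) bV(5) id_right[OF bU(1)] id_right[OF bV(1)] by auto
  \<comment> \<open>The class \<open>\<delta>\<close> is compressed to the images of
    \<open>a\<close> and \<open>h\<close>. Its realization \<open>X'\<close> is compared with
    \<open>X\<close> through \<open>f\<close> and \<open>g\<close>, which realize the projections
    and the inclusions of these images.\<close>
  define \<epsilon> where "\<epsilon> = push \<C> pU (pull \<C> iV \<delta>)"
  have p\<delta>: "pull \<C> iV \<delta> \<in> Ext \<C> V' U" using pull_ext[OF bV(1) d(1)] .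
  have \<epsilon>: "\<epsilon> \<in> Ext \<C> V' U'" unfolding \<epsilon>_def using push_ext[OF bU(3) p\<delta>] .
  obtain X' x1 y1 where c1: "conflation \<C> U' x1 X' y1 V' \<epsilon>" using conflation_exists[OF \<epsilon>] by blast
  note d1 = conflationD[OF c1]
  have "pull \<C> pV \<epsilon> = push \<C> pU (pull \<C> h \<delta>)"
    using push_pull[OF bU(3) bV(3) p\<delta>] pull_comp[OF bV(1,3) d(1)] V(2) by (simp add: \<epsilon>_def)
  also have "\<dots> = push \<C> pU \<delta>" using push_comp[OF bU(3) a(1) d(1)] pUa h(3) by simp
  finally obtain f where f: "f \<in> Hom \<C> M X'" "f \<cdot> x = x1 \<cdot> pU" "y1 \<cdot> f = pV \<cdot> y"
    using real_morphism[OF c c1 bU(3) bV(3)] by auto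
  have "push \<C> iU \<epsilon> = push \<C> a (pull \<C> iV \<delta>)" using push_comp[OF bU(1,3) p\<delta>] U(2) by (simp add: \<epsilon>_def)
  also have "\<dots> = pull \<C> (h \<cdot> iV) \<delta>" using push_pull[OF a(1) bV(1) d(1)] h(3) pull_comp[OF h(1) bV(1) d(1)] by simp
  also have "\<dots> = pull \<C> iV \<delta>" using hiV by simp
  finally obtain g where g: "g \<in> Hom \<C> X' M" "g \<cdot> x1 = x \<cdot> iU" "y \<cdot> g = iV \<cdot> y1"
    using real_morphism[OF c1 c bU(1) bV(1)] by auto
  have fi: "f \<cdot> i \<in> Hom \<C> X X'" and pg: "p \<cdot> g \<in> Hom \<C> X' X" using f g b by (simp_all add: comp_hom)
  have eg: "e \<cdot> g \<in> Hom \<C> X' M" using comp_hom[OF e(1) g(1)] .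
  have fg: "(f \<cdot> i) \<cdot> (p \<cdot> g) = f \<cdot> (e \<cdot> g)"
    using comp_assoc[OF f(1) b(1) pg] comp_assoc[OF b(1,3) g(1)] by (simp add: e_def)
  have iso1: "is_iso \<C> X' X' ((f \<cdot> i) \<cdot> (p \<cdot> g))"
  proof (rule conflation_endo_iso[OF c1 comp_hom[OF fi pg]])
    have "(f \<cdot> (e \<cdot> g)) \<cdot> x1 = f \<cdot> (e \<cdot> (x \<cdot> iU))" using comp_assoc[OF f(1) eg d1(2)] comp_assoc[OF e(1) g(1) d1(2)] g(2) by simp
    also have "\<dots> = f \<cdot> (x \<cdot> iU)" using comp_reduce[OF a(2) e(1) d(2) bU(1)] comp_assoc[OF d(2) a(1) bU(1)] aiU by simp
    also have "\<dots> = x1" using comp_reduce[OF f(2,1) d(2) bU(1)] comp_assoc[OF d1(2) bU(3,1)] bU(5) id_right[OF d1(2)] by simp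
    finally show "(f \<cdot> i) \<cdot> (p \<cdot> g) \<cdot> x1 = x1" using fg by simp
    have "y1 \<cdot> (f \<cdot> (e \<cdot> g)) = pV \<cdot> (y \<cdot> (e \<cdot> g))" using comp_reduce[OF f(3) d1(3) f(1) eg] comp_assoc[OF bV(3) d(3) eg] by simp
    also have "\<dots> = pV \<cdot> (h \<cdot> (iV \<cdot> y1))" using comp_reduce[OF h(2)[symmetric] d(3) e(1) g(1)] comp_assoc[OF h(1) d(3) g(1)] g(3) by simp
    also have "\<dots> = y1" using comp_reduce[OF hiV h(1) bV(1) d1(3)] comp_cancel[OF bV(5,3,1) d1(3)] by simp
    finally show "y1 \<cdot> ((f \<cdot> i) \<cdot> (p \<cdot> g)) = y1" using fg by simp
  qed
  have iso2: "is_iso \<C> X X ((p \<cdot> g) \<cdot> (f \<cdot> i))"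
  proof (rule is_iso_unipotent[OF comp_hom[OF pg fi]])
    \<comment> \<open>\<open>g \<cdot> f\<close> and \<open>e\<close> induce the same maps
      \<open>a\<close> and \<open>h\<close> on the ends, so \<open>n\<close> kills \<open>x\<close>
      and is killed by \<open>y\<close>. Hence \<open>n \<cdot> (e \<cdot> n) = 0\<close>, and the
      endomorphism of \<open>X\<close> differs from 1 by a map of square zero.\<close>
    define n where "n = g \<cdot> f - e"
    have gf: "g \<cdot> f \<in> Hom \<C> M M" using comp_hom[OF g(1) f(1)] .
    have n: "n \<in> Hom \<C> M M" unfolding n_def using hom_diff[OF gf e(1)] .
    have "(g \<cdot> f) \<cdot> x = x \<cdot> a" using comp_assoc[OF g(1) f(1) d(2)] f(2) comp_reduce[OF g(2,1) d1(2) bU(3)] comp_assoc[OF d(2) bU(1,3)] U(2) by simp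
    then have "n \<cdot> x = 0" unfolding n_def using comp_diff_left[OF gf e(1) d(2)] a(2) by simp
    then obtain k where k: "k \<in> Hom \<C> V M" "n = k \<cdot> y" using hom_factor_deflation[OF c n] by blast
    have "y \<cdot> (g \<cdot> f) = h \<cdot> y" using comp_reduce[OF g(3) d(3) g(1) f(1)] comp_assoc[OF bV(1) d1(3) f(1)] f(3) comp_assoc[OF bV(1,3) d(3)] V(2) by simp
    then have yn: "y \<cdot> n = 0" unfolding n_def using comp_diff_right[OF d(3) gf e(1)] h(2) by simp
    have "n \<cdot> (e \<cdot> n) = k \<cdot> (y \<cdot> (e \<cdot> n))" using k comp_assoc[OF k(1) d(3) comp_hom[OF e(1) n]] by simp
    also have "y \<cdot> (e \<cdot> n) = h \<cdot> (y \<cdot> n)" using comp_reduce[OF h(2)[symmetric] d(3) e(1) n] comp_assoc[OF h(1) d(3) n] by simp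
    finally have nen: "n \<cdot> (e \<cdot> n) = 0" using yn comp_zero_right[OF h(1)] comp_zero_right[OF k(1)] by simp
    have ni: "n \<cdot> i \<in> Hom \<C> X M" "e \<cdot> i \<in> Hom \<C> X M" "(g \<cdot> f) \<cdot> i \<in> Hom \<C> X M" using n b e gf by (simp_all add: comp_hom)
    have "p \<cdot> (e \<cdot> i) = Ident \<C> X" using comp_assoc[OF b(1,3,1)] comp_cancel[OF b(5,3,1) id_hom] b(5) id_right[OF b(1)] by (simp add: e_def)
    moreover have "(p \<cdot> g) \<cdot> (f \<cdot> i) = p \<cdot> ((g \<cdot> f) \<cdot> i)" using comp_assoc[OF b(3) g(1) fi] comp_assoc[OF g(1) f(1) b(1)] by simp
    moreover have "p \<cdot> (n \<cdot> i) = p \<cdot> ((g \<cdot> f) \<cdot> i) - p \<cdot> (e \<cdot> i)"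
      unfolding n_def using comp_diff_left[OF gf e(1) b(1)] comp_diff_right[OF b(3) ni(3,2)] by simp
    ultimately have eq: "(p \<cdot> g) \<cdot> (f \<cdot> i) - Ident \<C> X = p \<cdot> (n \<cdot> i)" by simp
    have pni: "p \<cdot> (n \<cdot> i) \<in> Hom \<C> X X" using comp_hom[OF b(3) ni(1)] .
    have "(p \<cdot> (n \<cdot> i)) \<cdot> (p \<cdot> (n \<cdot> i)) = p \<cdot> ((n \<cdot> (e \<cdot> n)) \<cdot> i)"
      using comp_assoc[OF b(3) ni(1) pni] comp_assoc[OF n b(1) pni] comp_reduce[OF refl b(1,3) ni(1)] comp_assoc[OF e(1) n b(1)] comp_assoc[OF n comp_hom[OF e(1) n] b(1)]
      by (simp add: e_def)
    then show "((p \<cdot> g) \<cdot> (f \<cdot> i) - Ident \<C> X) \<cdot> ((p \<cdot> g) \<cdot> (f \<cdot> i) - Ident \<C> X) = 0"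
      using eq nen comp_zero_left[OF b(1)] comp_zero_right[OF b(3)] by simp
  qed
  obtain k where "is_iso \<C> X' X k" using is_iso_sym[OF is_iso_two_sided[OF fi pg iso2 iso1]] by blast
  then obtain x' y' where "conflation \<C> U' x' X y' V' \<epsilon>" using conflation_iso_exists[OF c1] by blast
  then show ?thesis using U(1) V(1) by blast
qed

end

section \<open>Mixed standardizable sets\<close>

context extriangulated_category
begin

text \<open>Independence is uniqueness of the coefficients of the element 0, compared with the zero
  family. Both families are restricted to \<open>{..<d}\<close>, since uniqueness is stated among
  extensional functions.\<close>

lemma D_basis_brick_independent:
  assumes "D_basis \<C> M N d \<delta>" "brick \<C> N" and u: "\<And>k. k < d \<Longrightarrow> u k \<in> Hom \<C> N N"
    and "(\<Sum>k<d. push \<C> (u k) (\<delta> k)) = 0" and k: "k < d"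
  shows "u k = 0"
proof -
  have \<delta>: "\<delta> k \<in> Ext \<C> M N" if "k < d" for k using assms(1) that by (simp add: D_basis_def)
  let ?u = "\<lambda>k\<in>{..<d}. u k" and ?v = "\<lambda>k\<in>{..<d}. 0"
  have "\<forall>\<epsilon>\<in>Ext \<C> M N. \<exists>!f. f \<in> {..<d} \<rightarrow>\<^sub>E Hom \<C> N N \<and> \<epsilon> = (\<Sum>k<d. push \<C> (f k) (\<delta> k))"
    using assms(1,2) by (simp add: D_basis_def)
  then have "\<exists>!f. f \<in> {..<d} \<rightarrow>\<^sub>E Hom \<C> N N \<and> 0 = (\<Sum>k<d. push \<C> (f k) (\<delta> k))"
    using ext_zero by (rule bspec)
  moreover have "?u \<in> {..<d} \<rightarrow>\<^sub>E Hom \<C> N N \<and> 0 = (\<Sum>k<d. push \<C> (?u k) (\<delta> k))" using u assms(4) by simp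
  moreover have "?v \<in> {..<d} \<rightarrow>\<^sub>E Hom \<C> N N \<and> 0 = (\<Sum>k<d. push \<C> (?v k) (\<delta> k))"
    using push_zero_hom[OF \<delta>] by simp
  ultimately have "?u = ?v" by blast
  then have "?u k = ?v k" by (rule fun_cong)
  then show ?thesis using k by simp
qed

lemma D_basis_scalar_independent:
  assumes "D_basis \<C> M N d \<delta>" "\<not> brick \<C> N" and "(\<Sum>k<d. escale \<C> (u k) (\<delta> k)) = 0" and k: "k < d"
  shows "u k = 0"
proof -
  interpret vector_space "escale \<C>" by (rule ext_ambient)
  let ?u = "\<lambda>k\<in>{..<d}. u k" and ?v = "\<lambda>k\<in>{..<d}. 0"
  have "\<forall>\<epsilon>\<in>Ext \<C> M N. \<exists>!r. r \<in> {..<d} \<rightarrow>\<^sub>E UNIV \<and> \<epsilon> = (\<Sum>k<d. escale \<C> (r k) (\<delta> k))"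
    using assms(1,2) by (simp add: D_basis_def)
  then have "\<exists>!r. r \<in> {..<d} \<rightarrow>\<^sub>E UNIV \<and> 0 = (\<Sum>k<d. escale \<C> (r k) (\<delta> k))"
    using ext_zero by (rule bspec)
  moreover have "?u \<in> {..<d} \<rightarrow>\<^sub>E UNIV \<and> 0 = (\<Sum>k<d. escale \<C> (?u k) (\<delta> k))" using assms(3) by simp
  moreover have "?v \<in> {..<d} \<rightarrow>\<^sub>E UNIV \<and> 0 = (\<Sum>k<d. escale \<C> (?v k) (\<delta> k))" by simp
  ultimately have "?u = ?v" by blast
  then have "?u k = ?v k" by (rule fun_cong)
  then show ?thesis using k by simp
qed

end

locale mixed_standardizable_set = krull_schmidt_negative_extriangulated_category \<C>
  for \<C> :: "('o, 'm::ab_group_add, 'k::field, 'e::ab_group_add, 'n::ab_group_add, 'z) neg_extri_cat_scheme" (structure) +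
  fixes t :: nat and \<Theta> :: "nat \<Rightarrow> 'o"
  assumes standardizable: "mixed_standardizable \<C> t \<Theta>"
begin

lemma brick_or_stone: "i \<in> {1..t} \<Longrightarrow> brick \<C> (\<Theta> i) \<or> stone \<C> (\<Theta> i)"
  using standardizable unfolding mixed_standardizable_def MS1_def by blast

lemma hom_zero_downwards: "i \<in> {1..t} \<Longrightarrow> j \<in> {1..t} \<Longrightarrow> j < i \<Longrightarrow> Hom \<C> (\<Theta> i) (\<Theta> j) = {0}"
  using standardizable unfolding mixed_standardizable_def MS2_def by simp

lemma ext_zero_downwards: "i \<in> {1..t} \<Longrightarrow> j \<in> {1..t} \<Longrightarrow> j < i \<Longrightarrow> Ext \<C> (\<Theta> i) (\<Theta> j) = {0}"
  using standardizable unfolding mixed_standardizable_def MS3_def by simp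

lemma theta_local: "i \<in> {1..t} \<Longrightarrow> local_endomorphism_ring \<C> (\<Theta> i)"
  using brick_or_stone[of i] brick_local[of "\<Theta> i"] indecomposable_local[of "\<Theta> i"] by (auto simp: stone_def)

text \<open>(MS4) concerns the direct sum; inclusion and projection of the two members make this
  group a retract of the vanishing one.\<close>

lemma next_theta:
  assumes "i \<in> {1..t}" "j \<in> {1..t}" shows "NExt \<C> (\<Theta> i) (\<Theta> j) = {0}"
proof -
  define D where "D = dsum \<C> {1..t} \<Theta>"
  obtain \<iota> \<pi> where ds: "direct_sum \<C> {1..t} \<Theta> D \<iota> \<pi>"
    using dsum_direct_sum[of "{1..t}" \<Theta>] by (auto simp: D_def)
  note d = direct_sumD[OF ds]
  have D: "NExt \<C> D D = {0}" using standardizable by (simp add: mixed_standardizable_def MS4_def D_def)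
  have "\<eta> = 0" if h: "\<eta> \<in> NExt \<C> (\<Theta> i) (\<Theta> j)" for \<eta>
  proof -
    have h1: "npull \<C> (\<pi> i) \<eta> \<in> NExt \<C> D (\<Theta> j)" using npull_next[OF d(3)[OF assms(1)] h] .
    then have "npush \<C> (\<iota> j) (npull \<C> (\<pi> i) \<eta>) = 0" using npush_next[OF d(2)[OF assms(2)] h1] D by simp
    then have "npull \<C> (\<pi> i) \<eta> = 0"
      using npush_comp[OF d(3)[OF assms(2)] d(2)[OF assms(2)] h1] npush_id[OF h1] d(4)[OF assms(2,2)]
        npush_zero[OF d(3)[OF assms(2)]] by simp
    then show ?thesis
      using npull_comp[OF d(3)[OF assms(1)] d(2)[OF assms(1)] h] npull_id[OF h] d(4)[OF assms(1,1)]
        npull_zero[OF d(2)[OF assms(1)]] by simp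
  qed
  then show ?thesis using next_zero by auto
qed

text \<open>Induction downwards from the empty range at \<open>Suc t\<close>. Reordering by (MS3)
  puts the copies of \<open>\<Theta> n\<close> at the quotient end; (MS2) and (MS4) then allow a
  summand to be cut out of both ends, where the induction hypothesis and the case of one brick or
  stone apply.\<close>

lemma filtered_summand:
  assumes "i \<le> Suc t" "1 \<le> i" "M \<in> filtered \<C> (\<Theta> ` {i..t})" "biproduct \<C> X Y M \<iota> \<kappa> \<pi> \<rho>"
  shows "X \<in> filtered \<C> (\<Theta> ` {i..t})"
  using assms(1,3,4)
proof (induction i arbitrary: M X Y \<iota> \<kappa> \<pi> \<rho> rule: inc_induct)
  case base
  have "zero_object \<C> M" using base(1) by (induction rule: filtered_induct) simp_all
  then show ?case by (intro filtered_zero biproduct_zero_summand[OF base(2)])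
next
  case (step n)
  have n: "n \<in> {1..t}" "{n..t} = insert n {Suc n..t}" using step.hyps assms(2) by auto
  have m: "j \<in> {1..t}" "n < j" if "j \<in> {Suc n..t}" for j using that by auto
  have ins: "\<Theta> ` {n..t} = insert (\<Theta> n) (\<Theta> ` {Suc n..t})" using n(2) by simp
  have "Ext \<C> T (\<Theta> n) = {0}" if "T \<in> \<Theta> ` {Suc n..t}" for T
    using that ext_zero_downwards[OF m(1) n(1) m(2)] by auto
  then obtain U V x y \<delta> where U: "U \<in> filtered \<C> (\<Theta> ` {Suc n..t})" "V \<in> filtered \<C> {\<Theta> n}" "conflation \<C> U x M y V \<delta>"
    using filtered_reorder[of M "\<Theta> n" "\<Theta> ` {Suc n..t}"] step.prems(1) ins by auto
  have "Hom \<C> U (\<Theta> n) = {0}" using filtered_hom_vanish_left[OF U(1)] hom_zero_downwards[OF m(1) n(1) m(2)] by blast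
  then have hom: "Hom \<C> U V = {0}" using filtered_hom_vanish_right[OF U(2)] by blast
  have "NExt \<C> U (\<Theta> n) = {0}" using filtered_next_vanish_left[OF U(1)] next_theta[OF m(1) n(1)] by blast
  then have neg: "NExt \<C> U V = {0}" using filtered_next_vanish_right[OF U(2)] by blast
  obtain U' U2 iU jU pU qU V' V2 iV jV pV qV x' y' \<delta>' where *: "biproduct \<C> U' U2 U iU jU pU qU"
    "biproduct \<C> V' V2 V iV jV pV qV" "conflation \<C> U' x' X y' V' \<delta>'"
    using conflation_summand[OF U(3) hom neg step.prems(2)] by blast
  have U': "U' \<in> filtered \<C> (\<Theta> ` {n..t})" using filtered_mono[OF _ step.IH[OF U(1) *(1)]] ins by blast
  have "V' \<in> filtered \<C> {\<Theta> n}"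
    using brick_or_stone[OF n(1)] brick_filtered_summand[OF _ next_theta[OF n(1,1)] U(2) *(2)] stone_filtered_summand[OF _ U(2) *(2)]
    by blast
  then have V': "V' \<in> filtered \<C> (\<Theta> ` {n..t})" using filtered_mono[of "{\<Theta> n}" "\<Theta> ` {n..t}"] ins by blast
  show ?case by (rule filtered_extension[OF U' V' *(3)])
qed

text \<open>\<open>Filt\<close> allows factors from the additive closure of the direct sum. These
  are themselves filtered, since filtered objects are closed under summands; conversely each
  \<open>\<Theta> j\<close> is a summand of the sum.\<close>

lemma Filt_filtered:
  assumes "i \<in> {1..t}" shows "Filt \<C> (dsum \<C> {i..t} \<Theta>) = filtered \<C> (\<Theta> ` {i..t})"
proof
  define D where "D = dsum \<C> {i..t} \<Theta>"
  define F where "F = filtered \<C> (\<Theta> ` {i..t})"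
  obtain \<iota> \<pi> where ds: "direct_sum \<C> {i..t} \<Theta> D \<iota> \<pi>"
    using dsum_direct_sum[of "{i..t}" \<Theta>] by (auto simp: D_def)
  note d = direct_sumD[OF ds]
  have D: "D \<in> F" unfolding F_def
    by (rule finite_sums_filtered[OF direct_sum_in_finite_sums[OF ds]]) (use filtered_single in blast)
  have add: "X \<in> F" if X: "X \<in> add_closure \<C> D" for X
  proof -
    obtain n S \<iota> \<pi> Y k j p q where S: "direct_sum \<C> {..<n} (\<lambda>_. D) S \<iota> \<pi>" "biproduct \<C> X Y S k j p q"
      using X by (auto simp: add_closure_def)
    have "S \<in> F" unfolding F_def
      by (rule finite_sums_filtered[OF direct_sum_in_finite_sums[OF S(1)]]) (use D in \<open>auto simp: F_def\<close>)
    then show ?thesis using filtered_summand[OF _ _ _ S(2), of i] assms by (simp add: F_def)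
  qed
  have "star_power \<C> (add_closure \<C> D) n \<subseteq> F" for n
  proof (induction n)
    case (Suc n)
    show ?case
    proof
      fix M assume "M \<in> star_power \<C> (add_closure \<C> D) (Suc n)"
      then obtain X Y f g \<delta> where M: "X \<in> add_closure \<C> D" "Y \<in> star_power \<C> (add_closure \<C> D) n" "conflation \<C> X f M g Y \<delta>"
        by (auto simp: star_def)
      have "X \<in> F" "Y \<in> F" using add[OF M(1)] Suc M(2) by auto
      then show "M \<in> F" unfolding F_def using filtered_extension[OF _ _ M(3)] by simp
    qed
  qed (use add in auto)
  then show "Filt \<C> (dsum \<C> {i..t} \<Theta>) \<subseteq> filtered \<C> (\<Theta> ` {i..t})" unfolding Filt_def F_def D_def by blast
  have T: "\<Theta> j \<in> add_closure \<C> D" if j: "j \<in> {i..t}" for j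
  proof -
    obtain R k q where "biproduct \<C> (\<Theta> j) R D (\<iota> j) k (\<pi> j) q"
      using retract_complement[OF d(2)[OF j] d(3)[OF j]] d(4)[OF j j] by auto
    moreover have "direct_sum \<C> {..<1::nat} (\<lambda>_. D) D (\<lambda>_. Ident \<C> D) (\<lambda>_. Ident \<C> D)"
      by (simp add: direct_sum_def id_hom id_left[OF id_hom])
    ultimately show ?thesis unfolding add_closure_def by blast
  qed
  have Z: "Z \<in> add_closure \<C> D" if z: "zero_object \<C> Z" for Z
  proof -
    have "direct_sum \<C> {..<0::nat} (\<lambda>_. D) Z (\<lambda>_. 0) (\<lambda>_. 0)" using z by (simp add: direct_sum_def zero_object_iff)
    then show ?thesis unfolding add_closure_def using biproduct_zero_left[OF z, of Z] by blast
  qed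
  \<comment> \<open>\<open>star_power\<close> at \<open>n\<close> has \<open>n + 1\<close> factors;
    the zero object ending a filtration of length \<open>n\<close> serves as the last one.\<close>
  have "filtered_length \<C> (\<Theta> ` {i..t}) n \<subseteq> star_power \<C> (add_closure \<C> D) n" for n
  proof (induction n)
    case (Suc n)
    show ?case
    proof
      fix M assume "M \<in> filtered_length \<C> (\<Theta> ` {i..t}) (Suc n)"
      then obtain j Y f g \<delta> where M: "j \<in> {i..t}" "Y \<in> filtered_length \<C> (\<Theta> ` {i..t}) n" "conflation \<C> (\<Theta> j) f M g Y \<delta>"
        by (auto simp: star_def)
      show "M \<in> star_power \<C> (add_closure \<C> D) (Suc n)"
        using starI[OF T[OF M(1)] _ M(3)] Suc M(2) by auto
    qed
  qed (use Z in auto)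
  then show "filtered \<C> (\<Theta> ` {i..t}) \<subseteq> Filt \<C> (dsum \<C> {i..t} \<Theta>)" unfolding Filt_def filtered_def D_def by blast
qed

section \<open>Iterated universal extensions\<close>

text \<open>The index \<open>j\<close> marks the stage: extensions by all members before
  \<open>\<Theta> j\<close> have been killed. The factorization clause is carried along because it
  later lets endomorphisms of \<open>P\<close> induce endomorphisms of
  \<open>\<Theta> i\<close>.\<close>

definition partial_cover :: "nat \<Rightarrow> nat \<Rightarrow> 'o \<Rightarrow> bool" where
  "partial_cover i j P \<longleftrightarrow> (\<exists>K f \<alpha> \<delta>. conflation \<C> K f P \<alpha> (\<Theta> i) \<delta> \<and> K \<in> filtered \<C> (\<Theta> ` {i..t}) \<and>
     (\<forall>l\<in>{1..<j}. Ext \<C> P (\<Theta> l) = {0}) \<and> (\<forall>g\<in>Hom \<C> P (\<Theta> i). \<exists>h\<in>Hom \<C> (\<Theta> i) (\<Theta> i). g = h \<cdot> \<alpha>))"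

text \<open>
  A map from \<open>E\<close> to \<open>\<Theta>(i)\<close> vanishes on the kernel of the universal extension: for \<open>i < j\<close> by (MS2), and for \<open>i = j\<close>
  because its components there are the coefficients of a relation in a basis.
\<close>

lemma partial_cover_universal_extension:
  assumes ij: "i \<in> {1..t}" "j \<in> {1..t}" "i \<le> j" "i < j \<or> brick \<C> (\<Theta> i)"
    and u: "universal_extension \<C> M (\<Theta> j) E a" and M: "partial_cover i j M"
  shows "partial_cover i j E"
proof -
  obtain d \<delta> where basis: "D_basis \<C> M (\<Theta> j) d \<delta>" and ud: "if d = 0 then E = M \<and> a = Ident \<C> M
      else \<exists>S \<iota> \<pi> f. direct_sum \<C> {..<d} (\<lambda>_. \<Theta> j) S \<iota> \<pi> \<and> conflation \<C> S f E a M (\<Sum>i<d. push \<C> (\<iota> i) (\<delta> i))"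
    using u unfolding universal_extension_def by blast
  show ?thesis
  proof (cases "d = 0")
    case True
    then show ?thesis using ud M by simp
  next
    case False
    then obtain S \<iota> \<pi> f where S: "direct_sum \<C> {..<d} (\<lambda>_. \<Theta> j) S \<iota> \<pi>"
      and c: "conflation \<C> S f E a M (\<Sum>i<d. push \<C> (\<iota> i) (\<delta> i))" using ud by auto
    obtain K f0 \<alpha> \<delta>0 where K: "conflation \<C> K f0 M \<alpha> (\<Theta> i) \<delta>0" "K \<in> filtered \<C> (\<Theta> ` {i..t})"
      "\<And>l. l \<in> {1..<j} \<Longrightarrow> Ext \<C> M (\<Theta> l) = {0}" "\<And>g. g \<in> Hom \<C> M (\<Theta> i) \<Longrightarrow> \<exists>h\<in>Hom \<C> (\<Theta> i) (\<Theta> i). g = h \<cdot> \<alpha>"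
      using M unfolding partial_cover_def by blast
    note s = direct_sumD[OF S] and cc = conflationD[OF c] and k = conflationD[OF K(1)]
    have Sf: "S \<in> filtered \<C> {\<Theta> j}"
      by (rule finite_sums_filtered[OF direct_sum_in_finite_sums[OF S]]) (auto intro: filtered_single)
    \<comment> \<open>The kernel \<open>E'\<close> of the composite deflation is an extension of the
      old kernel \<open>K\<close> by \<open>S\<close>, hence filtered.\<close>
    obtain E' h' d' e \<delta>'' where E': "conflation \<C> E' h' E (\<alpha> \<cdot> a) (\<Theta> i) \<delta>''"
      "conflation \<C> S e E' d' K (pull \<C> f0 (\<Sum>i<d. push \<C> (\<iota> i) (\<delta> i)))"
      using ET4_op[OF K(1) c] by blast
    have "S \<in> filtered \<C> (\<Theta> ` {i..t})" by (rule filtered_mono[OF _ Sf]) (use ij in auto)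
    then have E'f: "E' \<in> filtered \<C> (\<Theta> ` {i..t})" by (rule filtered_extension[OF _ K(2) E'(2)])
    \<comment> \<open>By (MS3) the copies of \<open>\<Theta> j\<close> in \<open>S\<close> have no
      extensions by earlier members, so what was killed before stays killed.\<close>
    have ext: "Ext \<C> E (\<Theta> l) = {0}" if l: "l \<in> {1..<j}" for l
    proof (rule ext_vanish_contravariant[OF c _ K(3)[OF l]])
      show "Ext \<C> S (\<Theta> l) = {0}"
        by (rule filtered_ext_vanish_left[OF Sf]) (use ext_zero_downwards[OF ij(2), of l] l ij in auto)
    qed
    have kernel: "g \<cdot> f = 0" if g: "g \<in> Hom \<C> E (\<Theta> i)" for g
    proof (cases "i < j")
      case True
      have "Hom \<C> S (\<Theta> i) = {0}"
        by (rule filtered_hom_vanish_left[OF Sf]) (use hom_zero_downwards[OF ij(2,1) True] in auto)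
      then show ?thesis using comp_hom[OF g cc(2)] by simp
    next
      case False
      then have i: "i = j" and N: "brick \<C> (\<Theta> j)" using ij by auto
      let ?N = "\<Theta> j"
      define \<phi> where "\<phi> = g \<cdot> f"
      have \<phi>: "\<phi> \<in> Hom \<C> S ?N" using comp_hom[OF g cc(2)] i by (simp add: \<phi>_def)
      have \<delta>: "\<delta> k \<in> Ext \<C> M ?N" if "k < d" for k using basis that by (simp add: D_basis_def)
      have \<iota>: "\<iota> k \<in> Hom \<C> ?N S" if "k < d" for k using s(2) that by simp
      have \<phi>\<iota>: "\<phi> \<cdot> \<iota> k \<in> Hom \<C> ?N ?N" if "k < d" for k using comp_hom[OF \<phi> \<iota>[OF that]] .
      \<comment> \<open>The class of a conflation vanishes when pushed along its inflation
        \<open>f\<close>, hence also along \<open>g \<cdot> f\<close>; written in components this is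
        a relation among the \<open>\<delta> k\<close>.\<close>
      have "push \<C> \<phi> (\<Sum>k<d. push \<C> (\<iota> k) (\<delta> k)) = 0"
        using push_comp[OF g cc(2,1)] push_inflation[OF c] push_zero[OF g] by (simp add: \<phi>_def)
      moreover have "push \<C> \<phi> (\<Sum>k<d. push \<C> (\<iota> k) (\<delta> k)) = (\<Sum>k<d. push \<C> \<phi> (push \<C> (\<iota> k) (\<delta> k)))"
        by (rule push_sum[OF \<phi>]) (use push_ext[OF \<iota> \<delta>] in auto)
      moreover have "(\<Sum>k<d. push \<C> \<phi> (push \<C> (\<iota> k) (\<delta> k))) = (\<Sum>k<d. push \<C> (\<phi> \<cdot> \<iota> k) (\<delta> k))"
        by (rule sum.cong[OF refl]) (use push_comp[OF \<phi> \<iota> \<delta>] in auto)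
      ultimately have rel: "(\<Sum>k<d. push \<C> (\<phi> \<cdot> \<iota> k) (\<delta> k)) = 0" by simp
      have z: "\<phi> \<cdot> \<iota> k = 0" if "k < d" for k by (rule D_basis_brick_independent[OF basis N \<phi>\<iota> rel that])
      have "\<phi> = \<phi> \<cdot> (\<Sum>k<d. \<iota> k \<cdot> \<pi> k)" using s(5) id_right[OF \<phi>] by simp
      also have "\<dots> = (\<Sum>k<d. \<phi> \<cdot> (\<iota> k \<cdot> \<pi> k))"
        by (rule comp_sum_right[OF \<phi> comp_hom[OF s(2,3)]])
      also have "\<dots> = 0"
        by (rule sum.neutral) (use comp_reduce_zero[OF z \<phi> s(2,3)] in auto)
      finally show ?thesis by (simp add: \<phi>_def)
    qed
    have hom: "\<exists>h\<in>Hom \<C> (\<Theta> i) (\<Theta> i). g = h \<cdot> (\<alpha> \<cdot> a)" if g: "g \<in> Hom \<C> E (\<Theta> i)" for g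
    proof -
      obtain g' where g': "g' \<in> Hom \<C> M (\<Theta> i)" "g = g' \<cdot> a" using hom_factor_deflation[OF c g kernel[OF g]] by blast
      obtain h where h: "h \<in> Hom \<C> (\<Theta> i) (\<Theta> i)" "g' = h \<cdot> \<alpha>" using K(4)[OF g'(1)] by blast
      have "g = h \<cdot> (\<alpha> \<cdot> a)" using g'(2) h(2) comp_assoc[OF h(1) k(3) cc(3)] by simp
      then show ?thesis using h(1) by blast
    qed
    show ?thesis unfolding partial_cover_def using E'(1) E'f ext hom by blast
  qed
qed

text \<open>If the deflation is invertible, the universal class is zero, and so are all its
  components. Members of a basis are nonzero, so the basis is empty; in that case the universal
  extension is by definition \<open>M\<close> itself.\<close>

lemma universal_extension_iso:
  assumes N: "Ident \<C> N \<noteq> 0" and u: "universal_extension \<C> M N E a" and iso: "is_iso \<C> E M a"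
  shows "E = M \<and> Ext \<C> M N = {0}"
proof -
  obtain d \<delta> where basis: "D_basis \<C> M N d \<delta>" and ud: "if d = 0 then E = M \<and> a = Ident \<C> M
      else \<exists>S \<iota> \<pi> f. direct_sum \<C> {..<d} (\<lambda>_. N) S \<iota> \<pi> \<and> conflation \<C> S f E a M (\<Sum>i<d. push \<C> (\<iota> i) (\<delta> i))"
    using u unfolding universal_extension_def by blast
  have "d = 0"
  proof (rule ccontr)
    assume d: "d \<noteq> 0"
    obtain S \<iota> \<pi> f where S: "direct_sum \<C> {..<d} (\<lambda>_. N) S \<iota> \<pi>"
      and c: "conflation \<C> S f E a M (\<Sum>i<d. push \<C> (\<iota> i) (\<delta> i))" using ud d by auto
    note s = direct_sumD[OF S] and cc = conflationD[OF c]
    let ?\<epsilon> = "\<Sum>k<d. push \<C> (\<iota> k) (\<delta> k)"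
    obtain b where b: "b \<in> Hom \<C> M E" "a \<cdot> b = Ident \<C> M" using iso by (rule is_isoE)
    have e0: "?\<epsilon> = 0"
      using pull_comp[OF cc(3) b(1) cc(1)] b(2) pull_id[OF cc(1)] pull_deflation[OF c] pull_zero[OF b(1)] by simp
    have \<delta>: "\<delta> k \<in> Ext \<C> M N" if "k < d" for k using basis that by (simp add: D_basis_def)
    have z: "\<delta> k = 0" if k: "k < d" for k
    proof -
      have \<pi>: "\<pi> k \<in> Hom \<C> S N" and \<iota>: "\<And>l. l < d \<Longrightarrow> \<iota> l \<in> Hom \<C> N S" using s(2,3) k by simp_all
      \<comment> \<open>Pushing the universal class along the projection \<open>\<pi> k\<close>
        recovers its component \<open>\<delta> k\<close>.\<close>
      have "push \<C> (\<pi> k) ?\<epsilon> = (\<Sum>l<d. push \<C> (\<pi> k) (push \<C> (\<iota> l) (\<delta> l)))"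
        by (rule push_sum[OF \<pi>]) (use push_ext[OF \<iota> \<delta>] in auto)
      also have "\<dots> = (\<Sum>l<d. if l = k then \<delta> k else 0)"
      proof (rule sum.cong[OF refl])
        fix l assume "l \<in> {..<d}"
        then have l: "l < d" by simp
        have "push \<C> (\<pi> k) (push \<C> (\<iota> l) (\<delta> l)) = push \<C> (if k = l then Ident \<C> N else 0) (\<delta> l)"
          using push_comp[OF \<pi> \<iota>[OF l] \<delta>[OF l]] s(4)[of k l] k l by simp
        then show "push \<C> (\<pi> k) (push \<C> (\<iota> l) (\<delta> l)) = (if l = k then \<delta> k else 0)"
          using push_id[OF \<delta>[OF l]] push_zero_hom[OF \<delta>[OF l]] by auto
      qed
      also have "\<dots> = \<delta> k" using k by simp
      finally show ?thesis using e0 push_zero[OF \<pi>] by simp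
    qed
    show False
    proof (cases "brick \<C> N")
      case True
      have "(\<Sum>k<d. push \<C> (Ident \<C> N) (\<delta> k)) = 0" using z push_zero[OF id_hom] by simp
      then show False using D_basis_brick_independent[OF basis True id_hom, of 0] d N by simp
    next
      case False
      interpret vector_space "escale \<C>" by (rule ext_ambient)
      have "(\<Sum>k<d. escale \<C> 1 (\<delta> k)) = 0" using z by simp
      then show False using D_basis_scalar_independent[OF basis False, of "\<lambda>_. 1" 0] d by simp
    qed
  qed
  then have "Ext \<C> M N = {0}"
    using basis by (intro ext_vanishI) (auto simp: D_basis_def split: if_splits)
  then show ?thesis using ud \<open>d = 0\<close> by simp
qed

text \<open>Starting from \<open>\<Theta> i\<close>, the universal extensions by each
  \<open>\<Theta> j\<close> are run until one of them is an isomorphism, which raises the stage by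
  one.\<close>

lemma partial_cover_exists:
  assumes adm: "admits_universal_extensions \<C> (Filt \<C> (dsum \<C> {1..t} \<Theta>)) t \<Theta>" and i: "i \<in> {1..t}"
  shows "\<exists>P. partial_cover i (Suc t) P"
proof -
  have F: "Filt \<C> (dsum \<C> {1..t} \<Theta>) = filtered \<C> (\<Theta> ` {1..t})" using Filt_filtered[of 1] i by simp
  have start: "partial_cover i j (\<Theta> i)" if "\<forall>l\<in>{1..<j}. Ext \<C> (\<Theta> i) (\<Theta> l) = {0}" for j
  proof -
    obtain Z where Z: "zero_object \<C> Z" "conflation \<C> Z 0 (\<Theta> i) (Ident \<C> (\<Theta> i)) (\<Theta> i) 0"
      using conflation_id_left[of "\<Theta> i"] by blast
    have h: "\<forall>g\<in>Hom \<C> (\<Theta> i) (\<Theta> i). \<exists>h\<in>Hom \<C> (\<Theta> i) (\<Theta> i). g = h \<cdot> Ident \<C> (\<Theta> i)"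
      by (metis id_right)
    show ?thesis unfolding partial_cover_def
      by (intro exI conjI) (rule Z(2) filtered_zero[OF Z(1)] that h)+
  qed
  have step: "\<exists>P. partial_cover i (Suc j) P"
    if j: "j \<in> {1..t}" "i \<le> j" "i < j \<or> brick \<C> (\<Theta> i)" and P: "partial_cover i j P" for j P
  proof -
    obtain K f \<alpha> \<delta> where K: "conflation \<C> K f P \<alpha> (\<Theta> i) \<delta>" "K \<in> filtered \<C> (\<Theta> ` {i..t})"
      using P unfolding partial_cover_def by blast
    have "K \<in> filtered \<C> (\<Theta> ` {1..t})" by (rule filtered_mono[OF _ K(2)]) (use i in auto)
    moreover have "\<Theta> i \<in> filtered \<C> (\<Theta> ` {1..t})" using i by (intro filtered_single) simp
    ultimately have "P \<in> Filt \<C> (dsum \<C> {1..t} \<Theta>)" using filtered_extension[OF _ _ K(1)] F by simp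
    then obtain Q a where Q: "Q 0 = P" "\<forall>s\<ge>1::nat. universal_extension \<C> (Q (s - 1)) (\<Theta> j) (Q s) (a s)"
      "\<exists>s\<ge>1::nat. is_iso \<C> (Q s) (Q (s - 1)) (a s)"
      using adm j(1) unfolding admits_universal_extensions_def admits_universal_extensions_by_def by blast
    have pc: "partial_cover i j (Q s)" for s
    proof (induction s)
      case (Suc s)
      have "universal_extension \<C> (Q s) (\<Theta> j) (Q (Suc s)) (a (Suc s))" using Q(2)[rule_format, of "Suc s"] by simp
      then show ?case by (rule partial_cover_universal_extension[OF i j _ Suc])
    qed (use Q(1) P in simp)
    obtain s where s: "s \<ge> 1" "is_iso \<C> (Q s) (Q (s - 1)) (a s)" using Q(3) by blast
    have "Ident \<C> (\<Theta> j) \<noteq> 0" using theta_local[OF j(1)] by (simp add: local_endomorphism_ring_def)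
    \<comment> \<open>The isomorphism at step \<open>s\<close> forces
      \<open>Q s = Q (s - 1)\<close>, so it is the object \<open>Q s\<close> that has no extensions
      by \<open>\<Theta> j\<close>.\<close>
    then have e: "Ext \<C> (Q s) (\<Theta> j) = {0}"
      using universal_extension_iso[OF _ Q(2)[rule_format, OF s(1)] s(2)] by simp
    have "{1..<Suc j} = insert j {1..<j}" using j(1) by auto
    then have "partial_cover i (Suc j) (Q s)" using pc[of s] e unfolding partial_cover_def by simp
    then show ?thesis by blast
  qed
  have below: "\<forall>l\<in>{1..<i}. Ext \<C> (\<Theta> i) (\<Theta> l) = {0}" using ext_zero_downwards[OF i] i by auto
  have first: "\<exists>P. partial_cover i (Suc i) P"
  \<comment> \<open>A brick may have self-extensions and needs a round of universal extensions by
    itself. Otherwise \<open>\<Theta> i\<close> is a stone and is already at stage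
    \<open>Suc i\<close>.\<close>
  proof (cases "brick \<C> (\<Theta> i)")
    case True
    then show ?thesis using step[OF i _ _ start[OF below]] by simp
  next
    case False
    then have "Ext \<C> (\<Theta> i) (\<Theta> i) = {0}" using brick_or_stone[OF i] by (simp add: stone_def)
    moreover have "{1..<Suc i} = insert i {1..<i}" using i by auto
    ultimately show ?thesis using start[of "Suc i"] below by auto
  qed
  \<comment> \<open>The final stage is \<open>Suc t\<close>, as stage \<open>j\<close> speaks only
    of indices below \<open>j\<close>.\<close>
  have "Suc i \<le> Suc t" using i by simp
  then show ?thesis
  proof (induction rule: dec_induct)
    case (step n)
    then obtain P where "partial_cover i n P" by blast
    then show ?case using \<open>\<And>j P. j \<in> {1..t} \<Longrightarrow> i \<le> j \<Longrightarrow> i < j \<or> brick \<C> (\<Theta> i) \<Longrightarrow> partial_cover i j P \<Longrightarrow> \<exists>P. partial_cover i (Suc j) P\<close>[of n P] step.hyps by simp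
  qed (rule first)
qed

text \<open>
  Write the identity of a cover \<open>P\<close> as a sum of projections onto local summands. Each of them induces an endomorphism of
  the object \<open>\<Theta>(i)\<close> with local endomorphism ring, so for one summand \<open>X\<close> it is invertible; \<open>\<alpha>\<close> then factors through \<open>X\<close>, and
  the complement of \<open>X\<close> splits off from the kernel.
\<close>

lemma minimal_cover:
  assumes i: "i \<in> {1..t}" and c: "conflation \<C> K f P \<alpha> (\<Theta> i) \<delta>" and K: "K \<in> filtered \<C> (\<Theta> ` {i..t})"
    and surj: "\<And>g. g \<in> Hom \<C> P (\<Theta> i) \<Longrightarrow> \<exists>h\<in>Hom \<C> (\<Theta> i) (\<Theta> i). g = h \<cdot> \<alpha>"
  shows "\<exists>K' f' X \<alpha>' \<delta>' s r. conflation \<C> K' f' X \<alpha>' (\<Theta> i) \<delta>' \<and> K' \<in> filtered \<C> (\<Theta> ` {i..t}) \<and>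
    indecomposable \<C> X \<and> right_minimal \<C> X \<alpha>' \<and> s \<in> Hom \<C> X P \<and> r \<in> Hom \<C> P X \<and> r \<cdot> s = Ident \<C> X"
proof -
  let ?T = "\<Theta> i"
  note cc = conflationD[OF c]
  have neg: "NExt \<C> K ?T = {0}"
    by (rule filtered_next_vanish_left[OF K]) (use next_theta[OF _ i] i in auto)
  obtain n :: nat and Y \<iota> \<pi> where ds: "direct_sum \<C> {..<n} Y P \<iota> \<pi>" and loc: "\<forall>k<n. local_endomorphism_ring \<C> (Y k)"
    using krull_schmidt[of P] by blast
  note d = direct_sumD[OF ds]
  have m\<iota>\<pi>: "\<iota> k \<cdot> \<pi> k \<in> Hom \<C> P P" if "k \<in> {..<n}" for k using comp_hom[OF d(2)[OF that] d(3)[OF that]] .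
  have m\<alpha>: "\<alpha> \<cdot> (\<iota> k \<cdot> \<pi> k) \<in> Hom \<C> P ?T" if "k \<in> {..<n}" for k using comp_hom[OF cc(3) m\<iota>\<pi>[OF that]] .
  have "\<forall>k\<in>{..<n}. \<exists>h. h \<in> Hom \<C> ?T ?T \<and> \<alpha> \<cdot> (\<iota> k \<cdot> \<pi> k) = h \<cdot> \<alpha>" using surj[OF m\<alpha>] by blast
  then obtain g where g: "\<And>k. k \<in> {..<n} \<Longrightarrow> g k \<in> Hom \<C> ?T ?T" "\<And>k. k \<in> {..<n} \<Longrightarrow> \<alpha> \<cdot> (\<iota> k \<cdot> \<pi> k) = g k \<cdot> \<alpha>"
    by metis
  have sg: "(\<Sum>k<n. g k) \<in> Hom \<C> ?T ?T" using g(1) by (rule hom_sum)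
  have "(\<Sum>k<n. g k) \<cdot> \<alpha> = (\<Sum>k<n. g k \<cdot> \<alpha>)" by (rule comp_sum_left[OF g(1) cc(3)])
  also have "\<dots> = (\<Sum>k<n. \<alpha> \<cdot> (\<iota> k \<cdot> \<pi> k))" using g(2) by simp
  also have "\<dots> = \<alpha> \<cdot> (\<Sum>k<n. \<iota> k \<cdot> \<pi> k)" by (rule comp_sum_right[OF cc(3) m\<iota>\<pi>, symmetric])
  also have "\<dots> = Ident \<C> ?T \<cdot> \<alpha>" using d(5) id_right[OF cc(3)] id_left[OF cc(3)] by simp
  finally have "((\<Sum>k<n. g k) - Ident \<C> ?T) \<cdot> \<alpha> = 0" using comp_diff_left[OF sg id_hom cc(3)] by simp
  \<comment> \<open>Endomorphisms of \<open>\<Theta> i\<close> are determined by their composite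
    with \<open>\<alpha>\<close>, because \<open>K\<close> has no negative extensions by
    \<open>\<Theta> i\<close>.\<close>
  then have "(\<Sum>k<n. g k) - Ident \<C> ?T = 0" by (rule deflation_epi[OF c neg hom_diff[OF sg id_hom]])
  then have "is_iso \<C> ?T ?T (\<Sum>k<n. g k)" using is_iso_id[of ?T] by simp
  then obtain k where k: "k \<in> {..<n}" "is_iso \<C> ?T ?T (g k)"
    using local_sum_iso[OF theta_local[OF i] finite_lessThan, of n g] g(1) by blast
  obtain u where u: "u \<in> Hom \<C> ?T ?T" "u \<cdot> g k = Ident \<C> ?T" using k(2) by (rule is_isoE)
  define X s r \<alpha>' where "X = Y k" "s = \<iota> k" "r = \<pi> k" "\<alpha>' = \<alpha> \<cdot> s"
  have s: "s \<in> Hom \<C> X P" and r: "r \<in> Hom \<C> P X" and rs: "r \<cdot> s = Ident \<C> X" and lX: "local_endomorphism_ring \<C> X"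
    using d(2,3)[OF k(1)] d(4)[OF k(1,1)] loc k(1) by (simp_all add: X_s_r_\<alpha>'_def)
  have \<alpha>': "\<alpha>' \<in> Hom \<C> X ?T" using comp_hom[OF cc(3) s] by (simp add: X_s_r_\<alpha>'_def)
  have u\<alpha>': "u \<cdot> \<alpha>' \<in> Hom \<C> X ?T" using comp_hom[OF u(1) \<alpha>'] .
  \<comment> \<open>Inverting \<open>g k\<close> makes \<open>\<alpha>\<close> factor through
    \<open>r\<close> up to the factor \<open>u\<close>; composition with \<open>s\<close> shows
    \<open>u \<cdot> \<alpha>' = \<alpha>'\<close>, which removes it.\<close>
  have "\<alpha> = u \<cdot> (g k \<cdot> \<alpha>)" using comp_cancel[OF u(2,1) g(1)[OF k(1)] cc(3)] by simp
  also have "g k \<cdot> \<alpha> = \<alpha>' \<cdot> r" using g(2)[OF k(1)] comp_assoc[OF cc(3) s r] by (simp add: X_s_r_\<alpha>'_def)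
  finally have \<alpha>1: "\<alpha> = (u \<cdot> \<alpha>') \<cdot> r" using comp_assoc[OF u(1) \<alpha>' r] by simp
  have "\<alpha>' = ((u \<cdot> \<alpha>') \<cdot> r) \<cdot> s" using \<alpha>1 by (simp add: X_s_r_\<alpha>'_def(4))
  also have "\<dots> = u \<cdot> \<alpha>'" using comp_assoc[OF u\<alpha>' r s] rs id_right[OF u\<alpha>'] by simp
  finally have \<alpha>r: "\<alpha> = \<alpha>' \<cdot> r" using \<alpha>1 by simp
  have \<alpha>s: "\<alpha> \<cdot> s = \<alpha>'" by (simp add: X_s_r_\<alpha>'_def(4))
  have "\<alpha>' \<noteq> 0"
  proof
    assume "\<alpha>' = 0"
    then have "Ident \<C> ?T \<cdot> \<alpha> = 0" using \<alpha>r comp_zero_left[OF r] comp_zero_right[OF id_hom] by simp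
    then have "Ident \<C> ?T = 0" by (rule deflation_epi[OF c neg id_hom])
    then show False using theta_local[OF i] by (simp add: local_endomorphism_ring_def)
  qed
  \<comment> \<open>As \<open>X\<close> is local, \<open>h\<close> or \<open>1 - h\<close> is
    invertible; the latter is annihilated by the nonzero map \<open>\<alpha>'\<close>.\<close>
  have min: "is_iso \<C> X X h" if h: "h \<in> Hom \<C> X X" "\<alpha>' \<cdot> h = \<alpha>'" for h
  proof -
    have h': "Ident \<C> X - h \<in> Hom \<C> X X" using hom_diff[OF id_hom h(1)] .
    have "is_iso \<C> X X (h + (Ident \<C> X - h))" using is_iso_id[of X] by simp
    then have "is_iso \<C> X X h \<or> is_iso \<C> X X (Ident \<C> X - h)"
      using lX h(1) h' unfolding local_endomorphism_ring_def by blast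
    moreover have "\<alpha>' \<cdot> (Ident \<C> X - h) = 0" using comp_diff_right[OF \<alpha>' id_hom h(1)] h(2) id_right[OF \<alpha>'] by simp
    ultimately show ?thesis using is_iso_zero_comp_right[OF _ \<alpha>'] \<open>\<alpha>' \<noteq> 0\<close> by blast
  qed
  obtain R j q where "biproduct \<C> X R P s j r q" using retract_complement[OF s r rs] by blast
  note b = biproductD[OF this]
  \<comment> \<open>The complement \<open>R\<close> maps to zero in \<open>\<Theta> i\<close>, so
    its inclusion factors through \<open>K\<close>, where \<open>q \<cdot> f\<close> retracts
    it.\<close>
  have "\<alpha> \<cdot> j = 0" using \<alpha>r comp_assoc[OF \<alpha>' r b(2)] b(7) comp_zero_right[OF \<alpha>'] by simp
  then obtain l where l: "l \<in> Hom \<C> R K" "j = f \<cdot> l" using hom_factor_inflation[OF c b(2)] by blast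
  have qf: "q \<cdot> f \<in> Hom \<C> K R" using comp_hom[OF b(4) cc(2)] .
  have "(q \<cdot> f) \<cdot> l = Ident \<C> R" using comp_assoc[OF b(4) cc(2) l(1)] l(2) b(6) by simp
  then obtain K' iK pK where bK: "biproduct \<C> R K' K l iK (q \<cdot> f) pK" using retract_complement[OF l(1) qf] by blast
  note k' = biproductD[OF bK]
  have K': "K' \<in> filtered \<C> (\<Theta> ` {i..t})" using filtered_summand[OF _ _ K biproduct_swap[OF bK]] i by simp
  \<comment> \<open>\<open>\<delta>\<close> is pushed to the complement \<open>K'\<close> of
    \<open>R\<close> in \<open>K\<close>. The realization \<open>X'\<close> of the result will be
    shown to be isomorphic to \<open>X\<close> over \<open>\<Theta> i\<close>.\<close>
  define \<epsilon> where "\<epsilon> = push \<C> pK \<delta>"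
  have \<epsilon>: "\<epsilon> \<in> Ext \<C> ?T K'" unfolding \<epsilon>_def using push_ext[OF k'(4) cc(1)] .
  obtain X' x' y' where c': "conflation \<C> K' x' X' y' ?T \<epsilon>" using conflation_exists[OF \<epsilon>] by blast
  note d' = conflationD[OF c']
  have "push \<C> pK \<delta> = pull \<C> (Ident \<C> ?T) \<epsilon>" using pull_id[OF \<epsilon>] by (simp add: \<epsilon>_def)
  then obtain v where v: "v \<in> Hom \<C> P X'" "v \<cdot> f = x' \<cdot> pK" "y' \<cdot> v = \<alpha>"
    using real_morphism[OF c c' k'(4) id_hom] id_left[OF cc(3)] by auto
  have lq: "l \<cdot> (q \<cdot> f) \<in> Hom \<C> K K" "iK \<cdot> pK \<in> Hom \<C> K K" using comp_hom[OF l(1) qf] comp_hom[OF k'(2,4)] by auto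
  \<comment> \<open>The idempotent of \<open>K\<close> belonging to \<open>R\<close> factors through
    the inflation \<open>f\<close>, so it kills \<open>\<delta>\<close>. Thus
    \<open>\<delta>\<close> comes entirely from \<open>K'\<close>, which gives the map
    \<open>w\<close> back to \<open>P\<close>.\<close>
  have "push \<C> (l \<cdot> (q \<cdot> f)) \<delta> = 0"
    using push_comp[OF l(1) qf cc(1)] push_comp[OF b(4) cc(2,1)] push_inflation[OF c] push_zero[OF b(4)] push_zero[OF l(1)] by simp
  then have "push \<C> (iK \<cdot> pK) \<delta> = \<delta>" using push_add_hom[OF lq cc(1)] k'(9) push_id[OF cc(1)] by simp
  then have "push \<C> iK \<epsilon> = pull \<C> (Ident \<C> ?T) \<delta>" using push_comp[OF k'(2,4) cc(1)] pull_id[OF cc(1)] by (simp add: \<epsilon>_def)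
  then obtain w where w: "w \<in> Hom \<C> X' P" "w \<cdot> x' = f \<cdot> iK" "\<alpha> \<cdot> w = y'"
    using real_morphism[OF c' c k'(2) id_hom] id_left[OF d'(3)] by auto
  \<comment> \<open>Both composites of \<open>v \<cdot> s\<close> and \<open>r \<cdot> w\<close> are
    invertible: on \<open>X\<close> by minimality of \<open>\<alpha>'\<close>, on \<open>X'\<close>
    because \<open>v\<close> kills \<open>R\<close>, so that the composite is
    \<open>v \<cdot> w\<close>, which is the identity on both ends.\<close>
  have vs: "v \<cdot> s \<in> Hom \<C> X X'" and rw: "r \<cdot> w \<in> Hom \<C> X' X" using comp_hom v(1) w(1) s r by blast+
  have \<alpha>rw: "\<alpha>' \<cdot> (r \<cdot> w) = y'" using comp_assoc[OF \<alpha>' r w(1)] \<alpha>r w(3) by simp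
  have "y' \<cdot> (v \<cdot> s) = \<alpha>'" using comp_assoc[OF d'(3) v(1) s] v(3) \<alpha>s by simp
  then have "\<alpha>' \<cdot> ((r \<cdot> w) \<cdot> (v \<cdot> s)) = \<alpha>'" using comp_assoc[OF \<alpha>' rw vs] \<alpha>rw by simp
  then have iso1: "is_iso \<C> X X ((r \<cdot> w) \<cdot> (v \<cdot> s))" by (rule min[OF comp_hom[OF rw vs]])
  have vw: "v \<cdot> w \<in> Hom \<C> X' X'" using comp_hom[OF v(1) w(1)] .
  have qw: "q \<cdot> w \<in> Hom \<C> X' R" "j \<cdot> (q \<cdot> w) \<in> Hom \<C> X' P" "s \<cdot> (r \<cdot> w) \<in> Hom \<C> X' P"
    using comp_hom[OF b(4) w(1)] comp_hom[OF b(2) comp_hom[OF b(4) w(1)]] comp_hom[OF s rw] by auto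
  have vj: "v \<cdot> j = 0"
    using l(2) comp_reduce[OF v(2,1) cc(2) l(1)] comp_assoc[OF d'(2) k'(4) l(1)] k'(8) comp_zero_right[OF d'(2)] by simp
  have "w = s \<cdot> (r \<cdot> w) + j \<cdot> (q \<cdot> w)"
    using comp_add_left[OF comp_hom[OF s r] comp_hom[OF b(2,4)] w(1)] b(9) id_left[OF w(1)]
      comp_assoc[OF s r w(1)] comp_assoc[OF b(2,4) w(1)] by simp
  then have "v \<cdot> w = v \<cdot> (s \<cdot> (r \<cdot> w)) + v \<cdot> (j \<cdot> (q \<cdot> w))" using comp_add_right[OF v(1) qw(3,2)] by simp
  then have fact: "(v \<cdot> s) \<cdot> (r \<cdot> w) = v \<cdot> w"
    using comp_reduce_zero[OF vj v(1) b(2) qw(1)] comp_assoc[OF v(1) s rw] by simp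
  have "is_iso \<C> X' X' (v \<cdot> w)"
  proof (rule conflation_endo_iso[OF c' vw])
    show "v \<cdot> w \<cdot> x' = x'"
      using comp_assoc[OF v(1) w(1) d'(2)] w(2) comp_reduce[OF v(2,1) cc(2) k'(2)] comp_assoc[OF d'(2) k'(4,2)] k'(6) id_right[OF d'(2)] by simp
    show "y' \<cdot> (v \<cdot> w) = y'" using comp_reduce[OF v(3) d'(3) v(1) w(1)] w(3) by simp
  qed
  then have iso2: "is_iso \<C> X' X' ((v \<cdot> s) \<cdot> (r \<cdot> w))" using fact by simp
  have "is_iso \<C> X' X (r \<cdot> w)" by (rule is_iso_two_sided[OF rw vs iso2 iso1])
  then have "conflation \<C> K' ((r \<cdot> w) \<cdot> x') X \<alpha>' ?T \<epsilon>" by (rule conflation_iso[OF c' _ \<alpha>' \<alpha>rw])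
  moreover have "right_minimal \<C> X \<alpha>'" unfolding right_minimal_def using min by blast
  ultimately show ?thesis using K' local_indecomposable[OF lX] s r rs by blast
qed

end

section \<open>Indecomposable projectives over the standardizable set and the stratifying
  system\<close>

theorem theorem3p17:
  fixes \<C> :: "('o, 'm::ab_group_add, 'k::field, 'e::ab_group_add, 'n::ab_group_add) neg_extri_cat"
    and t :: nat and \<Theta> :: "nat \<Rightarrow> 'o"
  assumes "krull_schmidt_negative_extriangulated_category \<C>"
    and "mixed_standardizable \<C> t \<Theta>"
    and "ext_finite \<C> (add_closure \<C> (dsum \<C> {1..t} \<Theta>))"
    and "admits_universal_extensions \<C> (Filt \<C> (dsum \<C> {1..t} \<Theta>)) t \<Theta>"
  shows "(\<forall>i\<in>{1..t}. \<exists>K f P \<alpha> \<delta>.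
            conflation \<C> K f P \<alpha> (\<Theta> i) \<delta> \<and> K \<in> Filt \<C> (dsum \<C> {i..t} \<Theta>) \<and>
            indecomposable \<C> P \<and> projective_in \<C> (Filt \<C> (dsum \<C> {1..t} \<Theta>)) P \<and>
            right_minimal \<C> P \<alpha>) \<and>
         (\<forall>P. (\<forall>i\<in>{1..t}. \<exists>K f \<alpha> \<delta>.
            conflation \<C> K f (P i) \<alpha> (\<Theta> i) \<delta> \<and> K \<in> Filt \<C> (dsum \<C> {i..t} \<Theta>) \<and>
            indecomposable \<C> (P i) \<and> projective_in \<C> (Filt \<C> (dsum \<C> {1..t} \<Theta>)) (P i) \<and>
            right_minimal \<C> (P i) \<alpha>)
          \<longrightarrow> mixed_stratifying_system \<C> t \<Theta> P)"
proof (intro conjI ballI allI impI)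
  interpret mixed_standardizable_set \<C> t \<Theta>
    using assms(1,2) by (simp add: mixed_standardizable_set_def mixed_standardizable_set_axioms_def)
  fix i assume i: "i \<in> {1..t}"
  have F: "Filt \<C> (dsum \<C> {1..t} \<Theta>) = filtered \<C> (\<Theta> ` {1..t})" using Filt_filtered[of 1] i by simp
  obtain P where "partial_cover i (Suc t) P" using partial_cover_exists[OF assms(4) i] by blast
  then obtain K f \<alpha> \<delta> where K: "conflation \<C> K f P \<alpha> (\<Theta> i) \<delta>" "K \<in> filtered \<C> (\<Theta> ` {i..t})"
    and ext: "\<And>l. l \<in> {1..<Suc t} \<Longrightarrow> Ext \<C> P (\<Theta> l) = {0}"
    and surj: "\<And>g. g \<in> Hom \<C> P (\<Theta> i) \<Longrightarrow> \<exists>h\<in>Hom \<C> (\<Theta> i) (\<Theta> i). g = h \<cdot>\<^bsub>\<C>\<^esub> \<alpha>"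
    unfolding partial_cover_def by blast
  obtain K' f' X \<alpha>' \<delta>' s r where X: "conflation \<C> K' f' X \<alpha>' (\<Theta> i) \<delta>'" "K' \<in> filtered \<C> (\<Theta> ` {i..t})"
    "indecomposable \<C> X" "right_minimal \<C> X \<alpha>'" "s \<in> Hom \<C> X P" "r \<in> Hom \<C> P X" "r \<cdot>\<^bsub>\<C>\<^esub> s = Ident \<C> X"
    using minimal_cover[OF i K surj] by blast
  have "K' \<in> filtered \<C> (\<Theta> ` {1..t})" by (rule filtered_mono[OF _ X(2)]) (use i in auto)
  moreover have "\<Theta> i \<in> filtered \<C> (\<Theta> ` {1..t})" using i by (intro filtered_single) simp
  ultimately have XF: "X \<in> filtered \<C> (\<Theta> ` {1..t})" using filtered_extension[OF _ _ X(1)] by simp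
  \<comment> \<open>Vanishing passes from \<open>P\<close> to its retract \<open>X\<close>, and then
    from the members of the set to all objects filtered by them.\<close>
  have "Ext \<C> X (\<Theta> l) = {0}" if "l \<in> {1..t}" for l
    by (rule ext_vanish_retract[OF X(5-7) ext]) (use that in auto)
  have "Ext \<C> X W = {0}" if "W \<in> filtered \<C> (\<Theta> ` {1..t})" for W
    by (rule filtered_ext_vanish_right[OF that]) (use \<open>\<And>l. l \<in> {1..t} \<Longrightarrow> Ext \<C> X (\<Theta> l) = {0}\<close> in auto)
  then have "projective_in \<C> (Filt \<C> (dsum \<C> {1..t} \<Theta>)) X" using XF F by (simp add: projective_in_def)
  then show "\<exists>K f P \<alpha> \<delta>. conflation \<C> K f P \<alpha> (\<Theta> i) \<delta> \<and> K \<in> Filt \<C> (dsum \<C> {i..t} \<Theta>) \<and>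
      indecomposable \<C> P \<and> projective_in \<C> (Filt \<C> (dsum \<C> {1..t} \<Theta>)) P \<and> right_minimal \<C> P \<alpha>"
    using X(1-4) Filt_filtered[OF i] by metis
next
  \<comment> \<open>The vanishing required of \<open>P i\<close> is contained in its projectivity;
    (MS1), (MS2) and (MS4) are common to standardizable sets and stratifying systems.\<close>
  fix P
  assume "\<forall>i\<in>{1..t}. \<exists>K f \<alpha> \<delta>. conflation \<C> K f (P i) \<alpha> (\<Theta> i) \<delta> \<and> K \<in> Filt \<C> (dsum \<C> {i..t} \<Theta>) \<and>
      indecomposable \<C> (P i) \<and> projective_in \<C> (Filt \<C> (dsum \<C> {1..t} \<Theta>)) (P i) \<and> right_minimal \<C> (P i) \<alpha>"
  then show "mixed_stratifying_system \<C> t \<Theta> P"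
    using assms(2) unfolding mixed_stratifying_system_def mixed_standardizable_def projective_in_def by blast
qed

end
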